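(* Let $\{w^k\}=\{(x^k,y^k,V_k)\}$ be an infinite sequence generated by Algorithm 2 (with scaling matrices equal to the identity) and suppose that Assumptions B and C hold. Then: 1. the full step-size $s^k_1=1$ is eventually adopted in Step 2-2; 2. $w^{k+1/2}+\Delta_1w^k\in\mathcal{N}_{\mu_k}^{\varepsilon_k}$, i.e., $R_{\mu_k}(w^{k+1/2}+\Delta_1w^k)\le\varepsilon_k=\gamma_1\mu_k^{1+\alpha}$, $F(x^{k+1/2}+\Delta_1x^k)\in S^m_{++}$, and $V_{k+1/2}+\Delta_1V_k\in S^m_{++}$, for all $k$ sufficiently large; and 3. $\|w^{k+1/2}+\Delta_1w^k-w^\ast\|=O\left(\|w^{k+1/2}-w^\ast\|\right)$.
   Context: Notation. $S^m$, $S^m_+$, $S^m_{++}$: real symmetric, positive semidefinite, positive definite $m\times m$ matrices. $X\circ Y=(XY+YX)/2$, $X\bullet Y=\mathrm{Tr}(XY)$, $\mathcal{L}_X(Z)=X\circ Z$ on $S^m$; $\mathrm{svec}(X)=(X_{11},\sqrt2X_{21},\ldots,\sqrt2X_{m1},X_{22},\sqrt2X_{32},\ldots,X_{mm})^\top$, and $X$ is identified with $\mathrm{svec}(X)$. $(\zeta)_+=\max(\zeta,0)$; $(F_i\bullet V)_{i=1}^n=(F_1\bullet V,\ldots,F_n\bullet V)^\top$. $\mathcal{M}_+(T)$ is the set of nonnegative finite regular Borel measures on $T$; $\mathrm{supp}(y)=\{\tau\in T:y(\{\tau\})\neq0\}$. Problem (SISDP). Minimize $f(x)$ over $x\in\mathbb{R}^n$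 subject to $g(x,\tau)\le0$ for all $\tau\in T$ and $F(x)\in S^m_+$, where $f$ is continuously differentiable, $g:\mathbb{R}^n\times T\to\mathbb{R}$ is continuous with $g(\cdot,\tau)$ convex and continuously differentiable, $F(x)=F_0+\sum_{i=1}^nx_iF_i$ with $F_i\in S^m$, and $T\subset\mathbb{R}^q$ is a bounded closed set formed by finitely many sufficiently smooth inequality constraints. The solution set is nonempty. A KKT point is $(x,y,V)$ with $\nabla f(x)+\int_T\nabla_xg(x,\tau)\,dy(\tau)-(F_i\bullet V)_{i=1}^n=0$; $F(x)\circ V=O$, $F(x),V\in S^m_+$; $\int_Tg(x,\tau)\,dy(\tau)=0$, $g(x,\tau)\le0$ $(\tau\in T)$, $y\in\mathcal{M}_+(T)$. For $\mu\ge0$, $R_\mu(x,y,V)=\sqrt{\theta(x)^2+\|\phi_1\|^2+\phi_2^2+\|\phi_3\|^2}$ with $\theta(x)=\max_{\tau\in T}(g(x,\tau))_+$, $\phi_1=\nabla f(x)+\int_T\nabla_xg(x,\tau)\,dy(\tau)-(F_i\bullet V)_{i=1}^n$, $\phi_2=\int_Tg(x,\tau)\,dy(\tau)$, $\phi_3=\mathrm{svec}(F(x)\circ V-\mu I)$; $\mathcal{N}_\mu^\varepsilon=\{w=(x,y,V)\in\mathbb{R}^n\times\mathcal{M}_+(T)\times S^m_{++}:R_\mu(w)\le\varepsilon,\ F(x)\in S^m_{++}\}$. Local reduction. Fix $\sigma>0$. Let $S(x)$ be the set of all local maximizers of $\max_{\tau\in T}g(x,\tau)$ and $S_\sigma(x)=\{\tau\in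 S(x):g(x,\tau)>\max_{\tau'\in T}g(x,\tau')-\sigma\}$. A point $\bar x$ is nondegenerate if $|S_\sigma(\bar x)|<\infty$ and the linear independence constraint qualification, the second-order sufficient conditions and strict complementarity for $\max_{\tau\in T}g(\bar x,\tau)$ hold at every $\tau\in S_\sigma(\bar x)$. Then there are an open neighborhood $U(\bar x)$, $p(\bar x)=|S_\sigma(\bar x)|$, and twice continuously differentiable $\tau^i_{\bar x}:U(\bar x)\to T$ ($1\le i\le p(\bar x)$) such that for $x\in U(\bar x)$ one has $S_\sigma(x)=\{\tau^i_{\bar x}(x)\}_{i}$ and these are strict local maximizers of $g(x,\cdot)$ on $T$. Put $\hat g_i(x)=g(x,\tau^i_{\bar x}(x))$, $\hat g=(\hat g_i)_i$, $L(x,y)=f(x)+\sum_iy_i\hat g_i(x)-F(x)\bullet V$ (its Hessian $\nabla^2_{xx}L$ in $x$ does not depend on $V$). A discrete measure supported on $\{\tau^i_{\bar x}(x)\}_i$ is identified with the vector of its masses $y_i=y(\{\tau^i_{\bar x}(x)\})$; in particular the vectors $y^{k+1/2}$ and $y^{k+1/2}+\Delta_1y^k$ below are regarded as measures with these masses at the points $\tau^i_{x^k}(x^{k+1/2})$ and $\tau^i_{x^k}(x^{k+1/2}+\Delta_1x^k)$, respectively. Algorithm 2 (with all scaling matrices equal to the identity). Parameters: $0<\alpha<1$, $0<\beta<1$, $\gamma_1,\gamma_2>0$, $\delta\in(0,1)$, $\mu_0>0$, $0<c\le\frac1{\alpha+2}$; $\varepsilon_0=\gamma_1\mu_0^{1+\alpha}$;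 $w^0=(x^0,y^0,V_0)$ with $y^0\in\mathcal{M}_+(T)$, $F(x^0),V_0\in S^m_{++}$. For $k=0,1,\ldots$ (stop if $w^k$ is a KKT point; here the sequence is infinite): Step 2-1. With $\hat g$ defined at $\bar x=x^k$, find $\Delta_{1/2}w^k=(\Delta_{1/2}x^k,\Delta_{1/2}y^k,\Delta_{1/2}V_k)$ as a solution $(\Delta x,\Delta y,\Delta V)$, at $(x,y,V)=w^k$ and $\mu=\mu_k$, of (a) $\nabla f(x)+\nabla^2_{xx}L(x,y)\Delta x+\nabla\hat g(x)(y+\Delta y)-(F_i\bullet(V+\Delta V))_{i=1}^n=0$, (b) $F(x)\circ(V+\Delta V)+\frac12\left(\mathcal{L}_V+\mathcal{L}_{F(x)}\mathcal{L}_V\mathcal{L}_{F(x)}^{-1}\right)\sum_{i=1}^n\Delta x_iF_i=\mu I$, (c) $0\le y+\Delta y\perp\hat g(x)+\nabla\hat g(x)^\top\Delta x\le0$. Set $w^{k+1/2}=(x^{k+1/2},y^{k+1/2},V_{k+1/2})=w^k+s^k_{1/2}\Delta_{1/2}w^k$. Let $J_a^k=\{i:\hat g_i(x^k)+\nabla\hat g_i(x^k)^\top\Delta_{1/2}x^k=0\}$. Step 2-2. Solve at $(x,y,V)=w^{k+1/2}$, $\mu=\mu_k$, the linear equations consisting of (a), (b) and $\hat g_i(x)+\nabla\hat g_i(x)^\top\Delta x=0$ $(i\in J_a^k)$, $y_i+\Delta y_i=0$ $(i\notin J_a^k)$. If solvable, call a solution $\Delta_1w^k=(\Delta_1x^k,\Delta_1y^k,\Delta_1V_k)$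 and compute $s^k_1$; if not solvable or not well-defined (the functions $\hat g_i$, $i\in J_a^k$, defined at $x^k$ not being valid at $x^{k+1/2}$), go to Step 2-4. Step 2-3. If $w^k_+:=w^{k+1/2}+s^k_1\Delta_1w^k\in\mathcal{N}_{\mu_k}^{\varepsilon_k}$, set $w^{k+1}=w^k_+$ and go to Step 3; otherwise go to Step 2-4. Step 2-4. Find some $w^{k+1}\in\mathcal{N}_{\mu_k}^{\varepsilon_k}$ (by an auxiliary interior-point SQP method). Step 3. $\mu_{k+1}=\min(\beta\mu_k,\gamma_2\mu_k^{1+c\alpha})$, $\varepsilon_{k+1}=\gamma_1\mu_{k+1}^{1+\alpha}$. Step sizes, $j\in\{\frac12,1\}$: $s^k_j=\min(t^k_j,u^k_j)$, where with $\lambda=\lambda_{\min}\left(F(x^{k+j-1/2})^{-1}\sum_i(\Delta_jx^k)_iF_i\right)$, $t^k_j=-\delta/\lambda$ if $\lambda\le-1$ and $t^k_j=1$ otherwise; $u^k_j$ is defined likewise with $\lambda=\lambda_{\min}(V_{k+j-1/2}^{-1}\Delta_jV_k)$. The paper's convergence analysis also fixes (for the sake of analysis) a constant $\tilde c$ with $\frac12<\tilde c<\frac{1-c}{1+c\alpha}<1$. Assumption B. (1) $\lim_{k\to\infty}w^k=w^\ast=(x^\ast,y^\ast,V_\ast)$, where $w^\ast$ is a KKT point of the SISDP. (2) $x^\ast$ is nondegenerate. (3) For sufficiently large $k$, $\{\tau^i_{x^k}(\cdot)\}_{i=1}^{p(x^k)}=\{\tau^i_{x^\ast}(\cdot)\}_{i=1}^{p(x^\ast)}$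 and $\mathrm{supp}(y^k)\subseteq\{\tau^1_{x^\ast}(x^k),\ldots,\tau^{p(x^\ast)}_{x^\ast}(x^k)\}$. Accordingly $y^k$ and $y^\ast$ are identified with vectors in $\mathbb{R}^{p(x^\ast)}$ with entries $y^k_i=y^k(\{\tau^i_{x^\ast}(x^k)\})$, $y^\ast_i=y^\ast(\{\tau^i_{x^\ast}(x^\ast)\})$, and norms such as $\|w^k-w^\ast\|$ are Euclidean norms under this identification. Assumption C. Let $I_a(x^\ast)=\{i:\hat g_i(x^\ast)=0\}$. (1) $f$ and $g(\cdot,\tau)$ ($\tau\in T$) are three times continuously differentiable. (2) $J_a^k=I_a(x^\ast)$ for all sufficiently large $k$. (3) $F(x^\ast)+V_\ast\in S^m_{++}$ and $-\hat g_i(x^\ast)+y^\ast_i>0$ $(i=1,\ldots,p(x^\ast))$. (4) The Jacobian at $(x^\ast,(y^\ast_i)_{i\in I_a(x^\ast)},\mathrm{svec}(V_\ast))$ of the map $\Phi_0(x,\tilde y,\mathrm{svec}(V))=\left(\nabla f(x)+\sum_{i\in I_a(x^\ast)}y_i\nabla\hat g_i(x)-(F_i\bullet V)_{i=1}^n,\ (\hat g_i(x))_{i\in I_a(x^\ast)},\ \mathrm{svec}(F(x)\circ V)\right)$, $\tilde y=(y_i)_{i\in I_a(x^\ast)}$, is nonsingular.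
   Formalization: Assumption C(1) is read as also requiring each reduced function ĝ_i at x* to be three times continuously differentiable on U(x* ); smoothness of g(·,τ) in x alone does not ensure that the Hessian of ĝ_i exists, while joint C³ smoothness of g does. *)

theory Defs
  imports "HOL-Analysis.Analysis" "HOL-Library.Landau_Symbols"
begin

section \<open>Differential calculus\<close>

text \<open>On an open set \<open>S\<close> of a Euclidean space this is the usual class of \<open>k\<close> times continuously
  differentiable functions: all directional derivatives of order at most \<open>k\<close> exist and are
  continuous, and those of order below \<open>k\<close> are Frechet differentiable.\<close>

primrec ck_on :: "nat \<Rightarrow> ('a::real_normed_vector \<Rightarrow> 'b::real_normed_vector) \<Rightarrow> 'a set \<Rightarrow> bool" where
  "ck_on 0 f S \<longleftrightarrow> continuous_on S f"
| "ck_on (Suc k) f S \<longleftrightarrow>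
     (\<forall>x\<in>S. f differentiable (at x)) \<and> (\<forall>v. ck_on k (\<lambda>x. frechet_derivative f (at x) v) S)"

definition grad :: "(real^'n \<Rightarrow> real) \<Rightarrow> real^'n \<Rightarrow> real^'n" where
  "grad f x = (THE D. GDERIV f x :> D)"

definition hess :: "(real^'n \<Rightarrow> real) \<Rightarrow> real^'n \<Rightarrow> real^'n^'n" where
  "hess f x = jacobian (grad f) (at x)"


section \<open>Symmetric matrices\<close>

definition Sym :: "(real^'m^'m) set" where
  "Sym = {A. transpose A = A}"

definition Psd :: "(real^'m^'m) set" where
  "Psd = {A \<in> Sym. \<forall>v. 0 \<le> v \<bullet> (A *v v)}"

definition Pd :: "(real^'m^'m) set" where
  "Pd = {A \<in> Sym. \<forall>v. v \<noteq> 0 \<longrightarrow> 0 < v \<bullet> (A *v v)}"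

definition jprod :: "real^'m^'m \<Rightarrow> real^'m^'m \<Rightarrow> real^'m^'m" where
  "jprod X Y = (1/2) *\<^sub>R (X ** Y + Y ** X)"

definition jinv :: "real^'m^'m \<Rightarrow> real^'m^'m \<Rightarrow> real^'m^'m" where
  "jinv X = inv_into Sym (jprod X)"

definition mat_inner :: "real^'m^'m \<Rightarrow> real^'m^'m \<Rightarrow> real" where
  "mat_inner X Y = trace (X ** Y)"

text \<open>The coordinates of \<open>svec A\<close> are the positions \<open>(i, j)\<close> with \<open>j \<le> i\<close>; the remaining
  coordinates of the ambient space are zero padding.\<close>

definition svec :: "real^('m::{finite,linorder})^('m::{finite,linorder}) \<Rightarrow> real^('m \<times> 'm)" where
  "svec A = (\<chi> p. if snd p < fst p then sqrt 2 * A $ fst p $ snd p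
                  else if snd p = fst p then A $ fst p $ fst p else 0)"

definition lambda_min :: "real^'m^'m \<Rightarrow> real" where
  "lambda_min A = Min {l. \<exists>v. v \<noteq> 0 \<and> A *v v = l *\<^sub>R v}"


section \<open>The semi-infinite semidefinite program\<close>

text \<open>The index set \<open>T\<close> is \<open>{\<tau>. \<forall>h \<in> set (tcons P). h \<tau> \<le> 0}\<close>.\<close>

record ('n::finite, 'm::finite, 'q::finite) sisdp_data =
  obj :: "real^'n \<Rightarrow> real"
  con :: "real^'n \<Rightarrow> real^'q \<Rightarrow> real"
  F0 :: "real^'m^'m"
  Fc :: "'n \<Rightarrow> real^'m^'m"
  tcons :: "(real^'q \<Rightarrow> real) list"

definition Tset :: "('n::finite, 'm::finite, 'q::finite) sisdp_data \<Rightarrow> (real^'q) set" where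
  "Tset P = {\<tau>. \<forall>h\<in>set (tcons P). h \<tau> \<le> 0}"

definition Flin :: "('n::finite, 'm::finite, 'q::finite) sisdp_data \<Rightarrow> real^'n \<Rightarrow> real^'m^'m" where
  "Flin P d = (\<Sum>i\<in>UNIV. (d $ i) *\<^sub>R Fc P i)"

definition Fmap :: "('n::finite, 'm::finite, 'q::finite) sisdp_data \<Rightarrow> real^'n \<Rightarrow> real^'m^'m" where
  "Fmap P x = F0 P + Flin P x"

definition Fadj :: "('n::finite, 'm::finite, 'q::finite) sisdp_data \<Rightarrow> real^'m^'m \<Rightarrow> real^'n" where
  "Fadj P V = (\<chi> i. mat_inner (Fc P i) V)"

definition feasible :: "('n::finite, 'm::finite, 'q::finite) sisdp_data \<Rightarrow> (real^'n) set" where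
  "feasible P = {x. (\<forall>\<tau>\<in>Tset P. con P x \<tau> \<le> 0) \<and> Fmap P x \<in> Psd}"

definition sisdp :: "('n::finite, 'm::finite, 'q::finite) sisdp_data \<Rightarrow> bool" where
  "sisdp P \<longleftrightarrow>
     ck_on 1 (obj P) UNIV \<and>
     continuous_on (UNIV \<times> Tset P) (\<lambda>(x, \<tau>). con P x \<tau>) \<and>
     (\<forall>\<tau>\<in>Tset P. convex_on UNIV (\<lambda>x. con P x \<tau>) \<and> ck_on 1 (\<lambda>x. con P x \<tau>) UNIV) \<and>
     F0 P \<in> Sym \<and> (\<forall>i. Fc P i \<in> Sym) \<and>
     (\<forall>h\<in>set (tcons P). ck_on 2 h UNIV) \<and>
     compact (Tset P) \<and> Tset P \<noteq> {} \<and>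
     (\<exists>x\<in>feasible P. \<forall>x'\<in>feasible P. obj P x \<le> obj P x')"

text \<open>Finite Borel measures on the compact metric space \<open>T\<close> are automatically regular.\<close>

definition Mplus :: "(real^'q) set \<Rightarrow> (real^'q) measure set" where
  "Mplus T = {y. sets y = sets (restrict_space borel T) \<and> finite_measure y}"

definition supp :: "(real^'q) set \<Rightarrow> (real^'q) measure \<Rightarrow> (real^'q) set" where
  "supp T y = {\<tau>\<in>T. measure y {\<tau>} \<noteq> 0}"

type_synonym ('n, 'm, 'q) mtriple = "(real^'n) \<times> (real^'q) measure \<times> (real^'m^'m)"

definition phi1 :: "('n::finite, 'm::finite, 'q::finite) sisdp_data \<Rightarrow> ('n, 'm, 'q) mtriple \<Rightarrow> real^'n" where
  "phi1 P = (\<lambda>(x, y, V).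
     grad (obj P) x + (\<integral>\<tau>. grad (\<lambda>x'. con P x' \<tau>) x \<partial>y) - Fadj P V)"

definition phi2 :: "('n::finite, 'm::finite, 'q::finite) sisdp_data \<Rightarrow> ('n, 'm, 'q) mtriple \<Rightarrow> real" where
  "phi2 P = (\<lambda>(x, y, V). \<integral>\<tau>. con P x \<tau> \<partial>y)"

definition phi3 :: "('n::finite, 'm::{finite,linorder}, 'q::finite) sisdp_data \<Rightarrow> real \<Rightarrow>
    ('n, 'm, 'q) mtriple \<Rightarrow> real^('m \<times> 'm)" where
  "phi3 P \<mu> = (\<lambda>(x, y, V). svec (jprod (Fmap P x) V - \<mu> *\<^sub>R mat 1))"

definition theta :: "('n::finite, 'm::finite, 'q::finite) sisdp_data \<Rightarrow> real^'n \<Rightarrow> real" where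
  "theta P x = (SUP \<tau>\<in>Tset P. max (con P x \<tau>) 0)"

definition Rres :: "('n::finite, 'm::{finite,linorder}, 'q::finite) sisdp_data \<Rightarrow> real \<Rightarrow>
    ('n, 'm, 'q) mtriple \<Rightarrow> real" where
  "Rres P \<mu> w = sqrt ((theta P (fst w))\<^sup>2 + (norm (phi1 P w))\<^sup>2 + (phi2 P w)\<^sup>2
                     + (norm (phi3 P \<mu> w))\<^sup>2)"

definition Nbhd :: "('n::finite, 'm::{finite,linorder}, 'q::finite) sisdp_data \<Rightarrow> real \<Rightarrow> real \<Rightarrow>
    ('n, 'm, 'q) mtriple set" where
  "Nbhd P \<mu> \<epsilon> = {(x, y, V). y \<in> Mplus (Tset P) \<and> V \<in> Pd \<and> Rres P \<mu> (x, y, V) \<le> \<epsilon> \<and> Fmap P x \<in> Pd}"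

definition kkt_point :: "('n::finite, 'm::finite, 'q::finite) sisdp_data \<Rightarrow> ('n, 'm, 'q) mtriple \<Rightarrow> bool" where
  "kkt_point P = (\<lambda>(x, y, V).
     phi1 P (x, y, V) = 0 \<and>
     jprod (Fmap P x) V = 0 \<and> Fmap P x \<in> Psd \<and> V \<in> Psd \<and>
     phi2 P (x, y, V) = 0 \<and> (\<forall>\<tau>\<in>Tset P. con P x \<tau> \<le> 0) \<and> y \<in> Mplus (Tset P))"


section \<open>Local reduction\<close>

definition locmax :: "('n::finite, 'm::finite, 'q::finite) sisdp_data \<Rightarrow> real^'n \<Rightarrow> (real^'q) set" where
  "locmax P x = {\<tau>\<in>Tset P. \<forall>\<^sub>F \<tau>' in at \<tau> within Tset P. con P x \<tau>' \<le> con P x \<tau>}"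

definition locmax_sigma :: "('n::finite, 'm::finite, 'q::finite) sisdp_data \<Rightarrow> real \<Rightarrow> real^'n \<Rightarrow> (real^'q) set" where
  "locmax_sigma P \<sigma> x = {\<tau>\<in>locmax P x. con P x \<tau> > (SUP \<tau>'\<in>Tset P. con P x \<tau>') - \<sigma>}"

definition active_tcons :: "('n::finite, 'm::finite, 'q::finite) sisdp_data \<Rightarrow> real^'q \<Rightarrow> nat set" where
  "active_tcons P \<tau> = {j. j < length (tcons P) \<and> (tcons P ! j) \<tau> = 0}"

definition licq :: "('n::finite, 'm::finite, 'q::finite) sisdp_data \<Rightarrow> real^'q \<Rightarrow> bool" where
  "licq P \<tau> \<longleftrightarrow> (\<forall>c. (\<Sum>j\<in>active_tcons P \<tau>. c j *\<^sub>R grad (tcons P ! j) \<tau>) = 0 \<longrightarrow>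
                    (\<forall>j\<in>active_tcons P \<tau>. c j = 0))"

text \<open>First-order multipliers, second-order sufficient condition and strict complementarity for
  maximizing \<open>con P x\<close> over \<open>Tset P\<close>; the Lagrangian is \<open>con P x \<tau> - (\<Sum>j. \<nu> j * h j \<tau>)\<close>.\<close>

definition lower_mult :: "('n::finite, 'm::finite, 'q::finite) sisdp_data \<Rightarrow> real^'n \<Rightarrow> real^'q \<Rightarrow>
    (nat \<Rightarrow> real) \<Rightarrow> bool" where
  "lower_mult P x \<tau> \<nu> \<longleftrightarrow>
     (\<forall>j\<in>active_tcons P \<tau>. 0 \<le> \<nu> j) \<and>
     grad (con P x) \<tau> = (\<Sum>j\<in>active_tcons P \<tau>. \<nu> j *\<^sub>R grad (tcons P ! j) \<tau>)"

definition lower_strict_compl :: "('n::finite, 'm::finite, 'q::finite) sisdp_data \<Rightarrow> real^'q \<Rightarrow>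
    (nat \<Rightarrow> real) \<Rightarrow> bool" where
  "lower_strict_compl P \<tau> \<nu> \<longleftrightarrow> (\<forall>j\<in>active_tcons P \<tau>. 0 < \<nu> j)"

definition lower_sosc :: "('n::finite, 'm::finite, 'q::finite) sisdp_data \<Rightarrow> real^'n \<Rightarrow> real^'q \<Rightarrow>
    (nat \<Rightarrow> real) \<Rightarrow> bool" where
  "lower_sosc P x \<tau> \<nu> \<longleftrightarrow>
     (\<forall>d. d \<noteq> 0 \<longrightarrow>
        (\<forall>j\<in>active_tcons P \<tau>. grad (tcons P ! j) \<tau> \<bullet> d \<le> 0 \<and>
                              (0 < \<nu> j \<longrightarrow> grad (tcons P ! j) \<tau> \<bullet> d = 0)) \<longrightarrow>
        d \<bullet> ((hess (con P x) \<tau> - (\<Sum>j\<in>active_tcons P \<tau>. \<nu> j *\<^sub>R hess (tcons P ! j) \<tau>)) *v d) < 0)"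

definition nondegenerate :: "('n::finite, 'm::finite, 'q::finite) sisdp_data \<Rightarrow> real \<Rightarrow> real^'n \<Rightarrow> bool" where
  "nondegenerate P \<sigma> x \<longleftrightarrow>
     finite (locmax_sigma P \<sigma> x) \<and>
     (\<forall>\<tau>\<in>locmax_sigma P \<sigma> x.
        (\<exists>W. open W \<and> \<tau> \<in> W \<and> ck_on 2 (con P x) W) \<and>
        licq P \<tau> \<and>
        (\<exists>\<nu>. lower_mult P x \<tau> \<nu> \<and> lower_sosc P x \<tau> \<nu> \<and> lower_strict_compl P \<tau> \<nu>))"

text \<open>The functions \<open>\<tau>\<^sup>i\<close> attached to a point are represented by the set \<open>B\<close> of these functions,
  and the functions themselves serve as the indices \<open>i\<close>. So no enumeration has to be chosen, and
  two reductions agree up to renumbering iff their sets of functions are equal. Functions are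
  extensional (\<open>undefined\<close> outside \<open>U\<close>), which makes equality that of functions on \<open>U\<close>.\<close>

type_synonym ('n, 'q) branch = "real^'n \<Rightarrow> real^'q"

definition local_reduction :: "('n::finite, 'm::finite, 'q::finite) sisdp_data \<Rightarrow> real \<Rightarrow> real^'n \<Rightarrow>
    (real^'n) set \<Rightarrow> ('n, 'q) branch set \<Rightarrow> bool" where
  "local_reduction P \<sigma> xb U B \<longleftrightarrow>
     open U \<and> xb \<in> U \<and> finite B \<and> B \<subseteq> (U \<rightarrow>\<^sub>E Tset P) \<and>
     (\<forall>i\<in>B. ck_on 2 i U) \<and>
     (\<forall>x\<in>U. bij_betw (\<lambda>i. i x) B (locmax_sigma P \<sigma> x) \<and>
       (\<forall>i\<in>B. \<forall>\<^sub>F \<tau>' in at (i x) within Tset P. con P x \<tau>' < con P x (i x)))"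

definition ghat :: "('n::finite, 'm::finite, 'q::finite) sisdp_data \<Rightarrow> ('n, 'q) branch \<Rightarrow> real^'n \<Rightarrow> real" where
  "ghat P i x = con P x (i x)"

text \<open>Triples \<open>(x, y, V)\<close> whose measure is replaced by its vector of masses. Only the entries of
  \<open>y\<close> at the indices of the current reduction are meaningful.\<close>

type_synonym ('n, 'm, 'q) vtriple = "(real^'n) \<times> (('n, 'q) branch \<Rightarrow> real) \<times> (real^'m^'m)"

definition masses :: "('n::finite, 'm::finite, 'q::finite) mtriple \<Rightarrow> ('n, 'm, 'q) vtriple" where
  "masses = (\<lambda>(x, y, V). (x, \<lambda>i. measure y {i x}, V))"

definition as_measure :: "(real^'q) set \<Rightarrow> ('n, 'q) branch set \<Rightarrow>
    ('n::finite, 'm::finite, 'q::finite) vtriple \<Rightarrow> ('n, 'm, 'q) mtriple" where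
  "as_measure T B = (\<lambda>(x, y, V).
     (x, distr (point_measure B (\<lambda>i. ennreal (y i))) (restrict_space borel T) (\<lambda>i. i x), V))"

text \<open>A vector triple represents a point of the neighborhood \<open>Nbhd P \<mu> \<epsilon>\<close>. Validity of the functions
  in \<open>B\<close> and nonnegativity of the masses are needed for it to represent an element of
  \<open>\<real>\<^sup>n \<times> Mplus T \<times> Sym\<close> at all.\<close>

definition in_Nbhd :: "('n::finite, 'm::{finite,linorder}, 'q::finite) sisdp_data \<Rightarrow> (real^'n) set \<Rightarrow>
    ('n, 'q) branch set \<Rightarrow> real \<Rightarrow> real \<Rightarrow> ('n, 'm, 'q) vtriple \<Rightarrow> bool" where
  "in_Nbhd P U B \<mu> \<epsilon> z \<longleftrightarrow>
     fst z \<in> U \<and> (\<forall>i\<in>B. 0 \<le> fst (snd z) i) \<and> as_measure (Tset P) B z \<in> Nbhd P \<mu> \<epsilon>"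

definition vstep :: "('n::finite, 'm::finite, 'q::finite) vtriple \<Rightarrow> real \<Rightarrow> ('n, 'm, 'q) vtriple \<Rightarrow>
    ('n, 'm, 'q) vtriple" where
  "vstep = (\<lambda>(x, y, V) s (dx, dy, dV). (x + s *\<^sub>R dx, \<lambda>i. y i + s * dy i, V + s *\<^sub>R dV))"

definition vdist :: "('n, 'q) branch set \<Rightarrow> ('n::finite, 'm::{finite,linorder}, 'q::finite) vtriple \<Rightarrow>
    ('n, 'm, 'q) vtriple \<Rightarrow> real" where
  "vdist B = (\<lambda>(x, y, V) (x', y', V').
     sqrt ((norm (x - x'))\<^sup>2 + (\<Sum>i\<in>B. (y i - y' i)\<^sup>2) + (norm (svec (V - V')))\<^sup>2))"


section \<open>The algorithm\<close>

record alg_param =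
  alpha :: real
  beta :: real
  gamma1 :: real
  gamma2 :: real
  delta :: real
  mu0 :: real
  cexp :: real

definition valid_param :: "alg_param \<Rightarrow> bool" where
  "valid_param p \<longleftrightarrow>
     0 < alpha p \<and> alpha p < 1 \<and> 0 < beta p \<and> beta p < 1 \<and> 0 < gamma1 p \<and> 0 < gamma2 p \<and>
     0 < delta p \<and> delta p < 1 \<and> 0 < mu0 p \<and> 0 < cexp p \<and> cexp p \<le> 1 / (alpha p + 2)"

primrec mu :: "alg_param \<Rightarrow> nat \<Rightarrow> real" where
  "mu p 0 = mu0 p"
| "mu p (Suc k) = min (beta p * mu p k) (gamma2 p * mu p k powr (1 + cexp p * alpha p))"

definition eps :: "alg_param \<Rightarrow> nat \<Rightarrow> real" where
  "eps p k = gamma1 p * mu p k powr (1 + alpha p)"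

definition lagrangian :: "('n::finite, 'm::finite, 'q::finite) sisdp_data \<Rightarrow> ('n, 'q) branch set \<Rightarrow>
    (('n, 'q) branch \<Rightarrow> real) \<Rightarrow> real^'m^'m \<Rightarrow> real^'n \<Rightarrow> real" where
  "lagrangian P B y V x = obj P x + (\<Sum>i\<in>B. y i * ghat P i x) - mat_inner (Fmap P x) V"

definition eq_a :: "('n::finite, 'm::finite, 'q::finite) sisdp_data \<Rightarrow> ('n, 'q) branch set \<Rightarrow>
    ('n, 'm, 'q) vtriple \<Rightarrow> ('n, 'm, 'q) vtriple \<Rightarrow> bool" where
  "eq_a P B = (\<lambda>(x, y, V) (dx, dy, dV).
     grad (obj P) x + hess (lagrangian P B y V) x *v dx
       + (\<Sum>i\<in>B. (y i + dy i) *\<^sub>R grad (ghat P i) x) - Fadj P (V + dV) = 0)"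

definition eq_b :: "('n::finite, 'm::finite, 'q::finite) sisdp_data \<Rightarrow> real \<Rightarrow>
    ('n, 'm, 'q) vtriple \<Rightarrow> ('n, 'm, 'q) vtriple \<Rightarrow> bool" where
  "eq_b P \<mu> = (\<lambda>(x, y, V) (dx, dy, dV).
     jprod (Fmap P x) (V + dV)
       + (1/2) *\<^sub>R (jprod V (Flin P dx)
                   + jprod (Fmap P x) (jprod V (jinv (Fmap P x) (Flin P dx))))
     = \<mu> *\<^sub>R mat 1)"

definition lin_ghat :: "('n::finite, 'm::finite, 'q::finite) sisdp_data \<Rightarrow> real^'n \<Rightarrow> real^'n \<Rightarrow>
    ('n, 'q) branch \<Rightarrow> real" where
  "lin_ghat P x dx i = ghat P i x + grad (ghat P i) x \<bullet> dx"

definition cond_c :: "('n::finite, 'm::finite, 'q::finite) sisdp_data \<Rightarrow> ('n, 'q) branch set \<Rightarrow>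
    ('n, 'm, 'q) vtriple \<Rightarrow> ('n, 'm, 'q) vtriple \<Rightarrow> bool" where
  "cond_c P B = (\<lambda>(x, y, V) (dx, dy, dV).
     (\<forall>i\<in>B. 0 \<le> y i + dy i) \<and> (\<forall>i\<in>B. lin_ghat P x dx i \<le> 0) \<and>
     (\<Sum>i\<in>B. (y i + dy i) * lin_ghat P x dx i) = 0)"

definition predictor_sys :: "('n::finite, 'm::finite, 'q::finite) sisdp_data \<Rightarrow> ('n, 'q) branch set \<Rightarrow> real \<Rightarrow>
    ('n, 'm, 'q) vtriple \<Rightarrow> ('n, 'm, 'q) vtriple \<Rightarrow> bool" where
  "predictor_sys P B \<mu> z d \<longleftrightarrow>
     snd (snd d) \<in> Sym \<and> eq_a P B z d \<and> eq_b P \<mu> z d \<and> cond_c P B z d"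

definition corrector_sys :: "('n::finite, 'm::finite, 'q::finite) sisdp_data \<Rightarrow> ('n, 'q) branch set \<Rightarrow>
    ('n, 'q) branch set \<Rightarrow> real \<Rightarrow> ('n, 'm, 'q) vtriple \<Rightarrow> ('n, 'm, 'q) vtriple \<Rightarrow> bool" where
  "corrector_sys P B J \<mu> z d \<longleftrightarrow>
     snd (snd d) \<in> Sym \<and> eq_a P B z d \<and> eq_b P \<mu> z d \<and>
     (\<forall>i\<in>J. lin_ghat P (fst z) (fst d) i = 0) \<and>
     (\<forall>i\<in>B - J. fst (snd z) i + fst (snd d) i = 0)"

definition step_len :: "real \<Rightarrow> real^'m^'m \<Rightarrow> real^'m^'m \<Rightarrow> real" where
  "step_len \<delta> A D =
     (let l = lambda_min (matrix_inv A ** D) in if l \<le> -1 then - \<delta> / l else 1)"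

definition step_size :: "('n::finite, 'm::finite, 'q::finite) sisdp_data \<Rightarrow> real \<Rightarrow>
    ('n, 'm, 'q) vtriple \<Rightarrow> ('n, 'm, 'q) vtriple \<Rightarrow> real" where
  "step_size P \<delta> = (\<lambda>(x, y, V) (dx, dy, dV).
     min (step_len \<delta> (Fmap P x) (Flin P dx)) (step_len \<delta> V dV))"

text \<open>In what follows \<open>w\<close> is the sequence of iterates, \<open>dh k\<close> and \<open>d1 k\<close> are the directions
  \<open>\<Delta>\<^bsub>1/2\<^esub>w\<^sup>k\<close> and \<open>\<Delta>\<^sub>1w\<^sup>k\<close>, and \<open>U\<close>, \<open>B\<close> assign to a point the neighborhood and the functions of
  its local reduction.\<close>

definition w_half :: "('n::finite, 'm::finite, 'q::finite) sisdp_data \<Rightarrow> alg_param \<Rightarrow>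
    (nat \<Rightarrow> ('n, 'm, 'q) mtriple) \<Rightarrow> (nat \<Rightarrow> ('n, 'm, 'q) vtriple) \<Rightarrow> nat \<Rightarrow> ('n, 'm, 'q) vtriple" where
  "w_half P p w dh k =
     vstep (masses (w k)) (step_size P (delta p) (masses (w k)) (dh k)) (dh k)"

definition J_act :: "('n::finite, 'm::finite, 'q::finite) sisdp_data \<Rightarrow> (real^'n \<Rightarrow> ('n, 'q) branch set) \<Rightarrow>
    (nat \<Rightarrow> ('n, 'm, 'q) mtriple) \<Rightarrow> (nat \<Rightarrow> ('n, 'm, 'q) vtriple) \<Rightarrow> nat \<Rightarrow> ('n, 'q) branch set" where
  "J_act P B w dh k = {i \<in> B (fst (w k)). lin_ghat P (fst (w k)) (fst (dh k)) i = 0}"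

text \<open>The first conjunct says that the corrector equations are well-defined: the functions of the
  reduction at \<open>x\<^sup>k\<close> are valid at \<open>x\<^sup>k\<^sup>+\<^sup>1\<^sup>/\<^sup>2\<close>.\<close>

definition corrector_solution :: "('n::finite, 'm::finite, 'q::finite) sisdp_data \<Rightarrow> alg_param \<Rightarrow>
    (real^'n \<Rightarrow> (real^'n) set) \<Rightarrow> (real^'n \<Rightarrow> ('n, 'q) branch set) \<Rightarrow>
    (nat \<Rightarrow> ('n, 'm, 'q) mtriple) \<Rightarrow> (nat \<Rightarrow> ('n, 'm, 'q) vtriple) \<Rightarrow> nat \<Rightarrow> ('n, 'm, 'q) vtriple \<Rightarrow> bool" where
  "corrector_solution P p U B w dh k d \<longleftrightarrow>
     fst (w_half P p w dh k) \<in> U (fst (w k)) \<and>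
     corrector_sys P (B (fst (w k))) (J_act P B w dh k) (mu p k) (w_half P p w dh k) d"

definition s_one :: "('n::finite, 'm::finite, 'q::finite) sisdp_data \<Rightarrow> alg_param \<Rightarrow>
    (nat \<Rightarrow> ('n, 'm, 'q) mtriple) \<Rightarrow> (nat \<Rightarrow> ('n, 'm, 'q) vtriple) \<Rightarrow>
    (nat \<Rightarrow> ('n, 'm, 'q) vtriple) \<Rightarrow> nat \<Rightarrow> real" where
  "s_one P p w dh d1 k = step_size P (delta p) (w_half P p w dh k) (d1 k)"

definition w_trial :: "('n::finite, 'm::finite, 'q::finite) sisdp_data \<Rightarrow> alg_param \<Rightarrow>
    (nat \<Rightarrow> ('n, 'm, 'q) mtriple) \<Rightarrow> (nat \<Rightarrow> ('n, 'm, 'q) vtriple) \<Rightarrow>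
    (nat \<Rightarrow> ('n, 'm, 'q) vtriple) \<Rightarrow> nat \<Rightarrow> ('n, 'm, 'q) vtriple" where
  "w_trial P p w dh d1 k = vstep (w_half P p w dh k) (s_one P p w dh d1 k) (d1 k)"

text \<open>If the corrector equations are unsolvable or not well-defined at \<open>k\<close>, then \<open>d1 k\<close> is
  arbitrary and unused.\<close>

definition generated_by_algorithm :: "('n::finite, 'm::{finite,linorder}, 'q::finite) sisdp_data \<Rightarrow> real \<Rightarrow>
    alg_param \<Rightarrow> (real^'n \<Rightarrow> (real^'n) set) \<Rightarrow> (real^'n \<Rightarrow> ('n, 'q) branch set) \<Rightarrow>
    (nat \<Rightarrow> ('n, 'm, 'q) mtriple) \<Rightarrow> (nat \<Rightarrow> ('n, 'm, 'q) vtriple) \<Rightarrow>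
    (nat \<Rightarrow> ('n, 'm, 'q) vtriple) \<Rightarrow> bool" where
  "generated_by_algorithm P \<sigma> p U B w dh d1 \<longleftrightarrow>
     Fmap P (fst (w 0)) \<in> Pd \<and> fst (snd (w 0)) \<in> Mplus (Tset P) \<and> snd (snd (w 0)) \<in> Pd \<and>
     (\<forall>k. \<not> kkt_point P (w k) \<and>
        local_reduction P \<sigma> (fst (w k)) (U (fst (w k))) (B (fst (w k))) \<and>
        predictor_sys P (B (fst (w k))) (mu p k) (masses (w k)) (dh k) \<and>
        ((\<exists>d. corrector_solution P p U B w dh k d) \<longrightarrow> corrector_solution P p U B w dh k (d1 k)) \<and>
        (if corrector_solution P p U B w dh k (d1 k) \<and>
            in_Nbhd P (U (fst (w k))) (B (fst (w k))) (mu p k) (eps p k) (w_trial P p w dh d1 k)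
         then w (Suc k) = as_measure (Tset P) (B (fst (w k))) (w_trial P p w dh d1 k)
         else w (Suc k) \<in> Nbhd P (mu p k) (eps p k)))"


section \<open>Assumptions of the local convergence analysis\<close>

text \<open>The measures \<open>y\<^sup>k\<close> are identified with their vectors of masses, so besides the inclusion of
  supports they have to be discrete, i.e. concentrated on the set \<open>supp\<close> of their atoms.\<close>

definition assumption_B :: "('n::finite, 'm::{finite,linorder}, 'q::finite) sisdp_data \<Rightarrow> real \<Rightarrow>
    (real^'n \<Rightarrow> (real^'n) set) \<Rightarrow> (real^'n \<Rightarrow> ('n, 'q) branch set) \<Rightarrow>
    (nat \<Rightarrow> ('n, 'm, 'q) mtriple) \<Rightarrow> ('n, 'm, 'q) mtriple \<Rightarrow> bool" where
  "assumption_B P \<sigma> U B w ws \<longleftrightarrow>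
     (\<lambda>k. vdist (B (fst ws)) (masses (w k)) (masses ws)) \<longlonglongrightarrow> 0 \<and>
     kkt_point P ws \<and>
     nondegenerate P \<sigma> (fst ws) \<and>
     (\<forall>\<^sub>F k in sequentially.
        U (fst (w k)) = U (fst ws) \<and> B (fst (w k)) = B (fst ws) \<and>
        (AE \<tau> in fst (snd (w k)). \<tau> \<in> supp (Tset P) (fst (snd (w k)))) \<and>
        supp (Tset P) (fst (snd (w k))) \<subseteq> (\<lambda>i. i (fst (w k))) ` B (fst ws))"

definition I_act :: "('n::finite, 'm::finite, 'q::finite) sisdp_data \<Rightarrow> (real^'n \<Rightarrow> ('n, 'q) branch set) \<Rightarrow>
    real^'n \<Rightarrow> ('n, 'q) branch set" where
  "I_act P B x = {i \<in> B x. ghat P i x = 0}"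

definition Phi0 :: "('n::finite, 'm::{finite,linorder}, 'q::finite) sisdp_data \<Rightarrow> ('n, 'q) branch set \<Rightarrow>
    ('n, 'm, 'q) vtriple \<Rightarrow> (real^'n) \<times> (('n, 'q) branch \<Rightarrow> real) \<times> (real^('m \<times> 'm))" where
  "Phi0 P I = (\<lambda>(x, y, V).
     (grad (obj P) x + (\<Sum>i\<in>I. y i *\<^sub>R grad (ghat P i) x) - Fadj P V,
      \<lambda>i. if i \<in> I then ghat P i x else 0,
      svec (jprod (Fmap P x) V)))"

text \<open>The Jacobian of \<open>Phi0 P I\<close> at \<open>z\<close> as a linear map, i.e. the product of the Jacobian with the
  direction \<open>d\<close>, computed componentwise. It acts on \<open>\<real>\<^sup>n \<times> \<real>\<^sup>I \<times> Sym\<close>, with \<open>\<real>\<^sup>I\<close> the functions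
  vanishing outside \<open>I\<close> and symmetric matrices identified with their images under \<open>svec\<close>.\<close>

definition Phi0_jacobian :: "('n::finite, 'm::{finite,linorder}, 'q::finite) sisdp_data \<Rightarrow>
    ('n, 'q) branch set \<Rightarrow> ('n, 'm, 'q) vtriple \<Rightarrow> ('n, 'm, 'q) vtriple \<Rightarrow>
    (real^'n) \<times> (('n, 'q) branch \<Rightarrow> real) \<times> (real^('m \<times> 'm))" where
  "Phi0_jacobian P I z d =
     (vector_derivative (\<lambda>t. fst (Phi0 P I (vstep z t d))) (at 0),
      \<lambda>i. vector_derivative (\<lambda>t. fst (snd (Phi0 P I (vstep z t d))) i) (at 0),
      vector_derivative (\<lambda>t. snd (snd (Phi0 P I (vstep z t d)))) (at 0))"

definition Phi0_jacobian_nonsingular :: "('n::finite, 'm::{finite,linorder}, 'q::finite) sisdp_data \<Rightarrow>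
    ('n, 'q) branch set \<Rightarrow> ('n, 'm, 'q) vtriple \<Rightarrow> bool" where
  "Phi0_jacobian_nonsingular P I z \<longleftrightarrow>
     bij_betw (Phi0_jacobian P I z)
       (UNIV \<times> {u. \<forall>i. i \<notin> I \<longrightarrow> u i = 0} \<times> Sym)
       (UNIV \<times> {u. \<forall>i. i \<notin> I \<longrightarrow> u i = 0} \<times> svec ` Sym)"

text \<open>The functions \<open>ghat P i\<close> are required to be three times continuously differentiable as well.
  This does not follow from smoothness of \<open>con P\<close> in \<open>x\<close> alone, but it holds whenever \<open>con P\<close> is
  three times continuously differentiable jointly in both arguments, because then
  \<open>grad (ghat P i) x = grad (\<lambda>x'. con P x' (i x)) x\<close> with a twice continuously differentiable \<open>i\<close>.\<close>

definition assumption_C :: "('n::finite, 'm::{finite,linorder}, 'q::finite) sisdp_data \<Rightarrow>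
    (real^'n \<Rightarrow> (real^'n) set) \<Rightarrow> (real^'n \<Rightarrow> ('n, 'q) branch set) \<Rightarrow>
    (nat \<Rightarrow> ('n, 'm, 'q) mtriple) \<Rightarrow> (nat \<Rightarrow> ('n, 'm, 'q) vtriple) \<Rightarrow> ('n, 'm, 'q) mtriple \<Rightarrow> bool" where
  "assumption_C P U B w dh ws \<longleftrightarrow>
     ck_on 3 (obj P) UNIV \<and> (\<forall>\<tau>\<in>Tset P. ck_on 3 (\<lambda>x. con P x \<tau>) UNIV) \<and>
     (\<forall>i\<in>B (fst ws). ck_on 3 (ghat P i) (U (fst ws))) \<and>
     (\<forall>\<^sub>F k in sequentially. J_act P B w dh k = I_act P B (fst ws)) \<and>
     Fmap P (fst ws) + snd (snd ws) \<in> Pd \<and>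
     (\<forall>i\<in>B (fst ws). - ghat P i (fst ws) + fst (snd (masses ws)) i > 0) \<and>
     Phi0_jacobian_nonsingular P (I_act P B (fst ws)) (masses ws)"

end

theory Submission
  imports Defs
begin

text \<open>Write \<open>\<nu>\<close> for the barrier parameter that controls the current iterate and \<open>\<mu>\<close> for its
  successor, so \<open>\<mu> = min (\<beta> \<nu>) (\<gamma>\<^sub>2 \<nu>\<^sup>1\<^sup>+\<^sup>c\<^sup>\<alpha>)\<close>. The predictor direction and the corrector direction solve
  the same kind of linear system. By identification of the active set, the complementarity condition of the
  predictor forces the inactive multipliers to \<open>0\<close> and the active linearized constraints to
  equality (\<open>predictor_imp_corrector\<close>), which is the corrector system. So one analysis of a Newton
  step is applied twice.

  The system differs from the Newton system of the reduced KKT map only in the term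
  \<open>\<L>\<^sub>F \<L>\<^sub>V \<L>\<^sub>F\<^sup>-\<^sup>1 - \<L>\<^sub>V\<close>, which may blow up at a singular limit \<open>F(x\<^sup>*)\<close> unless \<open>F\<close> and \<open>V\<close> nearly commute.
  They do. If \<open>E = F \<circ> V - \<kappa> I\<close>, then the commutator of \<open>F\<close> and \<open>V\<close> has norm at most \<open>2 \<parallel>E\<parallel>\<close>
  (\<open>commutator_bound\<close>), while the smallest eigenvalue of \<open>F\<close> is at least of the order of \<open>\<kappa>\<close>
  (\<open>near_central_coercive\<close>). Hence the term is an operator of norm \<open>O(\<parallel>E\<parallel> / \<kappa>)\<close>
  (\<open>scaling_defect_bound\<close>). In the neighborhoods this quotient tends to \<open>0\<close>, so the
  nonsingular Jacobian at the limit makes the system uniformly solvable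
  (\<open>newton_solvable\<close>): directions are bounded by a multiple of the residual.

  After a full step of size \<open>s\<close> the smooth residuals are \<open>O(s\<^sup>2)\<close> by Taylor's formula, and the residual of
  \<open>F \<circ> V = \<mu> I\<close> is \<open>O(s\<^sup>2 + (\<parallel>E\<parallel> / \<kappa>) s)\<close> (\<open>newton_step_residual\<close>). Put \<open>N = \<nu>\<^sup>1\<^sup>+\<^sup>\<alpha>\<close>. The iterate has
  \<open>\<parallel>E\<parallel> = O(N)\<close> and \<open>\<kappa> = \<nu>\<close>, and its distance to the target \<open>\<mu>\<close> is \<open>O(\<nu>)\<close>. So the predictor
  has \<open>s = O(\<nu>)\<close> and leaves residuals \<open>O(N)\<close>. The corrector then has \<open>\<kappa> = \<mu>\<close> and \<open>s = O(N)\<close>, and leaves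
  residuals \<open>O(N\<^sup>2 / \<mu>)\<close>. Existence of the constant \<open>ct\<close> means \<open>c (\<alpha> + 2) < 1\<close>, which is exactly
  \<open>N\<^sup>2 / \<mu> = o(\<mu>\<^sup>1\<^sup>+\<^sup>\<alpha>)\<close> (\<open>mu_ratio_corrector\<close>): the trial point lies in the neighborhood.

  Positive definiteness holds because \<open>F \<circ> V\<close> stays positive definite along the whole step: if one of the
  two factors became singular on the way, then the form of \<open>F \<circ> V\<close> would vanish at its null vectors
  (\<open>jprod_Pd_along_segment\<close>). Positive definite end points are just what makes the step size
  rule return \<open>1\<close> (\<open>step_len_eq_1\<close>). Finally, the half-way point satisfies \<open>F \<circ> V \<approx> \<mu> I\<close> whereas
  \<open>F \<circ> V = 0\<close> at the limit, so its distance to the limit is at least of the order of \<open>\<mu>\<close>, and this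
  dominates the corrector direction of size \<open>O(N) = o(\<mu>)\<close>.

  The measures enter only through their masses at the points \<open>\<tau>\<^sup>i(x)\<close>. The reduced and the original
  stationarity conditions agree because \<open>\<nabla>(ghat P i) x\<close> is the \<open>x\<close>-gradient of \<open>con P\<close> at \<open>i x\<close>
  (\<open>grad_local_maximum_value\<close>).\<close>

section \<open>Symmetric matrices\<close>

lemma Sym_iff: "A \<in> Sym \<longleftrightarrow> (\<forall>i j. A $ i $ j = A $ j $ i)"
  by (auto simp: Sym_def transpose_def vec_eq_iff)

lemma Sym_transpose: "A \<in> Sym \<Longrightarrow> transpose A = A"
  by (simp add: Sym_def)

lemma subspace_Sym: "subspace (Sym :: (real^'m^'m) set)"
  by (auto simp: subspace_def Sym_iff)

lemma Pd_Sym: "A \<in> Pd \<Longrightarrow> A \<in> Sym"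
  by (simp add: Pd_def)

lemma Pd_pos: "A \<in> Pd \<Longrightarrow> v \<noteq> 0 \<Longrightarrow> 0 < v \<bullet> (A *v v)"
  by (simp add: Pd_def)

lemma Pd_nonneg: "A \<in> Pd \<Longrightarrow> 0 \<le> v \<bullet> (A *v v)"
  using Pd_pos[of A v] by (cases "v = 0") auto

lemma Sym_inner: "A \<in> Sym \<Longrightarrow> u \<bullet> (A *v v) = v \<bullet> (A *v u)"
  by (metis Sym_transpose dot_lmul_matrix inner_commute vector_transpose_matrix)

lemma transpose_linear:
  "transpose (A + B) = transpose A + transpose B" "transpose (A - B) = transpose A - transpose B"
  "transpose (c *\<^sub>R A) = c *\<^sub>R transpose A" for A B :: "real^'n^'m"
  by (simp_all add: transpose_def vec_eq_iff)

lemma bounded_bilinear_matrix_mult: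
  "bounded_bilinear ((**) :: real^'m^'m \<Rightarrow> real^'m^'m \<Rightarrow> real^'m^'m)"
  apply (subst bilinear_conv_bounded_bilinear[symmetric])
  apply (auto simp: bilinear_def linear_iff matrix_matrix_mult_def vec_eq_iff sum.distrib[symmetric]
    sum_distrib_left algebra_simps)
  done

interpretation mm: bounded_bilinear "(**) :: real^'m^'m \<Rightarrow> real^'m^'m \<Rightarrow> real^'m^'m"
  by (rule bounded_bilinear_matrix_mult)

lemma norm_matrix_vector: "norm (A *v x) \<le> norm A * norm (x :: real^'m)" for A :: "real^'m^'n"
proof -
  have "norm (A *v x) = L2_set (\<lambda>i. norm ((A *v x) $ i)) UNIV" by (simp add: norm_vec_def)
  also have "\<dots> \<le> L2_set (\<lambda>i. norm (A $ i) * norm x) UNIV"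
  proof (rule L2_set_mono)
    fix i
    have "(A *v x) $ i = A $ i \<bullet> x" by (simp add: matrix_vector_mul_component)
    then show "norm ((A *v x) $ i) \<le> norm (A $ i) * norm x" by (simp add: Cauchy_Schwarz_ineq2)
  qed auto
  also have "\<dots> = norm A * norm x"
    by (simp add: norm_vec_def[of A] L2_set_left_distrib)
  finally show ?thesis .
qed

text \<open>The norm of a matrix is the Frobenius norm, so \<open>A \<bullet> B\<close> is the trace of \<open>A\<^sup>T B\<close>.\<close>
lemma inner_matrix_trace: "A \<bullet> B = trace (transpose A ** B)" for A :: "real^'m^'n"
  apply (simp add: trace_def matrix_matrix_mult_def transpose_def inner_vec_def)
  by (rule sum.swap)

lemma trace_transpose: "trace (transpose A) = trace (A :: real^'m^'m)"
  by (simp add: trace_def transpose_def)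

lemma inner_transpose: "transpose A \<bullet> B = A \<bullet> transpose B" for A :: "real^'m^'m"
proof -
  have "A \<bullet> transpose B = trace (transpose (B ** A))"
    by (simp add: inner_matrix_trace matrix_transpose_mul)
  also have "\<dots> = trace (B ** A)" by (rule trace_transpose)
  also have "\<dots> = trace (A ** B)" by (rule trace_mul_sym)
  also have "\<dots> = transpose A \<bullet> B" by (simp add: inner_matrix_trace)
  finally show ?thesis by simp
qed

lemma norm_transpose: "norm (transpose A) = norm (A :: real^'m^'m)"
  by (simp add: norm_eq_sqrt_inner inner_transpose)

lemma inner_matrix_columns: "A \<bullet> B = (\<Sum>j\<in>UNIV. (A *v axis j 1) \<bullet> (B *v axis j 1))"
  for A :: "real^'m^'n"
  apply (simp add: inner_vec_def matrix_vector_mult_basis column_def)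
  by (rule sum.swap)

lemma norm_matrix_mult: "norm (A ** B) \<le> norm A * norm (B :: real^'m^'m)"
proof (rule power2_le_imp_le)
  have "(norm (A ** B))\<^sup>2 = (\<Sum>j\<in>UNIV. (norm (A *v (B *v axis j 1)))\<^sup>2)"
    by (simp add: power2_norm_eq_inner inner_matrix_columns matrix_vector_mul_assoc)
  also have "\<dots> \<le> (\<Sum>j\<in>UNIV. (norm A * norm (B *v axis j 1))\<^sup>2)"
    by (intro sum_mono power_mono norm_matrix_vector) auto
  also have "\<dots> = (norm A * norm B)\<^sup>2"
    by (simp add: power_mult_distrib sum_distrib_left[symmetric] power2_norm_eq_inner inner_matrix_columns)
  finally show "(norm (A ** B))\<^sup>2 \<le> (norm A * norm B)\<^sup>2" .
qed auto

lemma quadratic_form_le_norm: "\<bar>v \<bullet> (A *v v)\<bar> \<le> norm A * (v \<bullet> v)" for v :: "real^'m"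
proof -
  have "\<bar>v \<bullet> (A *v v)\<bar> \<le> norm v * norm (A *v v)" by (rule Cauchy_Schwarz_ineq2)
  also have "\<dots> \<le> norm v * (norm A * norm v)" by (intro mult_left_mono norm_matrix_vector) auto
  finally show ?thesis by (simp add: power2_norm_eq_inner[symmetric] power2_eq_square algebra_simps)
qed

subsection \<open>Generalized eigenvalues\<close>

text \<open>A minimizer of the quotient of the two quadratic forms is a generalized eigenvector: \<open>D - l A\<close> is then
  positive semidefinite with a zero value at the minimizer.\<close>
lemma Rayleigh_minimum:
  fixes A D :: "real^'m^'m"
  assumes A: "A \<in> Pd" and D: "D \<in> Sym"
  obtains l v where "v \<noteq> 0" "D *v v = l *\<^sub>R (A *v v)" "\<And>u. l * (u \<bullet> (A *v u)) \<le> u \<bullet> (D *v u)"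
proof -
  let ?S = "sphere (0::real^'m) 1"
  let ?q = "\<lambda>u. (u \<bullet> (D *v u)) / (u \<bullet> (A *v u))"
  have pos: "u \<bullet> (A *v u) > 0" if "u \<noteq> 0" for u using A that by (auto simp: Pd_def)
  have "axis undefined 1 \<in> ?S" by simp
  then have ne: "?S \<noteq> {}" by blast
  have "continuous_on ?S ?q"
  proof (intro continuous_on_divide continuous_on_inner continuous_on_id ballI)
    fix u :: "real^'m" assume "u \<in> ?S"
    then have "u \<noteq> 0" by auto
    then show "u \<bullet> (A *v u) \<noteq> 0" using pos[of u] by linarith
  qed (simp_all add: linear_continuous_on)
  then obtain v where v: "v \<in> ?S" "\<And>u. u \<in> ?S \<Longrightarrow> ?q v \<le> ?q u"
    using continuous_attains_inf[OF compact_sphere ne] by blast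
  define l where "l = ?q v"
  have v0: "v \<noteq> 0" using v(1) by auto
  define M where "M = D - l *\<^sub>R A"
  have Ms: "M \<in> Sym" using D A Pd_Sym subspace_Sym unfolding M_def
    by (meson subspace_diff subspace_scale)
  have Mv: "M *v u = D *v u - l *\<^sub>R (A *v u)" for u
    by (simp add: M_def matrix_vector_mult_diff_rdistrib scaleR_matrix_vector_assoc)
  have le: "l * (u \<bullet> (A *v u)) \<le> u \<bullet> (D *v u)" for u
  proof (cases "u = 0")
    case False
    have "l \<le> ?q (u /\<^sub>R norm u)" using False v(2)[of "u /\<^sub>R norm u"] by (simp add: l_def)
    also have "\<dots> = ?q u" using False by (simp add: matrix_vector_mult_scaleR)
    finally show ?thesis using pos[OF False] by (simp add: field_simps)
  qed simp
  have psd: "0 \<le> u \<bullet> (M *v u)" for u using le[of u] by (simp add: Mv inner_diff_right)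
  have zero: "v \<bullet> (M *v v) = 0" using pos[OF v0] by (simp add: Mv inner_diff_right l_def)
  (* moving from v a little against M v would make the form negative *)
  have "M *v v = 0"
  proof (rule ccontr)
    assume "M *v v \<noteq> 0"
    define z where "z = M *v v"
    define a where "a = z \<bullet> z"
    define b where "b = z \<bullet> (M *v z)"
    have a: "a > 0" using \<open>M *v v \<noteq> 0\<close> by (simp add: a_def z_def)
    have b: "b \<ge> 0" using psd by (simp add: b_def)
    have vz: "v \<bullet> (M *v z) = a" using Sym_inner[OF Ms, of v z] by (simp add: a_def z_def)
    have ex: "(v - t *\<^sub>R z) \<bullet> (M *v (v - t *\<^sub>R z)) = - 2 * (t * a) + t * (t * b)" for t
    proof -
      have "(v - t *\<^sub>R z) \<bullet> (M *v (v - t *\<^sub>R z)) = (v - t *\<^sub>R z) \<bullet> (z - t *\<^sub>R (M *v z))"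
        by (simp add: matrix_vector_mult_diff_distrib matrix_vector_mult_scaleR z_def)
      also have "\<dots> = v \<bullet> z - t * (v \<bullet> (M *v z)) - t * (z \<bullet> z) + t * (t * (z \<bullet> (M *v z)))"
        by (simp add: inner_diff_left inner_diff_right algebra_simps)
      finally show ?thesis using zero vz by (simp add: a_def b_def z_def)
    qed
    define t where "t = a / (b + 1)"
    have t: "t > 0" "t * b \<le> a" using a b by (simp_all add: t_def field_simps)
    have "0 \<le> - 2 * (t * a) + t * (t * b)" using psd[of "v - t *\<^sub>R z"] ex by simp
    moreover have "t * (t * b) \<le> t * a" using t by (intro mult_left_mono) auto
    moreover have "t * a > 0" using t a by simp
    ultimately show False by linarith
  qed
  then have "D *v v = l *\<^sub>R (A *v v)" by (simp add: Mv)
  with v0 le that show ?thesis by blast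
qed

lemma finite_Pd_orthogonal:
  fixes A :: "real^'m^'m"
  assumes A: "A \<in> Pd" and nz: "0 \<notin> C"
    and orth: "\<And>u v. u \<in> C \<Longrightarrow> v \<in> C \<Longrightarrow> u \<noteq> v \<Longrightarrow> u \<bullet> (A *v v) = 0"
  shows "finite C"
proof -
  have "independent C"
  proof
    assume "dependent C"
    then obtain t c v0 where t: "finite t" "t \<subseteq> C" "v0 \<in> t" "c v0 \<noteq> 0"
      and z: "(\<Sum>v\<in>t. c v *\<^sub>R v) = 0"
      unfolding dependent_explicit by blast
    have v0: "v0 \<noteq> 0" using t nz by blast
    have "0 = (\<Sum>v\<in>t. c v *\<^sub>R v) \<bullet> (A *v v0)" by (simp add: z)
    also have "\<dots> = (\<Sum>v\<in>t. c v * (v \<bullet> (A *v v0)))" by (simp add: inner_sum_left)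
    also have "\<dots> = (\<Sum>v\<in>t. if v = v0 then c v0 * (v0 \<bullet> (A *v v0)) else 0)"
      using orth t by (intro sum.cong) auto
    also have "\<dots> = c v0 * (v0 \<bullet> (A *v v0))" using t by simp
    finally show False using t v0 A by (auto simp: Pd_def)
  qed
  then show ?thesis by (rule independent_imp_finite)
qed

text \<open>Gram-Schmidt for the inner product of \<open>A\<close>.\<close>
lemma Pd_orthonormal_family:
  fixes A :: "real^'m^'m"
  assumes A: "A \<in> Pd"
  shows "k \<le> CARD('m) \<Longrightarrow> \<exists>S::(real^'m) set. finite S \<and> card S = k \<and>
    (\<forall>u\<in>S. \<forall>v\<in>S. u \<bullet> (A *v v) = (if u = v then 1 else 0))"
proof (induction k)
  case 0
  show ?case by (intro exI[of _ "{}"]) auto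
next
  case (Suc k)
  then obtain S :: "(real^'m) set" where S: "finite S" "card S = k"
    "\<And>u v. u \<in> S \<Longrightarrow> v \<in> S \<Longrightarrow> u \<bullet> (A *v v) = (if u = v then 1 else 0)" by auto
  have "dim S < DIM(real^'m)" using dim_le_card'[OF S(1)] S(2) Suc.prems by simp
  then have "span S \<noteq> UNIV" using dim_eq_full[of S] by simp
  then obtain v where v: "v \<notin> span S" by blast
  define z where "z = v - (\<Sum>s\<in>S. (s \<bullet> (A *v v)) *\<^sub>R s)"
  have zs: "z \<notin> span S"
    using v span_add[of z S "\<Sum>s\<in>S. (s \<bullet> (A *v v)) *\<^sub>R s"]
    by (metis (mono_tags, lifting) z_def diff_add_cancel span_base span_scale span_sum)
  then have "z \<noteq> 0" using span_zero by blast
  then have zp: "z \<bullet> (A *v z) > 0" using A by (auto simp: Pd_def)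
  have sz: "s \<bullet> (A *v z) = 0" if s: "s \<in> S" for s
  proof -
    have "s \<bullet> (A *v z) = s \<bullet> (A *v v) - (\<Sum>r\<in>S. (r \<bullet> (A *v v)) * (s \<bullet> (A *v r)))"
      by (simp add: z_def matrix_vector_mult_diff_distrib linear_sum[of "(*v) A"] matrix_vector_mult_scaleR
          inner_diff_right inner_sum_right)
    also have "(\<Sum>r\<in>S. (r \<bullet> (A *v v)) * (s \<bullet> (A *v r))) = (\<Sum>r\<in>S. if r = s then s \<bullet> (A *v v) else 0)"
      using S(3) s by (intro sum.cong) auto
    finally show ?thesis using S(1) s by simp
  qed
  define u where "u = (1 / sqrt (z \<bullet> (A *v z))) *\<^sub>R z"
  have uS: "u \<notin> S"
  proof
    assume "u \<in> S"
    then have "sqrt (z \<bullet> (A *v z)) *\<^sub>R u \<in> span S" by (simp add: span_base span_scale)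
    then show False using zs zp by (simp add: u_def)
  qed
  have uu: "u \<bullet> (A *v u) = 1"
    using zp by (simp add: u_def matrix_vector_mult_scaleR flip: real_sqrt_mult)
  have us: "s \<bullet> (A *v u) = 0" "u \<bullet> (A *v s) = 0" if "s \<in> S" for s
    using sz[OF that] Sym_inner[OF Pd_Sym[OF A], of u s]
    by (simp_all add: u_def matrix_vector_mult_scaleR)
  show ?case
    using S uS uu us by (intro exI[of _ "insert u S"]) auto
qed

lemma Pd_factorization:
  fixes A :: "real^'m^'m"
  assumes A: "A \<in> Pd"
  obtains Q :: "real^'m^'m" where "Q ** (transpose Q ** A) = mat 1"
proof -
  obtain S :: "(real^'m) set" where S: "finite S" "card S = CARD('m)"
    "\<And>u v. u \<in> S \<Longrightarrow> v \<in> S \<Longrightarrow> u \<bullet> (A *v v) = (if u = v then 1 else 0)"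
    using Pd_orthonormal_family[OF A order_refl] by auto
  obtain b :: "'m \<Rightarrow> real^'m" where b: "bij_betw b UNIV S"
    using S finite_same_card_bij[of "UNIV::'m set" S] by auto
  define Q where "Q = transpose (\<chi> j. b j)"
  have Qb: "Q *v axis j 1 = b j" for j
    by (simp add: Q_def matrix_vector_mult_basis column_def transpose_def vec_eq_iff)
  have "(transpose Q ** A ** Q) $ i $ j = (mat 1 :: real^'m^'m) $ i $ j" for i j
  proof -
    have "(transpose Q ** A ** Q) $ i $ j = axis i 1 \<bullet> ((transpose Q ** A ** Q) *v axis j 1)"
      by (simp add: matrix_vector_mult_basis column_def inner_axis')
    also have "\<dots> = axis i 1 \<bullet> (transpose Q *v (A *v b j))"
      by (simp add: Qb flip: matrix_vector_mul_assoc)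
    also have "\<dots> = b i \<bullet> (A *v b j)"
      using dot_lmul_matrix[of "axis i 1" "transpose Q" "A *v b j"]
      by (metis Qb transpose_matrix_vector transpose_transpose)
    also have "\<dots> = (mat 1 :: real^'m^'m) $ i $ j"
      using S(3)[of "b i" "b j"] b by (auto simp: mat_def bij_betw_def inj_on_def)
    finally show ?thesis .
  qed
  then have "transpose Q ** A ** Q = mat 1" by (simp add: vec_eq_iff)
  then have "Q ** (transpose Q ** A) = mat 1" using matrix_left_right_inverse by blast
  then show ?thesis by (rule that)
qed

text \<open>Symmetry of \<open>A M\<close> says that \<open>M\<close> is self-adjoint for the inner product of \<open>A\<close>. The trace of
  \<open>M\<^sup>2\<close>, computed in an orthonormal basis of that inner product, is a sum of squares.\<close>
lemma trace_square_nonneg: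
  fixes A M :: "real^'m^'m"
  assumes A: "A \<in> Pd" and AM: "A ** M \<in> Sym"
  shows "0 \<le> trace (M ** M)"
proof -
  obtain Q :: "real^'m^'m" where Q: "Q ** (transpose Q ** A) = mat 1"
    by (rule Pd_factorization[OF A])
  define N where "N = M ** Q"
  have sym: "A ** M = transpose M ** A"
    using Sym_transpose[OF AM] Sym_transpose[OF Pd_Sym[OF A]] by (simp add: matrix_transpose_mul)
  have "M ** M = (Q ** (transpose Q ** A)) ** (M ** M)" by (simp only: Q matrix_mul_lid)
  also have "\<dots> = Q ** (transpose Q ** (A ** M ** M))" by (simp only: matrix_mul_assoc)
  finally have "trace (M ** M) = trace (Q ** (transpose Q ** (A ** M ** M)))" by (rule arg_cong)
  also have "\<dots> = trace (transpose Q ** (A ** M ** M) ** Q)" by (rule trace_mul_sym)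
  also have "A ** M ** M = transpose M ** A ** M" by (simp only: sym)
  also have "transpose Q ** (transpose M ** A ** M) ** Q = transpose N ** (A ** N)"
    by (simp add: N_def matrix_transpose_mul matrix_mul_assoc)
  also have "trace \<dots> = N \<bullet> (A ** N)" by (rule inner_matrix_trace[symmetric])
  also have "\<dots> = (\<Sum>j\<in>UNIV. (N *v axis j 1) \<bullet> (A *v (N *v axis j 1)))"
    by (simp add: inner_matrix_columns matrix_vector_mul_assoc)
  also have "\<dots> \<ge> 0"
    by (intro sum_nonneg Pd_nonneg[OF A])
  finally show ?thesis .
qed

text \<open>Let \<open>X\<close> be the commutator and \<open>E\<close> the deviation of the Jordan product from \<open>k I\<close>. Then
  \<open>M = X - 2 E = 2 (k I - V A)\<close>, and \<open>A M\<close> is symmetric. So \<open>M\<^sup>2\<close> has nonnegative trace; as \<open>X\<close> is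
  skew and \<open>E\<close> symmetric, this trace is \<open>4 \<parallel>E\<parallel>\<^sup>2 - \<parallel>X\<parallel>\<^sup>2\<close>. The point is that the constant depends on no
  condition number of \<open>A\<close>.\<close>
lemma commutator_bound:
  fixes A V :: "real^'m^'m"
  assumes A: "A \<in> Pd" and V: "V \<in> Sym"
  shows "norm (A ** V - V ** A) \<le> 2 * norm (jprod A V - k *\<^sub>R mat 1)"
proof -
  define X where "X = A ** V - V ** A"
  define E where "E = jprod A V - k *\<^sub>R mat 1"
  have tA: "transpose A = A" "transpose V = V" using A V by (auto simp: Pd_Sym Sym_transpose)
  have tX: "transpose X = - X" by (simp add: X_def transpose_linear matrix_transpose_mul tA)
  have tE: "transpose E = E"
    by (simp add: E_def jprod_def transpose_linear matrix_transpose_mul tA add.commute)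
  have XE: "X - 2 *\<^sub>R E = (2 * k) *\<^sub>R mat 1 - 2 *\<^sub>R (V ** A)"
    by (simp add: X_def E_def jprod_def scaleR_right_diff_distrib) (simp add: scaleR_2)
  have "A ** (X - 2 *\<^sub>R E) = (2 * k) *\<^sub>R A - 2 *\<^sub>R (A ** V ** A)"
    unfolding XE by (simp add: mm.diff_right mm.scaleR_right matrix_mul_assoc)
  then have "A ** (X - 2 *\<^sub>R E) \<in> Sym"
    by (simp add: Sym_def transpose_linear matrix_transpose_mul tA matrix_mul_assoc)
  from trace_square_nonneg[OF A this]
  have "0 \<le> transpose (X - 2 *\<^sub>R E) \<bullet> (X - 2 *\<^sub>R E)" by (simp add: inner_matrix_trace)
  also have "\<dots> = 4 * (E \<bullet> E) - X \<bullet> X"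
    by (simp add: transpose_linear tX tE inner_diff_left inner_diff_right inner_commute)
  finally have "(norm X)\<^sup>2 \<le> (2 * norm E)\<^sup>2" by (simp add: power2_norm_eq_inner power_mult_distrib)
  then show ?thesis unfolding X_def E_def by (rule power2_le_imp_le) simp
qed

subsection \<open>The Jordan product\<close>

lemma bounded_bilinear_jprod: "bounded_bilinear (jprod :: real^'m^'m \<Rightarrow> real^'m^'m \<Rightarrow> real^'m^'m)"
  apply (subst bilinear_conv_bounded_bilinear[symmetric])
  apply (auto simp: bilinear_def linear_iff jprod_def mm.add_left mm.add_right mm.scaleR_left
      mm.scaleR_right scaleR_add_right)
  done

interpretation jp: bounded_bilinear "jprod :: real^'m^'m \<Rightarrow> real^'m^'m \<Rightarrow> real^'m^'m"
  by (rule bounded_bilinear_jprod)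

lemma norm_jprod: "norm (jprod A B) \<le> norm A * norm B"
proof -
  have "norm (A ** B + B ** A) \<le> norm A * norm B + norm B * norm A"
    by (intro norm_triangle_le add_mono norm_matrix_mult)
  then show ?thesis by (simp add: jprod_def)
qed

lemma jprod_Sym: "A \<in> Sym \<Longrightarrow> B \<in> Sym \<Longrightarrow> jprod A B \<in> Sym"
  by (simp add: Sym_def jprod_def transpose_linear matrix_transpose_mul add.commute)

lemma jprod_quadratic_form:
  assumes "A \<in> Sym" "B \<in> Sym" "A *v v = l *\<^sub>R v"
  shows "v \<bullet> (jprod A B *v v) = l * (v \<bullet> (B *v v))"
proof -
  have "v \<bullet> (jprod A B *v v) = (v \<bullet> (A *v (B *v v)) + v \<bullet> (B *v (A *v v))) / 2"
    by (simp add: jprod_def matrix_vector_mult_add_rdistrib matrix_vector_mul_assoc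
        inner_add_right flip: scaleR_matrix_vector_assoc)
  also have "v \<bullet> (A *v (B *v v)) = l * (v \<bullet> (B *v v))"
    using Sym_inner[OF assms(1), of v "B *v v"] assms(3) by (simp add: inner_commute)
  finally show ?thesis using assms(3) by (simp add: matrix_vector_mult_scaleR)
qed

lemma norm_mat_1_ge: "1 \<le> norm (mat 1 :: real^'m^'m)"
  using norm_matrix_vector[of "mat 1 :: real^'m^'m" "axis undefined 1"] by simp

lemma mat_1_Pd: "mat 1 \<in> (Pd :: (real^'m^'m) set)"
  by (auto simp: Pd_def Sym_def transpose_mat)

lemma jprod_coercive:
  fixes A Y :: "real^'m^'m"
  assumes A: "A \<in> Sym" and c: "\<And>u. c * (u \<bullet> u) \<le> u \<bullet> (A *v u)"
  shows "c * (norm Y)\<^sup>2 \<le> Y \<bullet> jprod A Y"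
proof -
  have *: "c * (norm Y)\<^sup>2 \<le> Y \<bullet> (A ** Y)" for Y :: "real^'m^'m"
  proof -
    have "c * (norm Y)\<^sup>2 = (\<Sum>j\<in>UNIV. c * ((Y *v axis j 1) \<bullet> (Y *v axis j 1)))"
      by (simp only: power2_norm_eq_inner inner_matrix_columns sum_distrib_left)
    also have "\<dots> \<le> (\<Sum>j\<in>UNIV. (Y *v axis j 1) \<bullet> (A *v (Y *v axis j 1)))"
      by (intro sum_mono c)
    finally show ?thesis by (simp add: inner_matrix_columns[of Y "A ** Y"] matrix_vector_mul_assoc)
  qed
  have "c * (norm Y)\<^sup>2 \<le> Y \<bullet> (Y ** A)"
    using *[of "transpose Y"] inner_transpose[of Y "A ** transpose Y"] Sym_transpose[OF A]
    by (simp add: norm_transpose matrix_transpose_mul)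
  then show ?thesis using *[of Y] by (simp add: jprod_def inner_add_right)
qed

lemma jprod_norm_lower:
  fixes A Y :: "real^'m^'m"
  assumes A: "A \<in> Sym" and c: "\<And>u. c * (u \<bullet> u) \<le> u \<bullet> (A *v u)"
  shows "c * norm Y \<le> norm (jprod A Y)"
proof (cases "Y = 0")
  case False
  have "c * (norm Y)\<^sup>2 \<le> Y \<bullet> jprod A Y" by (rule jprod_coercive[OF A c])
  also have "\<dots> \<le> norm Y * norm (jprod A Y)" by (rule norm_cauchy_schwarz)
  finally show ?thesis using False by (simp add: power2_eq_square)
qed simp

lemma Pd_coercive:
  fixes A :: "real^'m^'m"
  assumes A: "A \<in> Pd"
  obtains c v where "c > 0" "v \<noteq> 0" "A *v v = c *\<^sub>R v" "\<And>u. c * (u \<bullet> u) \<le> u \<bullet> (A *v u)"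
proof -
  obtain l v where lv: "v \<noteq> 0" "A *v v = l *\<^sub>R (mat 1 *v v)"
    "\<And>u. l * (u \<bullet> (mat 1 *v u)) \<le> u \<bullet> (A *v u)"
    using Rayleigh_minimum[OF mat_1_Pd Pd_Sym[OF A]] by metis
  have "0 < l * (v \<bullet> v)" using Pd_pos[OF A lv(1)] lv(2) by simp
  moreover have "v \<bullet> v > 0" using lv(1) by simp
  ultimately have "l > 0" by (rule zero_less_mult_pos2)
  with lv that show ?thesis by simp
qed

text \<open>Coercivity gives injectivity on all matrices, hence surjectivity; the preimage of a symmetric
  matrix is symmetric by uniqueness, as its transpose is a preimage too.\<close>
lemma bij_betw_jprod_Sym:
  fixes A :: "real^'m^'m"
  assumes A: "A \<in> Pd"
  shows "bij_betw (jprod A) Sym Sym"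
proof -
  obtain c and v :: "real^'m" where c: "c > 0" "\<And>u. c * (u \<bullet> u) \<le> u \<bullet> (A *v u)"
    using Pd_coercive[OF A] by metis
  have lin: "linear (jprod A)" by (simp add: bounded_linear.linear jp.bounded_linear_right)
  have inj: "inj (jprod A)"
    unfolding linear_injective_0[OF lin]
    using jprod_norm_lower[OF Pd_Sym[OF A] c(2)] c(1)
    by (metis mult_le_0_iff norm_le_zero_iff norm_zero not_le)
  have "\<exists>Y\<in>Sym. jprod A Y = Z" if Z: "Z \<in> Sym" for Z
  proof -
    obtain Y where Y: "jprod A Y = Z"
      using linear_injective_imp_surjective[OF lin inj] by (metis surjD)
    have "jprod A (transpose Y) = transpose (jprod A Y)"
      using Sym_transpose[OF Pd_Sym[OF A]]
      by (simp add: jprod_def transpose_linear matrix_transpose_mul add.commute)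
    then have "transpose Y = Y" using inj Y Z by (metis Sym_transpose injD)
    then show ?thesis using Y by (auto simp: Sym_def)
  qed
  moreover have "jprod A ` Sym \<subseteq> Sym" using jprod_Sym Pd_Sym[OF A] by blast
  ultimately show ?thesis using inj by (auto simp: bij_betw_def inj_on_def inj_def)
qed

lemma
  assumes A: "A \<in> Pd" and Z: "Z \<in> Sym"
  shows jinv_Sym: "jinv A Z \<in> Sym" and jprod_jinv: "jprod A (jinv A Z) = Z"
  using bij_betw_jprod_Sym[OF A] Z
  by (auto simp: jinv_def bij_betw_def intro: inv_into_into f_inv_into_f)

lemma jinv_eqI: "A \<in> Pd \<Longrightarrow> Y \<in> Sym \<Longrightarrow> jprod A Y = Z \<Longrightarrow> jinv A Z = Y"
  using bij_betw_jprod_Sym[of A] by (auto simp: jinv_def bij_betw_def)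

lemma jinv_linear:
  assumes A: "A \<in> Pd" and Z: "Z1 \<in> Sym" "Z2 \<in> Sym"
  shows "jinv A (Z1 + Z2) = jinv A Z1 + jinv A Z2" "jinv A (c *\<^sub>R Z1) = c *\<^sub>R jinv A Z1"
  by (rule jinv_eqI[OF A]; use Z A in \<open>simp add: jp.add_right jp.scaleR_right jprod_jinv jinv_Sym
     subspace_add[OF subspace_Sym] subspace_scale[OF subspace_Sym]\<close>)+

text \<open>The equations (b) of the Newton system contain \<open>\<L>\<^sub>V\<close> averaged with its conjugate
  \<open>\<L>\<^sub>A \<L>\<^sub>V \<L>\<^sub>A\<^sup>-\<^sup>1\<close>; this is the difference of the two.\<close>

definition scaling_defect :: "real^'m^'m \<Rightarrow> real^'m^'m \<Rightarrow> real^'m^'m \<Rightarrow> real^'m^'m" where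
  "scaling_defect A V Z = jprod A (jprod V (jinv A Z)) - jprod V Z"

text \<open>The commutator of the operators \<open>\<L>\<^sub>A\<close> and \<open>\<L>\<^sub>V\<close> is a quarter of the double commutator.\<close>
lemma scaling_defect_commutator:
  fixes A V Z :: "real^'m^'m"
  assumes A: "A \<in> Pd" and Z: "Z \<in> Sym"
  defines "X \<equiv> A ** V - V ** A"
  shows "scaling_defect A V Z = (1/4) *\<^sub>R (X ** jinv A Z - jinv A Z ** X)"
proof -
  define Y where "Y = jinv A Z"
  have "scaling_defect A V Z = jprod A (jprod V Y) - jprod V (jprod A Y)"
    by (simp add: scaling_defect_def Y_def jprod_jinv[OF A \<open>Z \<in> Sym\<close>])
  also have "\<dots> = (1/4) *\<^sub>R (X ** Y - Y ** X)"
    by (simp add: jprod_def X_def mm.add_left mm.add_right mm.diff_left mm.diff_right mm.scaleR_left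
        mm.scaleR_right matrix_mul_assoc scaleR_add_right scaleR_diff_right)
  finally show ?thesis by (simp add: Y_def)
qed

text \<open>At a unit eigenvector \<open>v\<close> of the smallest eigenvalue \<open>c\<close> of \<open>A\<close>, the form of \<open>A \<circ> V\<close> has the value
  \<open>c (v \<bullet> V v)\<close>; near the central path this value is at least \<open>k / 2\<close>.\<close>
lemma near_central_coercive:
  fixes A V :: "real^'m^'m"
  assumes A: "A \<in> Pd" and V: "V \<in> Sym"
    and E: "norm (jprod A V - k *\<^sub>R mat 1) \<le> k / 2"
  shows "k * (u \<bullet> u) \<le> 2 * norm V * (u \<bullet> (A *v u))"
proof -
  obtain c v where c: "c > 0" "v \<noteq> 0" "A *v v = c *\<^sub>R v" "\<And>u. c * (u \<bullet> u) \<le> u \<bullet> (A *v u)"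
    using Pd_coercive[OF A] by metis
  have "\<bar>v \<bullet> ((jprod A V - k *\<^sub>R mat 1) *v v)\<bar> \<le> k / 2 * (v \<bullet> v)"
    using quadratic_form_le_norm[of v "jprod A V - k *\<^sub>R mat 1"] mult_right_mono[OF E, of "v \<bullet> v"]
    by simp
  moreover have "v \<bullet> ((jprod A V - k *\<^sub>R mat 1) *v v) = c * (v \<bullet> (V *v v)) - k * (v \<bullet> v)"
    using jprod_quadratic_form[OF Pd_Sym[OF A] V c(3)]
    by (simp add: matrix_vector_mult_diff_rdistrib inner_diff_right flip: scaleR_matrix_vector_assoc)
  ultimately have "k / 2 * (v \<bullet> v) \<le> c * (v \<bullet> (V *v v))" by linarith
  also have "\<dots> \<le> c * (norm V * (v \<bullet> v))"
    using quadratic_form_le_norm[of v V] c(1) by (intro mult_left_mono) auto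
  finally have "k / 2 * (v \<bullet> v) \<le> (c * norm V) * (v \<bullet> v)" by (simp add: mult.assoc)
  moreover have "v \<bullet> v > 0" using c(2) by simp
  ultimately have "k / 2 \<le> c * norm V" by (simp add: mult_le_cancel_right)
  then have k: "k \<le> 2 * norm V * c" by (simp add: mult.commute)
  have "k * (u \<bullet> u) \<le> 2 * norm V * c * (u \<bullet> u)" using k by (intro mult_right_mono) auto
  also have "\<dots> = 2 * norm V * (c * (u \<bullet> u))" by simp
  also have "\<dots> \<le> 2 * norm V * (u \<bullet> (A *v u))" using c(4) by (intro mult_left_mono) auto
  finally show ?thesis .
qed

text \<open>The commutator contributes \<open>2 \<parallel>E\<parallel>\<close> and the inverse of \<open>\<L>\<^sub>A\<close> contributes \<open>2 \<parallel>V\<parallel> / k\<close>, so the defect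
  is small relative to \<open>Z\<close> even though \<open>\<L>\<^sub>A\<^sup>-\<^sup>1\<close> alone is unbounded as \<open>k\<close> tends to \<open>0\<close>.\<close>
lemma scaling_defect_bound:
  fixes A V :: "real^'m^'m"
  assumes A: "A \<in> Pd" and V: "V \<in> Sym" and Z: "Z \<in> Sym" and k: "k > 0"
    and E: "norm (jprod A V - k *\<^sub>R mat 1) \<le> k / 2"
  shows "norm (scaling_defect A V Z)
    \<le> 2 * norm V * (norm (jprod A V - k *\<^sub>R mat 1) / k) * norm Z"
proof -
  define X where "X = A ** V - V ** A"
  define Y where "Y = jinv A Z"
  define e where "e = norm (jprod A V - k *\<^sub>R mat 1)"
  have X: "norm X \<le> 2 * e" unfolding X_def e_def by (rule commutator_bound[OF A V])
  have "V \<noteq> 0"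
  proof
    assume "V = 0"
    then have "k * norm (mat 1 :: real^'m^'m) \<le> k / 2" using E k by (simp add: jp.zero_right)
    then show False using norm_mat_1_ge[where 'm = 'm] k by (simp add: field_simps)
  qed
  then have V0: "norm V > 0" by simp
  have "k / (2 * norm V) * (u \<bullet> u) \<le> u \<bullet> (A *v u)" for u
    using near_central_coercive[OF A V E, of u] V0 by (simp add: field_simps)
  from jprod_norm_lower[OF Pd_Sym[OF A] this, of Y]
  have "k / (2 * norm V) * norm Y \<le> norm Z" using jprod_jinv[OF A Z] by (simp add: Y_def)
  then have Y: "norm Y \<le> 2 * norm V / k * norm Z" using k V0 by (simp add: field_simps)
  have "norm (scaling_defect A V Z) = norm (X ** Y - Y ** X) / 4"
    using scaling_defect_commutator[OF A Z, of V] by (simp add: X_def Y_def)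
  also have "\<dots> \<le> (norm X * norm Y + norm Y * norm X) / 4"
    by (intro divide_right_mono order_trans[OF norm_triangle_ineq4] add_mono norm_matrix_mult) auto
  also have "\<dots> = norm X * norm Y / 2" by simp
  also have "\<dots> \<le> (2 * e) * (2 * norm V / k * norm Z) / 2"
    by (intro divide_right_mono mult_mono X Y) (auto simp: e_def)
  also have "\<dots> = 2 * norm V * (e / k) * norm Z" by simp
  finally show ?thesis by (simp add: e_def)
qed

subsection \<open>Staying positive definite\<close>

text \<open>If \<open>A + D\<close> were not positive definite, the least generalized eigenvalue \<open>l\<close> of \<open>D\<close> relative to \<open>A\<close>
  would be at most \<open>-1\<close>, and the segment would meet a singular matrix at \<open>t = - 1 / l\<close>.\<close>
lemma Pd_along_segment:
  fixes A B D E :: "real^'m^'m"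
  assumes A: "A \<in> Pd" and D: "D \<in> Sym"
    and J: "\<And>t v. 0 \<le> t \<Longrightarrow> t \<le> 1 \<Longrightarrow> v \<noteq> 0 \<Longrightarrow> (A + t *\<^sub>R D) *v v = 0 \<Longrightarrow> False"
  shows "A + D \<in> Pd"
proof -
  obtain l v where lv: "v \<noteq> 0" "D *v v = l *\<^sub>R (A *v v)" "\<And>u. l * (u \<bullet> (A *v u)) \<le> u \<bullet> (D *v u)"
    using Rayleigh_minimum[OF A D] by metis
  have "l > -1"
  proof (rule ccontr)
    assume l: "\<not> l > -1"
    define t where "t = - (1 / l)"
    have t: "0 \<le> t" "t \<le> 1" using l by (auto simp: t_def field_simps)
    have "(A + t *\<^sub>R D) *v v = 0"
      using l lv(2) by (simp add: t_def matrix_vector_mult_diff_rdistrib flip: scaleR_matrix_vector_assoc)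
    then show False using J t lv(1) by blast
  qed
  have "0 < v \<bullet> ((A + D) *v v)" if "v \<noteq> 0" for v
  proof -
    have "0 < (1 + l) * (v \<bullet> (A *v v))" using \<open>l > -1\<close> Pd_pos[OF A that] by simp
    also have "\<dots> \<le> v \<bullet> ((A + D) *v v)"
      using lv(3)[of v] by (simp add: matrix_vector_mult_add_rdistrib inner_add_right algebra_simps)
    finally show ?thesis .
  qed
  moreover have "A + D \<in> Sym" using Pd_Sym[OF A] D by (intro subspace_add[OF subspace_Sym])
  ultimately show ?thesis by (simp add: Pd_def)
qed

text \<open>At a null vector of one of its factors the form of a Jordan product vanishes.\<close>
lemma jprod_Pd_along_segment:
  fixes A B D E :: "real^'m^'m"
  assumes A: "A \<in> Pd" "B \<in> Pd" and D: "D \<in> Sym" "E \<in> Sym"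
    and J: "\<And>t v. 0 \<le> t \<Longrightarrow> t \<le> 1 \<Longrightarrow> v \<noteq> 0 \<Longrightarrow> 0 < v \<bullet> (jprod (A + t *\<^sub>R D) (B + t *\<^sub>R E) *v v)"
  shows "A + D \<in> Pd" "B + E \<in> Pd"
proof -
  have S: "A + t *\<^sub>R D \<in> Sym" "B + t *\<^sub>R E \<in> Sym" for t
    using D Pd_Sym[OF A(1)] Pd_Sym[OF A(2)]
    by (auto intro!: subspace_add[OF subspace_Sym] subspace_scale[OF subspace_Sym])
  show "A + D \<in> Pd"
  proof (rule Pd_along_segment[OF A(1) D(1)])
    fix t :: real and v :: "real^'m" assume *: "0 \<le> t" "t \<le> 1" "v \<noteq> 0" "(A + t *\<^sub>R D) *v v = 0"
    show False using J[OF *(1-3)] jprod_quadratic_form[OF S(1)[of t] S(2)[of t], of v 0] *(4) by simp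
  qed
  show "B + E \<in> Pd"
  proof (rule Pd_along_segment[OF A(2) D(2)])
    fix t :: real and v :: "real^'m" assume *: "0 \<le> t" "t \<le> 1" "v \<noteq> 0" "(B + t *\<^sub>R E) *v v = 0"
    have "jprod (B + t *\<^sub>R E) (A + t *\<^sub>R D) = jprod (A + t *\<^sub>R D) (B + t *\<^sub>R E)"
      by (simp add: jprod_def add.commute)
    then show False using J[OF *(1-3)] jprod_quadratic_form[OF S(2)[of t] S(1)[of t], of v 0] *(4) by simp
  qed
qed

text \<open>The real eigenvalues of \<open>A\<^sup>-\<^sup>1 D\<close> are the generalized eigenvalues of \<open>D\<close> relative to \<open>A\<close>. They form a
  finite set because eigenvectors of different eigenvalues are orthogonal for the inner product of \<open>A\<close>, and
  a nonempty one by the Rayleigh quotient, so \<open>Min\<close> in \<open>lambda_min\<close> is attained; and \<open>A + D\<close>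
  multiplies the form of \<open>A\<close> at such an eigenvector by \<open>1 + l\<close>.\<close>
lemma step_len_eq_1:
  fixes A D :: "real^'m^'m"
  assumes A: "A \<in> Pd" and D: "D \<in> Sym" and AD: "A + D \<in> Pd"
  shows "step_len \<delta> A D = 1"
proof -
  have "A *v v \<noteq> 0" if "v \<noteq> 0" for v using Pd_pos[OF A that] by auto
  then have inv: "invertible A"
    using matrix_left_invertible_ker[of A] by (auto simp: invertible_left_inverse)
  then have "\<exists>A'. A ** A' = mat 1 \<and> A' ** A = mat 1" by (simp add: invertible_def)
  then have inv_mult: "A ** matrix_inv A = mat 1" "matrix_inv A ** A = mat 1"
    unfolding matrix_inv_def by (rule someI2_ex; simp)+
  have eq: "matrix_inv A ** D *v v = l *\<^sub>R v \<longleftrightarrow> D *v v = l *\<^sub>R (A *v v)" for l v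
  proof
    assume "matrix_inv A ** D *v v = l *\<^sub>R v"
    then have "A *v (matrix_inv A ** D *v v) = l *\<^sub>R (A *v v)" by (simp add: matrix_vector_mult_scaleR)
    then show "D *v v = l *\<^sub>R (A *v v)"
      by (simp add: matrix_vector_mul_assoc matrix_mul_assoc inv_mult)
  next
    assume "D *v v = l *\<^sub>R (A *v v)"
    then have "matrix_inv A *v (D *v v) = l *\<^sub>R (matrix_inv A *v (A *v v))"
      by (simp add: matrix_vector_mult_scaleR)
    then show "matrix_inv A ** D *v v = l *\<^sub>R v"
      by (simp add: matrix_vector_mul_assoc inv_mult)
  qed
  define S where "S = {l. \<exists>v. v \<noteq> 0 \<and> D *v v = l *\<^sub>R (A *v v)}"
  have lm: "lambda_min (matrix_inv A ** D) = Min S" by (simp add: lambda_min_def S_def eq)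
  have "\<forall>l\<in>S. \<exists>v. v \<noteq> 0 \<and> D *v v = l *\<^sub>R (A *v v)" by (simp add: S_def)
  then obtain f where f: "\<And>l. l \<in> S \<Longrightarrow> f l \<noteq> 0" "\<And>l. l \<in> S \<Longrightarrow> D *v f l = l *\<^sub>R (A *v f l)"
    unfolding bchoice_iff by blast
  have orth: "f l \<bullet> (A *v f m) = 0" if "l \<in> S" "m \<in> S" "l \<noteq> m" for l m
  proof -
    have "m * (f l \<bullet> (A *v f m)) = f l \<bullet> (D *v f m)" using f(2) that by simp
    also have "\<dots> = f m \<bullet> (D *v f l)" by (rule Sym_inner[OF D])
    also have "\<dots> = l * (f m \<bullet> (A *v f l))" using f(2) that by simp
    also have "\<dots> = l * (f l \<bullet> (A *v f m))" by (simp add: Sym_inner[OF Pd_Sym[OF A], of "f m"])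
    finally show ?thesis using that(3) by simp
  qed
  have inj: "inj_on f S"
  proof
    fix l m assume *: "l \<in> S" "m \<in> S" "f l = f m"
    show "l = m" using orth[OF *(1,2)] Pd_pos[OF A f(1)[OF *(1)]] *(3) by (cases "l = m") auto
  qed
  have "finite (f ` S)"
    by (rule finite_Pd_orthogonal[OF A]) (use f(1) orth in auto)
  then have fin: "finite S" using inj finite_image_iff by blast
  have ne: "S \<noteq> {}" using Rayleigh_minimum[OF A D] unfolding S_def by (metis (mono_tags, lifting) empty_iff mem_Collect_eq)
  have "l > -1" if "l \<in> S" for l
  proof -
    have "0 < f l \<bullet> ((A + D) *v f l)" using Pd_pos[OF AD f(1)[OF that]] .
    also have "\<dots> = (1 + l) * (f l \<bullet> (A *v f l))"
      using f(2)[OF that] by (simp add: matrix_vector_mult_add_rdistrib inner_add_right algebra_simps)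
    finally show ?thesis using Pd_pos[OF A f(1)[OF that]] by (simp add: zero_less_mult_iff)
  qed
  then have "Min S > -1" using fin ne by simp
  then show ?thesis by (simp add: step_len_def lm Let_def)
qed

text \<open>The factor \<open>sqrt 2\<close> accounts for the two mirror images of an off-diagonal entry.\<close>
lemma norm_svec:
  assumes A: "A \<in> Sym"
  shows "norm (svec A) = norm A"
proof -
  let ?L = "\<Sum>i\<in>UNIV. \<Sum>j\<in>UNIV. if j < i then (A $ i $ j)\<^sup>2 else 0"
  let ?U = "\<Sum>i\<in>UNIV. \<Sum>j\<in>UNIV. if i < j then (A $ i $ j)\<^sup>2 else 0"
  let ?D = "\<Sum>i\<in>UNIV. \<Sum>j\<in>UNIV. if j = i then (A $ i $ j)\<^sup>2 else 0"
  have "(norm (svec A))\<^sup>2 = (\<Sum>p\<in>UNIV. (svec A $ p)\<^sup>2)"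
    by (simp add: norm_vec_def L2_set_def sum_nonneg)
  also have "\<dots> = (\<Sum>i\<in>UNIV. \<Sum>j\<in>UNIV. (svec A $ (i, j))\<^sup>2)"
    by (simp add: sum.cartesian_product flip: UNIV_Times_UNIV)
  also have "\<dots> = (\<Sum>i\<in>UNIV. \<Sum>j\<in>UNIV. (if j < i then (A $ i $ j)\<^sup>2 else 0)
      + (if j < i then (A $ i $ j)\<^sup>2 else 0) + (if j = i then (A $ i $ j)\<^sup>2 else 0))"
    by (intro sum.cong refl) (auto simp: svec_def power_mult_distrib)
  also have "\<dots> = ?L + ?L + ?D" by (simp only: sum.distrib)
  also have "?L + ?L + ?D = ?U + ?L + ?D"
  proof -
    have "?L = ?U" using A by (subst sum.swap) (auto simp: Sym_iff intro!: sum.cong)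
    then show ?thesis by simp
  qed
  also have "?U + ?L + ?D = (\<Sum>i\<in>UNIV. \<Sum>j\<in>UNIV. (A $ i $ j)\<^sup>2)"
    unfolding sum.distrib[symmetric] by (intro sum.cong refl) auto
  also have "\<dots> = (norm A)\<^sup>2"
    by (simp add: norm_vec_def L2_set_def sum_nonneg)
  finally show ?thesis by simp
qed

section \<open>Differential calculus\<close>

lemma ck_on_cong:
  assumes "open S" "\<And>x. x \<in> S \<Longrightarrow> f x = g x" "ck_on k f S"
  shows "ck_on k g S"
  using assms(2,3)
proof (induction k arbitrary: f g)
  case 0
  then show ?case using continuous_on_cong[of S S f g] by simp
next
  case (Suc k)
  have f: "f differentiable at x" if "x \<in> S" for x using Suc.prems(2) that by simp
  have d: "frechet_derivative f (at x) = frechet_derivative g (at x)" if "x \<in> S" for x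
    by (rule frechet_derivative_transform_within_open[OF f[OF that] assms(1) that Suc.prems(1)])
  have "g differentiable at x" if x: "x \<in> S" for x
  proof -
    obtain D where "(f has_derivative D) (at x)" using f[OF x] unfolding differentiable_def ..
    then have "(g has_derivative D) (at x)"
      using assms(1) x Suc.prems(1) by (rule has_derivative_transform_within_open)
    then show ?thesis by (rule differentiableI)
  qed
  moreover have "ck_on k (\<lambda>x. frechet_derivative g (at x) v) S" for v
  proof (rule Suc.IH)
    show "ck_on k (\<lambda>x. frechet_derivative f (at x) v) S" using Suc.prems(2) by simp
    show "frechet_derivative f (at x) v = frechet_derivative g (at x) v" if "x \<in> S" for x
      using d[OF that] by simp
  qed
  ultimately show ?case by simp
qed

lemma ck_on_Suc_imp: "ck_on (Suc k) f S \<Longrightarrow> ck_on k f S"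
proof (induction k arbitrary: f)
  case 0
  then show ?case
    by (auto intro!: continuous_at_imp_continuous_on differentiable_imp_continuous_within)
next
  case (Suc k)
  then show ?case by (metis ck_on.simps(2))
qed

lemma ck_on_componentwise:
  fixes f :: "'a::real_normed_vector \<Rightarrow> 'b::euclidean_space"
  assumes "open S" "\<And>b. b \<in> Basis \<Longrightarrow> ck_on k (\<lambda>x. f x \<bullet> b) S"
  shows "ck_on k f S"
  using assms(2)
proof (induction k arbitrary: f)
  case 0
  then show ?case by (simp add: continuous_on_componentwise[of S f])
next
  case (Suc k)
  have df: "f differentiable at x" if "x \<in> S" for x
    using Suc.prems that by (subst differentiable_componentwise_within) auto
  have "frechet_derivative (\<lambda>x. f x \<bullet> b) (at x) v = frechet_derivative f (at x) v \<bullet> b" if "x \<in> S" for x v b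
  proof -
    have "((\<lambda>x. f x \<bullet> b) has_derivative (\<lambda>v. frechet_derivative f (at x) v \<bullet> b)) (at x)"
      using df[OF that] by (auto simp: frechet_derivative_works intro!: derivative_eq_intros)
    from fun_cong[OF frechet_derivative_at[OF this], of v] show ?thesis by simp
  qed
  moreover have "ck_on k (\<lambda>x. frechet_derivative f (at x) v \<bullet> b) S" if "b \<in> Basis" for v b
    by (rule ck_on_cong[OF assms(1), of "\<lambda>x. frechet_derivative (\<lambda>x. f x \<bullet> b) (at x) v"])
       (use Suc.prems[OF that] calculation in auto)
  ultimately show ?case using df Suc.IH by auto
qed

lemma linear_Basis_sum:
  fixes D :: "'a::euclidean_space \<Rightarrow> 'b::real_normed_vector"
  assumes "linear D"
  shows "D v = (\<Sum>b\<in>Basis. (v \<bullet> b) *\<^sub>R D b)"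
proof -
  have "D (\<Sum>b\<in>Basis. (v \<bullet> b) *\<^sub>R b) = (\<Sum>b\<in>Basis. (v \<bullet> b) *\<^sub>R D b)"
    by (simp only: linear_sum[OF assms] linear_scale[OF assms])
  then show ?thesis by (simp only: euclidean_representation)
qed

lemma grad_eqI:
  fixes f :: "real^'n \<Rightarrow> real"
  assumes "(f has_derivative (\<lambda>h. G \<bullet> h)) (at x)"
  shows "grad f x = G"
  unfolding grad_def
proof (rule the_equality)
  show "GDERIV f x :> G" using assms by (simp add: gderiv_def inner_commute)
  fix D assume "GDERIV f x :> D"
  then have "(f has_derivative (\<lambda>h. h \<bullet> D)) (at x)" by (simp add: gderiv_def)
  then have "(\<lambda>h. h \<bullet> D) = (\<lambda>h. G \<bullet> h)" by (rule has_derivative_unique[OF _ assms])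
  then have "h \<bullet> D = G \<bullet> h" for h by (rule fun_cong)
  then have "h \<bullet> D = h \<bullet> G" for h by (simp only: inner_commute[of h G])
  then have "\<forall>h. h \<bullet> D = h \<bullet> G" by simp
  then show "D = G" by (simp only: vector_eq_ldot)
qed

lemma has_derivative_grad:
  fixes f :: "real^'n \<Rightarrow> real"
  assumes "f differentiable at x"
  shows "(f has_derivative (\<lambda>h. grad f x \<bullet> h)) (at x)"
proof -
  let ?D = "frechet_derivative f (at x)"
  have D: "(f has_derivative ?D) (at x)" using assms by (simp add: frechet_derivative_works)
  define G where "G = (\<Sum>b\<in>Basis. ?D b *\<^sub>R b)"
  have lin: "linear ?D" using D by (rule has_derivative_linear)
  have "?D = (\<lambda>h. G \<bullet> h)"
  proof
    fix h
    show "?D h = G \<bullet> h"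
      unfolding linear_Basis_sum[OF lin, of h] G_def inner_sum_left
      by (intro sum.cong refl) (simp add: inner_commute)
  qed
  then have G: "(f has_derivative (\<lambda>h. G \<bullet> h)) (at x)" using D by simp
  then show ?thesis using grad_eqI[OF G] by simp
qed

lemma grad_inner:
  fixes f :: "real^'n \<Rightarrow> real"
  assumes "f differentiable at x"
  shows "grad f x \<bullet> h = frechet_derivative f (at x) h"
  by (rule fun_cong[OF frechet_derivative_at[OF has_derivative_grad[OF assms]]])

lemma ck_on_grad:
  fixes f :: "real^'n \<Rightarrow> real"
  assumes "open S" "ck_on (Suc k) f S"
  shows "ck_on k (grad f) S"
proof (rule ck_on_componentwise[OF assms(1)])
  fix b :: "real^'n"
  show "ck_on k (\<lambda>x. grad f x \<bullet> b) S"
    by (rule ck_on_cong[OF assms(1), of "\<lambda>x. frechet_derivative f (at x) b"])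
       (use assms(2) in \<open>auto simp: grad_inner\<close>)
qed

lemma norm_linear_Basis:
  fixes D :: "'a::euclidean_space \<Rightarrow> 'b::real_normed_vector"
  assumes "linear D"
  shows "norm (D v) \<le> (\<Sum>b\<in>Basis. norm (D b)) * norm v"
proof -
  have "norm (D v) = norm (\<Sum>b\<in>Basis. (v \<bullet> b) *\<^sub>R D b)"
    by (rule arg_cong[OF linear_Basis_sum[OF assms]])
  also have "\<dots> \<le> (\<Sum>b\<in>Basis. norm (D b) * norm v)"
  proof (rule sum_norm_le)
    fix b :: 'a assume "b \<in> Basis"
    then show "norm ((v \<bullet> b) *\<^sub>R D b) \<le> norm (D b) * norm v"
      using mult_right_mono[OF Basis_le_norm, of b "norm (D b)" v] by (simp add: mult.commute)
  qed
  finally show ?thesis by (simp add: sum_distrib_right)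
qed

lemma ck1_Lipschitz_near:
  fixes f :: "'a::euclidean_space \<Rightarrow> 'b::real_normed_vector"
  assumes f: "ck_on 1 f S" and r: "cball x0 r \<subseteq> S"
  shows "\<exists>K\<ge>0. \<forall>x\<in>cball x0 r. \<forall>y\<in>cball x0 r. norm (f x - f y) \<le> K * norm (x - y)"
proof -
  let ?D = "\<lambda>x. frechet_derivative f (at x)"
  have "\<exists>M. \<forall>x\<in>cball x0 r. norm (?D x b) \<le> M" for b
  proof -
    have "continuous_on (cball x0 r) (\<lambda>x. ?D x b)"
      using f r by (auto intro: continuous_on_subset)
    then have "bounded ((\<lambda>x. ?D x b) ` cball x0 r)"
      by (intro compact_imp_bounded compact_continuous_image compact_cball)
    then show ?thesis unfolding bounded_iff by auto
  qed
  then obtain M where M: "\<And>b x. x \<in> cball x0 r \<Longrightarrow> norm (?D x b) \<le> M b" by metis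
  define K where "K = (\<Sum>b\<in>Basis. \<bar>M b\<bar>)"
  have K: "K \<ge> 0" by (simp add: K_def sum_nonneg)
  have der: "(f has_derivative ?D x) (at x)" if "x \<in> cball x0 r" for x
    using f r that by (auto simp: frechet_derivative_works[symmetric])
  have on: "onorm (?D x) \<le> K" if x: "x \<in> cball x0 r" for x
  proof (rule onorm_bound[OF K])
    fix v
    have "norm (?D x v) \<le> (\<Sum>b\<in>Basis. norm (?D x b)) * norm v"
      by (rule norm_linear_Basis[OF has_derivative_linear[OF der[OF x]]])
    also have "\<dots> \<le> K * norm v"
      unfolding K_def using M[OF x] by (intro mult_right_mono sum_mono) (auto simp: order_trans[OF _ abs_ge_self])
    finally show "norm (?D x v) \<le> K * norm v" .
  qed
  have "norm (f x - f y) \<le> K * norm (x - y)" if "x \<in> cball x0 r" "y \<in> cball x0 r" for x y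
    using that by (intro differentiable_bound[OF convex_cball has_derivative_at_withinI[OF der] on])
  then show ?thesis using K by blast
qed

text \<open>The quadratic remainder is uniform in both points of a ball, because the second directional
  derivatives are bounded on compact balls and make the derivative Lipschitz there.\<close>

lemma ck2_Taylor_near:
  fixes f :: "'a::euclidean_space \<Rightarrow> 'b::real_normed_vector"
  assumes S: "open S" "x0 \<in> S" and f: "ck_on 2 f S"
  shows "\<exists>r>0. \<exists>K\<ge>0. cball x0 r \<subseteq> S \<and> (\<forall>x\<in>cball x0 r. \<forall>y\<in>cball x0 r.
     norm (f y - f x - frechet_derivative f (at x) (y - x)) \<le> K * (norm (y - x))\<^sup>2 \<and>
     norm (f y - f x) \<le> K * norm (y - x) \<and>
     (\<forall>v. norm (frechet_derivative f (at y) v - frechet_derivative f (at x) v)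
        \<le> K * norm (y - x) * norm v))"
proof -
  let ?D = "\<lambda>x. frechet_derivative f (at x)"
  obtain r where r: "r > 0" "cball x0 r \<subseteq> S" using S open_contains_cball by blast
  have f2: "ck_on 1 (\<lambda>x. ?D x v) S" for v
    using f by (simp add: numeral_2_eq_2)
  have f1: "ck_on 1 f S" using f ck_on_Suc_imp[of 1 f S] by (simp add: numeral_2_eq_2)
  obtain K0 where K0: "K0 \<ge> 0" "\<And>x y. x \<in> cball x0 r \<Longrightarrow> y \<in> cball x0 r \<Longrightarrow> norm (f y - f x) \<le> K0 * norm (y - x)"
    using ck1_Lipschitz_near[OF f1 r(2)] by metis
  have "\<forall>v. \<exists>K\<ge>0. \<forall>x\<in>cball x0 r. \<forall>y\<in>cball x0 r. norm (?D x v - ?D y v) \<le> K * norm (x - y)"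
    using ck1_Lipschitz_near[OF f2 r(2)] by (rule allI)
  then obtain M where "\<forall>v. M v \<ge> 0 \<and> (\<forall>x\<in>cball x0 r. \<forall>y\<in>cball x0 r. norm (?D x v - ?D y v) \<le> M v * norm (x - y))"
    unfolding choice_iff by (rule exE)
  then have M: "\<And>v. M v \<ge> 0"
    "\<And>v x y. x \<in> cball x0 r \<Longrightarrow> y \<in> cball x0 r \<Longrightarrow> norm (?D x v - ?D y v) \<le> M v * norm (x - y)"
    by simp_all
  define K1 where "K1 = (\<Sum>b\<in>Basis. M b)"
  have K1: "K1 \<ge> 0" using M by (simp add: K1_def sum_nonneg)
  have der: "(f has_derivative ?D x) (at x)" if "x \<in> cball x0 r" for x
    using f1 r that by (auto simp: frechet_derivative_works[symmetric])
  have lip: "norm (?D y v - ?D x v) \<le> K1 * norm (y - x) * norm v"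
    if xy: "x \<in> cball x0 r" "y \<in> cball x0 r" for x y v
  proof -
    have "linear (\<lambda>v. ?D y v - ?D x v)"
      using has_derivative_linear[OF der[OF xy(1)]] has_derivative_linear[OF der[OF xy(2)]]
      by (rule linear_compose_sub[rotated])
    from norm_linear_Basis[OF this, of v]
    have "norm (?D y v - ?D x v) \<le> (\<Sum>b\<in>Basis. norm (?D y b - ?D x b)) * norm v" .
    also have "\<dots> \<le> (\<Sum>b\<in>Basis. M b * norm (y - x)) * norm v"
      using M(2) xy by (intro mult_right_mono sum_mono) auto
    finally show ?thesis by (simp add: K1_def sum_distrib_right)
  qed
  have tay: "norm (f y - f x - ?D x (y - x)) \<le> K1 * (norm (y - x))\<^sup>2"
    if xy: "x \<in> cball x0 r" "y \<in> cball x0 r" for x y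
  proof -
    (* on the second ball the derivative deviates from the one at x by O(norm (y - x)) *)
    let ?S = "cball x0 r \<inter> cball x (norm (y - x))"
    have conv: "convex ?S" by (intro convex_Int convex_cball)
    have xS: "x \<in> ?S" "y \<in> ?S" using xy by (simp_all add: dist_norm norm_minus_commute)
    have "norm (f y - f x - ?D x (y - x)) \<le> norm (y - x) * (K1 * norm (y - x))"
    proof (rule differentiable_bound_linearization[where S = ?S and f' = ?D])
      fix t :: real assume "t \<in> {0..1}"
      then have "(1 - t) *\<^sub>R x + t *\<^sub>R y \<in> ?S" by (intro convexD_alt[OF conv xS]) auto
      moreover have "x + t *\<^sub>R (y - x) = (1 - t) *\<^sub>R x + t *\<^sub>R y" by (simp add: algebra_simps)
      ultimately show "x + t *\<^sub>R (y - x) \<in> ?S" by (simp only:)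
    next
      fix z assume z: "z \<in> ?S"
      then show "(f has_derivative ?D z) (at z within ?S)"
        by (intro has_derivative_at_withinI[OF der]) simp
      have zx: "norm (z - x) \<le> norm (y - x)" using z by (simp add: dist_norm norm_minus_commute)
      have "norm ((?D z - ?D x) v) \<le> (K1 * norm (y - x)) * norm v" for v
      proof -
        have "norm ((?D z - ?D x) v) \<le> K1 * norm (z - x) * norm v" using lip[of x z v] xy z by simp
        also have "\<dots> \<le> (K1 * norm (y - x)) * norm v"
          by (intro mult_right_mono mult_left_mono zx K1) simp
        finally show ?thesis .
      qed
      then show "onorm (?D z - ?D x) \<le> K1 * norm (y - x)" using K1 by (intro onorm_bound) auto
    qed (use xS in auto)
    then show ?thesis by (simp add: power2_eq_square algebra_simps)
  qed
  define K where "K = K0 + K1"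
  have K: "K \<ge> 0" "K0 \<le> K" "K1 \<le> K" using K0(1) K1 by (simp_all add: K_def)
  have "norm (f y - f x - ?D x (y - x)) \<le> K * (norm (y - x))\<^sup>2 \<and> norm (f y - f x) \<le> K * norm (y - x)
     \<and> (\<forall>v. norm (?D y v - ?D x v) \<le> K * norm (y - x) * norm v)" if xy: "x \<in> cball x0 r" "y \<in> cball x0 r" for x y
  proof (intro conjI allI)
    show "norm (f y - f x - ?D x (y - x)) \<le> K * (norm (y - x))\<^sup>2"
      by (rule order_trans[OF tay[OF xy]]) (intro mult_right_mono K, simp)
    show "norm (f y - f x) \<le> K * norm (y - x)"
      by (rule order_trans[OF K0(2)[OF xy]]) (intro mult_right_mono K, simp)
    show "norm (?D y v - ?D x v) \<le> K * norm (y - x) * norm v" for v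
      by (rule order_trans[OF lip[OF xy]]) (intro mult_right_mono K, simp_all)
  qed
  then show ?thesis using r K(1) by blast
qed

lemma directional_derivative_right:
  fixes f :: "'a::real_normed_vector \<Rightarrow> real"
  assumes "(f has_derivative D) (at x)"
  shows "((\<lambda>h. (f (x + h *\<^sub>R d) - f x) / h) \<longlongrightarrow> D d) (at_right 0)"
proof -
  have "((\<lambda>h. f (x + h *\<^sub>R d)) has_derivative (\<lambda>h. D (h *\<^sub>R d))) (at 0)"
    by (rule has_derivative_compose[where g = f, of "\<lambda>h. x + h *\<^sub>R d"])
       (auto intro!: derivative_eq_intros assms)
  moreover have "D (h *\<^sub>R d) = D d * h" for h
    using linear_scale[OF has_derivative_linear[OF assms]] by simp
  ultimately have "((\<lambda>h. f (x + h *\<^sub>R d)) has_field_derivative D d) (at 0)"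
    by (simp add: has_field_derivative_def)
  then have "((\<lambda>h. (f (x + h *\<^sub>R d) - f x) / h) \<longlongrightarrow> D d) (at 0)"
    by (simp add: DERIV_def)
  then show ?thesis by (rule filterlim_mono) (auto simp: at_within_le_at)
qed

text \<open>An envelope theorem that needs no derivatives in \<open>\<tau>\<close>. Let \<open>p\<close> be the value function. Local
  maximality at \<open>x\<close> only gives \<open>p(x + h d) - p(x) \<le> g(x + h d, \<tau>') - g(x, \<tau>')\<close> with the moving
  point \<open>\<tau>' = t(x + h d)\<close>. By convexity the right-hand side is at most
  \<open>h/s\<close> times the difference for a fixed step \<open>s\<close>, and there \<open>\<tau>'\<close> may be replaced by its limit. So the
  derivative of \<open>p\<close> is at most that of \<open>g\<close> in every direction, and linearity gives equality.\<close>

lemma grad_local_maximum_value: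
  fixes g :: "real^'n \<Rightarrow> 'q::real_normed_vector \<Rightarrow> real"
  assumes U: "open U" "x \<in> U" and t: "t \<in> U \<rightarrow> T" "continuous_on U t"
    and cont: "continuous_on (UNIV \<times> T) (\<lambda>(x, \<tau>). g x \<tau>)"
    and conv: "\<And>\<tau>. \<tau> \<in> T \<Longrightarrow> convex_on UNIV (\<lambda>x. g x \<tau>)"
    and diff: "(\<lambda>x'. g x' (t x)) differentiable at x" "(\<lambda>x'. g x' (t x')) differentiable at x"
    and max: "\<forall>\<^sub>F \<tau>' in at (t x) within T. g x \<tau>' \<le> g x (t x)"
  shows "grad (\<lambda>x'. g x' (t x')) x = grad (\<lambda>x'. g x' (t x)) x"
proof -
  let ?p = "\<lambda>x'. g x' (t x')"
  let ?G = "grad ?p x" and ?H = "grad (\<lambda>x'. g x' (t x)) x"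
  have tx: "t x \<in> T" using U t by auto
  have le: "?G \<bullet> d \<le> ?H \<bullet> d" for d
  proof -
    have s: "?G \<bullet> d \<le> (g (x + s *\<^sub>R d) (t x) - g x (t x)) / s" if s: "s > 0" for s
    proof -
      have xh: "((\<lambda>h. x + h *\<^sub>R d) \<longlongrightarrow> x) (at_right 0)"
        by (auto intro!: tendsto_eq_intros)
      have inU: "\<forall>\<^sub>F h in at_right 0. x + h *\<^sub>R d \<in> U"
        by (rule topological_tendstoD[OF xh U])
      have tl: "((\<lambda>h. t (x + h *\<^sub>R d)) \<longlongrightarrow> t x) (at_right 0)"
        using continuous_on_tendsto_compose[OF t(2) xh U(2) inU] .
      have inT: "\<forall>\<^sub>F h in at_right 0. t (x + h *\<^sub>R d) \<in> T"
        using inU by eventually_elim (use t in auto)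
      have gl: "((\<lambda>h. g y (t (x + h *\<^sub>R d))) \<longlongrightarrow> g y (t x)) (at_right 0)" for y
      proof -
        have "((\<lambda>h. (y, t (x + h *\<^sub>R d))) \<longlongrightarrow> (y, t x)) (at_right 0)"
          by (intro tendsto_Pair tendsto_const tl)
        moreover have "\<forall>\<^sub>F h in at_right 0. (y, t (x + h *\<^sub>R d)) \<in> UNIV \<times> T"
          using inT by eventually_elim simp
        ultimately show ?thesis
          using continuous_on_tendsto_compose[OF cont, of "\<lambda>h. (y, t (x + h *\<^sub>R d))" "(y, t x)" "at_right 0"] tx
          by (simp add: case_prod_unfold)
      qed
      have R: "((\<lambda>h. (g (x + s *\<^sub>R d) (t (x + h *\<^sub>R d)) - g x (t (x + h *\<^sub>R d))) / s)
          \<longlongrightarrow> (g (x + s *\<^sub>R d) (t x) - g x (t x)) / s) (at_right 0)"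
        using s by (intro tendsto_intros gl) auto
      have L: "((\<lambda>h. (?p (x + h *\<^sub>R d) - ?p x) / h) \<longlongrightarrow> ?G \<bullet> d) (at_right 0)"
        by (rule directional_derivative_right[OF has_derivative_grad[OF diff(2)]])
      have mx: "\<forall>\<^sub>F h in at_right 0. g x (t (x + h *\<^sub>R d)) \<le> g x (t x)"
      proof -
        have "\<forall>\<^sub>F \<tau>' in nhds (t x). \<tau>' \<noteq> t x \<longrightarrow> \<tau>' \<in> T \<longrightarrow> g x \<tau>' \<le> g x (t x)"
          using max by (simp add: eventually_at_filter)
        from eventually_compose_filterlim[OF this tl] inT show ?thesis
          by eventually_elim auto
      qed
      have hs: "\<forall>\<^sub>F h in at_right 0. 0 < h \<and> h < s"
        using eventually_at_right_field s by blast
      show ?thesis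
      proof (rule tendsto_le[OF _ R L])
        show "\<forall>\<^sub>F h in at_right 0. (?p (x + h *\<^sub>R d) - ?p x) / h
          \<le> (g (x + s *\<^sub>R d) (t (x + h *\<^sub>R d)) - g x (t (x + h *\<^sub>R d))) / s"
          using inT mx hs
        proof eventually_elim
          case (elim h)
          let ?t = "t (x + h *\<^sub>R d)"
          have "(1 - h / s) *\<^sub>R x + (h / s) *\<^sub>R (x + s *\<^sub>R d) = x + h *\<^sub>R d"
            using s by (simp add: algebra_simps)
          then have "g (x + h *\<^sub>R d) ?t \<le> (1 - h / s) * g x ?t + (h / s) * g (x + s *\<^sub>R d) ?t"
            using convex_onD[OF conv[OF elim(1)], of "h / s" x "x + s *\<^sub>R d"] elim s by simp
          then have "?p (x + h *\<^sub>R d) - ?p x \<le> h * ((g (x + s *\<^sub>R d) ?t - g x ?t) / s)"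
            using elim(2) s by (simp add: algebra_simps diff_divide_distrib)
          then show ?case using elim(3) by (simp add: pos_divide_le_eq mult.commute)
        qed
      qed simp
    qed
    have "((\<lambda>h. (g (x + h *\<^sub>R d) (t x) - g x (t x)) / h) \<longlongrightarrow> ?H \<bullet> d) (at_right 0)"
      by (rule directional_derivative_right[OF has_derivative_grad[OF diff(1)]])
    then show ?thesis
      by (rule tendsto_lowerbound) (auto simp: eventually_at_right_less s intro!: eventually_mono[OF eventually_at_right_less])
  qed
  have "?G \<bullet> d = ?H \<bullet> d" for d using le[of d] le[of "- d"] by simp
  then have "\<forall>d. ?G \<bullet> d = ?H \<bullet> d" by simp
  then show ?thesis by (simp only: vector_eq_rdot)
qed

section \<open>Discrete measures\<close>

lemma Mplus_singleton: "y \<in> Mplus T \<Longrightarrow> closed T \<Longrightarrow> \<tau> \<in> T \<Longrightarrow> {\<tau>} \<in> sets y"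
  by (simp add: Mplus_def sets_restrict_space_iff borel_closed)

text \<open>Measurability of \<open>h\<close> has to be assumed even for a measure with finitely many atoms, because
  Bochner integrals of non-measurable functions are \<open>0\<close>.\<close>
lemma integral_discrete_measure:
  fixes h :: "'a \<Rightarrow> 'b::euclidean_space"
  assumes "finite_measure y" and S: "finite S" "\<And>\<tau>. \<tau> \<in> S \<Longrightarrow> {\<tau>} \<in> sets y"
    and ae: "AE \<tau> in y. \<tau> \<in> S" and h: "h \<in> borel_measurable y"
  shows "(\<integral>\<tau>. h \<tau> \<partial>y) = (\<Sum>\<tau>\<in>S. measure y {\<tau>} *\<^sub>R h \<tau>)"
proof -
  interpret finite_measure y by fact
  have "(\<integral>\<tau>. h \<tau> \<partial>y) = (\<integral>\<tau>. (\<Sum>s\<in>S. indicator {s} \<tau> *\<^sub>R h s) \<partial>y)"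
  proof (rule integral_cong_AE[OF h])
    show "(\<lambda>\<tau>. \<Sum>s\<in>S. indicator {s} \<tau> *\<^sub>R h s) \<in> borel_measurable y"
      using S by (intro borel_measurable_sum borel_measurable_scaleR borel_measurable_indicator) auto
    show "AE \<tau> in y. h \<tau> = (\<Sum>s\<in>S. indicator {s} \<tau> *\<^sub>R h s)"
      using ae
    proof eventually_elim
      case (elim \<tau>)
      have "(\<Sum>s\<in>S. indicator {s} \<tau> *\<^sub>R h s) = (\<Sum>s\<in>S. if s = \<tau> then h \<tau> else 0)"
        by (intro sum.cong) (auto simp: indicator_def)
      then show ?case using elim S by simp
    qed
  qed
  also have "\<dots> = (\<Sum>s\<in>S. \<integral>\<tau>. indicator {s} \<tau> *\<^sub>R h s \<partial>y)"
    using S by (intro Bochner_Integration.integral_sum integrable_scaleR_left integrable_real_indicator)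
       (auto simp: less_top[symmetric])
  also have "\<dots> = (\<Sum>\<tau>\<in>S. measure y {\<tau>} *\<^sub>R h \<tau>)"
  proof (intro sum.cong refl)
    fix s assume "s \<in> S"
    then have s: "{s} \<in> sets y" by (rule S(2))
    then have "{s} \<inter> space y = {s}" using sets.sets_into_space by blast
    then show "(\<integral>\<tau>. indicator {s} \<tau> *\<^sub>R h s \<partial>y) = measure y {s} *\<^sub>R h s"
      using s by (subst integral_scaleR_left) (auto simp: less_top[symmetric])
  qed
  finally show ?thesis .
qed

lemma
  assumes x: "\<And>i. i \<in> B \<Longrightarrow> i x \<in> T" and B: "finite B" and y: "\<And>i. i \<in> B \<Longrightarrow> 0 \<le> y i"
  shows as_measure_Mplus: "fst (snd (as_measure T B (x, y, V))) \<in> Mplus T"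
    and integral_as_measure: "h \<in> borel_measurable (restrict_space borel T) \<Longrightarrow>
      (\<integral>\<tau>. h \<tau> \<partial>(fst (snd (as_measure T B (x, y, V))))) = (\<Sum>i\<in>B. y i *\<^sub>R (h (i x) :: 'b::euclidean_space))"
proof -
  let ?M = "point_measure B (\<lambda>i. ennreal (y i))"
  have m: "(\<lambda>i. i x) \<in> measurable ?M (restrict_space borel T)"
    using x by (auto simp: measurable_point_measure_eq1 space_restrict_space)
  have "finite_measure ?M"
    by (rule finite_measureI) (simp add: space_point_measure emeasure_point_measure_finite B ennreal_sum_less_top)
  then have "finite_measure (distr ?M (restrict_space borel T) (\<lambda>i. i x))"
    using m by (rule finite_measure.finite_measure_distr)
  then show "fst (snd (as_measure T B (x, y, V))) \<in> Mplus T"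
    by (simp add: as_measure_def Mplus_def)
  assume h: "h \<in> borel_measurable (restrict_space borel T)"
  then show "(\<integral>\<tau>. h \<tau> \<partial>(fst (snd (as_measure T B (x, y, V))))) = (\<Sum>i\<in>B. y i *\<^sub>R h (i x))"
    using y by (simp add: as_measure_def integral_distr[OF m h] lebesgue_integral_point_measure_finite[OF B])
qed

lemma borel_measurable_con:
  assumes "sisdp P"
  shows "con P x \<in> borel_measurable (restrict_space borel (Tset P))"
proof -
  have "continuous_on (Tset P) (\<lambda>\<tau>. (\<lambda>(x, \<tau>). con P x \<tau>) (x, \<tau>))"
    by (rule continuous_on_compose2[of "UNIV \<times> Tset P"])
      (use assms in \<open>auto simp: sisdp_def intro!: continuous_intros\<close>)
  then show ?thesis by (intro borel_measurable_continuous_on_restrict) simp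
qed

text \<open>On the index set the gradient is a pointwise limit of difference quotients that are continuous
  in \<open>\<tau>\<close>; no joint smoothness of \<open>con P\<close> is available.\<close>
lemma borel_measurable_grad_con:
  assumes "sisdp P"
  shows "(\<lambda>\<tau>. grad (\<lambda>x'. con P x' \<tau>) x) \<in> borel_measurable (restrict_space borel (Tset P))"
proof -
  let ?q = "\<lambda>n \<tau>. \<Sum>b\<in>Basis. ((con P (x + (1 / real (Suc n)) *\<^sub>R b) \<tau> - con P x \<tau>) / (1 / real (Suc n))) *\<^sub>R b"
  show ?thesis
  proof (rule borel_measurable_LIMSEQ_metric)
    show "?q n \<in> borel_measurable (restrict_space borel (Tset P))" for n
      using borel_measurable_con[OF assms]
      by (intro borel_measurable_sum borel_measurable_scaleR borel_measurable_divide borel_measurable_diff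
        borel_measurable_const) auto
    fix \<tau> assume "\<tau> \<in> space (restrict_space borel (Tset P))"
    then have "(\<lambda>x. con P x \<tau>) differentiable at x"
      using assms by (auto simp: sisdp_def space_restrict_space)
    from directional_derivative_right[OF has_derivative_grad[OF this]]
    have "((\<lambda>h. (con P (x + h *\<^sub>R b) \<tau> - con P x \<tau>) / h) \<longlongrightarrow> grad (\<lambda>x'. con P x' \<tau>) x \<bullet> b) (at_right 0)" for b .
    moreover have "filterlim (\<lambda>n. 1 / real (Suc n)) (at_right 0) sequentially"
      using LIMSEQ_Suc[OF lim_1_over_n]
      by (auto simp: filterlim_at intro!: always_eventually)
    ultimately have "(\<lambda>n. (con P (x + (1 / real (Suc n)) *\<^sub>R b) \<tau> - con P x \<tau>) / (1 / real (Suc n)))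
        \<longlonglongrightarrow> grad (\<lambda>x'. con P x' \<tau>) x \<bullet> b" for b
      by (rule filterlim_compose)
    then have "(\<lambda>n. ?q n \<tau>) \<longlonglongrightarrow> (\<Sum>b\<in>Basis. (grad (\<lambda>x'. con P x' \<tau>) x \<bullet> b) *\<^sub>R b)"
      by (intro tendsto_sum tendsto_scaleR tendsto_const)
    then show "(\<lambda>n. ?q n \<tau>) \<longlonglongrightarrow> grad (\<lambda>x'. con P x' \<tau>) x"
      by (simp only: euclidean_representation)
  qed
qed

section \<open>The barrier parameters\<close>

lemma mu_pos: "valid_param p \<Longrightarrow> 0 < mu p k"
  by (induction k) (auto simp: valid_param_def)

lemma mu_tendsto_0:
  assumes v: "valid_param p"
  shows "mu p \<longlonglongrightarrow> 0"
proof -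
  have "mu p k \<le> mu0 p * beta p ^ k" for k
  proof (induction k)
    case (Suc k)
    have "mu p (Suc k) \<le> beta p * mu p k" by simp
    also have "\<dots> \<le> beta p * (mu0 p * beta p ^ k)"
      using Suc v by (intro mult_left_mono) (auto simp: valid_param_def)
    finally show ?case by (simp add: mult.left_commute)
  qed simp
  moreover have "(\<lambda>k. mu0 p * beta p ^ k) \<longlonglongrightarrow> 0"
    using v by (auto simp: valid_param_def intro!: tendsto_mult_right_zero LIMSEQ_realpow_zero)
  ultimately show ?thesis
    using mu_pos[OF v] by (intro tendsto_sandwich[of "\<lambda>_. 0" "mu p" _ "\<lambda>k. mu0 p * beta p ^ k"])
      (auto intro!: always_eventually less_imp_le)
qed

lemma mu_powr_tendsto_0:
  assumes v: "valid_param p" and a: "a > 0"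
  shows "(\<lambda>k. mu p k powr a) \<longlonglongrightarrow> 0"
  using tendsto_powr'[OF mu_tendsto_0[OF v] tendsto_const, of a] mu_pos[OF v] a
  by (auto intro!: always_eventually less_imp_le)

text \<open>Since \<open>\<mu>\<^sup>c\<^sup>\<alpha>\<close> tends to \<open>0\<close>, the superlinear term eventually attains the minimum.\<close>
lemma mu_Suc_eventually:
  assumes v: "valid_param p"
  shows "\<forall>\<^sub>F k in sequentially. mu p (Suc k) = gamma2 p * mu p k powr (1 + cexp p * alpha p)"
proof -
  have pos: "cexp p * alpha p > 0" "gamma2 p > 0" "beta p > 0" using v by (auto simp: valid_param_def)
  have "\<forall>\<^sub>F k in sequentially. mu p k powr (cexp p * alpha p) < beta p / gamma2 p"
    using order_tendstoD(2)[OF mu_powr_tendsto_0[OF v pos(1)]] pos by simp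
  then show ?thesis
  proof eventually_elim
    case (elim k)
    have "gamma2 p * mu p k powr (1 + cexp p * alpha p) = (gamma2 p * mu p k powr (cexp p * alpha p)) * mu p k"
      using mu_pos[OF v, of k] by (simp add: powr_add)
    also have "\<dots> \<le> beta p * mu p k"
      using elim pos mu_pos[OF v, of k] by (intro mult_right_mono) (auto simp: field_simps)
    finally show ?case by (simp add: min_def)
  qed
qed

lemma mu_Suc_le:
  assumes v: "valid_param p"
  shows "mu p (Suc k) \<le> mu p k"
proof -
  have "mu p (Suc k) \<le> beta p * mu p k" by simp
  also have "\<dots> \<le> 1 * mu p k"
    using v mu_pos[OF v, of k] by (intro mult_right_mono) (auto simp: valid_param_def)
  finally show ?thesis by simp
qed

text \<open>With \<open>\<mu>\<^sub>k\<^sub>+\<^sub>1 = \<gamma>\<^sub>2 \<mu>\<^sub>k\<^sup>1\<^sup>+\<^sup>c\<^sup>\<alpha>\<close> the quotient is a multiple of \<open>\<mu>\<^sub>k\<close> to the power \<open>\<alpha> (1 - c)\<close>.\<close>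

lemma mu_ratio_predictor:
  assumes v: "valid_param p" and c: "cexp p < 1"
  shows "(\<lambda>k. mu p k powr (1 + alpha p) / mu p (Suc k)) \<longlonglongrightarrow> 0"
proof -
  have "alpha p * (1 - cexp p) > 0" using v c by (simp add: valid_param_def)
  then have "(\<lambda>k. mu p k powr (alpha p * (1 - cexp p)) / gamma2 p) \<longlonglongrightarrow> 0"
    by (intro tendsto_divide_zero mu_powr_tendsto_0[OF v])
  moreover have "\<forall>\<^sub>F k in sequentially. mu p k powr (alpha p * (1 - cexp p)) / gamma2 p
      = mu p k powr (1 + alpha p) / mu p (Suc k)"
    using mu_Suc_eventually[OF v]
  proof eventually_elim
    case (elim k)
    have "mu p k powr (1 + alpha p) = mu p k powr (alpha p * (1 - cexp p)) * mu p k powr (1 + cexp p * alpha p)"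
      by (simp add: algebra_simps flip: powr_add)
    then show ?case using elim v mu_pos[OF v, of k] by (simp add: valid_param_def)
  qed
  ultimately show ?thesis by (rule Lim_transform_eventually)
qed

text \<open>Here the exponent of \<open>\<mu>\<^sub>k\<close> is
  \<open>2 (1 + \<alpha>) - (1 + c \<alpha>) (2 + \<alpha>) = \<alpha> (1 - c (\<alpha> + 2))\<close>.\<close>
lemma mu_ratio_corrector:
  assumes v: "valid_param p" and c: "cexp p * (alpha p + 2) < 1"
  shows "(\<lambda>k. (mu p k powr (1 + alpha p))\<^sup>2 / mu p (Suc k) / mu p (Suc k) powr (1 + alpha p)) \<longlonglongrightarrow> 0"
proof -
  let ?e = "alpha p * (1 - cexp p * (alpha p + 2))" and ?g = "gamma2 p powr (2 + alpha p)"
  have e: "?e > 0" using v c by (simp add: valid_param_def)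
  have g: "?g > 0" using v by (simp add: valid_param_def)
  have "(\<lambda>k. mu p k powr ?e / ?g) \<longlonglongrightarrow> 0"
    by (intro tendsto_divide_zero mu_powr_tendsto_0[OF v e])
  moreover have "\<forall>\<^sub>F k in sequentially. mu p k powr ?e / ?g
      = (mu p k powr (1 + alpha p))\<^sup>2 / mu p (Suc k) / mu p (Suc k) powr (1 + alpha p)"
    using mu_Suc_eventually[OF v]
  proof eventually_elim
    case (elim k)
    let ?m = "mu p k" and ?n = "mu p (Suc k)"
    have m: "?m > 0" "?n > 0" using mu_pos[OF v] by blast+
    have "?n * ?n powr (1 + alpha p) = ?n powr (2 + alpha p)"
      using m powr_add[of ?n 1 "1 + alpha p"] by (simp add: add.assoc[symmetric])
    also have "\<dots> = ?g * ?m powr ((1 + cexp p * alpha p) * (2 + alpha p))"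
      unfolding elim using v m by (subst powr_mult) (auto simp: valid_param_def powr_powr)
    finally have n: "?n * ?n powr (1 + alpha p) = ?g * ?m powr ((1 + cexp p * alpha p) * (2 + alpha p))" .
    have "(?m powr (1 + alpha p))\<^sup>2 = ?m powr ?e * ?m powr ((1 + cexp p * alpha p) * (2 + alpha p))"
      by (simp add: power2_eq_square algebra_simps flip: powr_add)
    then have "(?m powr (1 + alpha p))\<^sup>2 / (?n * ?n powr (1 + alpha p)) = ?m powr ?e / ?g"
      using n m g by simp
    then show ?case by simp
  qed
  ultimately show ?thesis by (rule Lim_transform_eventually)
qed

section \<open>The linear matrix map\<close>

lemma Flin_Sym: "sisdp P \<Longrightarrow> Flin P h \<in> Sym"
  unfolding Flin_def sisdp_def
  by (auto intro!: subspace_sum[OF subspace_Sym] subspace_scale[OF subspace_Sym])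

lemma Fmap_Sym: "sisdp P \<Longrightarrow> Fmap P x \<in> Sym"
  unfolding Fmap_def using Flin_Sym[of P x] by (auto simp: sisdp_def intro: subspace_add[OF subspace_Sym])

lemma linear_Flin: "linear (Flin P)"
  by (simp add: linear_iff Flin_def sum.distrib scaleR_add_left scaleR_sum_right)

lemma Fmap_add: "Fmap P (x + h) = Fmap P x + Flin P h"
  by (simp add: Fmap_def linear_add[OF linear_Flin])

lemma Fmap_diff: "Fmap P x - Fmap P y = Flin P (x - y)"
  by (simp add: Fmap_def linear_diff[OF linear_Flin])

lemma linear_mat_inner_left: "linear (\<lambda>A. mat_inner A (V :: real^'m^'m))"
  by (simp add: linear_iff mat_inner_def mm.add_left mm.scaleR_left trace_def sum.distrib sum_distrib_left)

lemma linear_mat_inner_right: "linear (\<lambda>V. mat_inner A (V :: real^'m^'m))"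
  by (simp add: linear_iff mat_inner_def mm.add_right mm.scaleR_right trace_def sum.distrib sum_distrib_left)

lemma linear_Fadj: "linear (Fadj P)"
  by (simp add: linear_iff Fadj_def vec_eq_iff linear_add[OF linear_mat_inner_right]
      linear_scale[OF linear_mat_inner_right])

lemma Fadj_adjoint: "Fadj P V \<bullet> h = mat_inner (Flin P h) V"
  by (simp add: Fadj_def Flin_def inner_vec_def linear_sum[OF linear_mat_inner_left]
      linear_scale[OF linear_mat_inner_left] mult.commute)

lemma linear_bound_pos:
  fixes f :: "'a::euclidean_space \<Rightarrow> 'b::real_normed_vector"
  assumes "linear f"
  obtains C where "C > 0" "\<And>x. norm (f x) \<le> C * norm x"
  using linear_bounded_pos[OF assms] by blast

section \<open>The reduced KKT system\<close>

definition stationarity :: "('n::finite, 'm::finite, 'q::finite) sisdp_data \<Rightarrow> ('n, 'q) branch set \<Rightarrow>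
    real^'n \<Rightarrow> (('n, 'q) branch \<Rightarrow> real) \<Rightarrow> real^'m^'m \<Rightarrow> real^'n" where
  "stationarity P B x y V = grad (obj P) x + (\<Sum>i\<in>B. y i *\<^sub>R grad (ghat P i) x) - Fadj P V"

definition hessian_map :: "(real^'n \<Rightarrow> real) \<Rightarrow> real^'n \<Rightarrow> real^'n \<Rightarrow> real^'n" where
  "hessian_map f x = frechet_derivative (grad f) (at x)"

definition lagrangian_hessian :: "('n::finite, 'm::finite, 'q::finite) sisdp_data \<Rightarrow> ('n, 'q) branch set \<Rightarrow>
    real^'n \<Rightarrow> (('n, 'q) branch \<Rightarrow> real) \<Rightarrow> real^'n \<Rightarrow> real^'n" where
  "lagrangian_hessian P B x y d = hessian_map (obj P) x d + (\<Sum>i\<in>B. y i *\<^sub>R hessian_map (ghat P i) x d)"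

text \<open>The conclusion of \<open>ck2_Taylor_near\<close> with explicit radius and constant, so that the estimates of
  finitely many functions can be put over a common ball.\<close>
definition taylor_bound :: "('a::real_normed_vector \<Rightarrow> 'b::real_normed_vector) \<Rightarrow> 'a \<Rightarrow> real \<Rightarrow> real \<Rightarrow> bool" where
  "taylor_bound f x0 r K \<longleftrightarrow> (\<forall>x\<in>cball x0 r. \<forall>y\<in>cball x0 r.
     norm (f y - f x - frechet_derivative f (at x) (y - x)) \<le> K * (norm (y - x))\<^sup>2 \<and>
     norm (f y - f x) \<le> K * norm (y - x) \<and>
     (\<forall>v. norm (frechet_derivative f (at y) v - frechet_derivative f (at x) v)
        \<le> K * norm (y - x) * norm v))"

lemma taylor_bound_mono:
  assumes "taylor_bound f x0 r K" "r' \<le> r" "K \<le> K'"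
  shows "taylor_bound f x0 r' K'"
  unfolding taylor_bound_def
proof (intro ballI conjI allI)
  fix x y v assume "x \<in> cball x0 r'" "y \<in> cball x0 r'"
  then have xy: "x \<in> cball x0 r" "y \<in> cball x0 r" using assms(2) by auto
  note T = assms(1)[unfolded taylor_bound_def, rule_format, OF xy]
  show "norm (f y - f x - frechet_derivative f (at x) (y - x)) \<le> K' * (norm (y - x))\<^sup>2"
    by (rule order_trans[OF conjunct1[OF T]]) (intro mult_right_mono assms(3), simp)
  show "norm (f y - f x) \<le> K' * norm (y - x)"
    by (rule order_trans[OF conjunct1[OF conjunct2[OF T]]]) (intro mult_right_mono assms(3), simp)
  show "norm (frechet_derivative f (at y) v - frechet_derivative f (at x) v) \<le> K' * norm (y - x) * norm v"
    using assms(1)[unfolded taylor_bound_def, rule_format, OF xy]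
    by (intro order_trans[OF spec[OF conjunct2[OF conjunct2[OF T]]]] mult_right_mono assms(3)) simp_all
qed

lemma finite_common_radius:
  assumes "finite B" and ex: "\<And>i. i \<in> B \<Longrightarrow> \<exists>r>0. \<exists>K\<ge>0. Q i r K"
    and mono: "\<And>i r K r' K'. Q i r K \<Longrightarrow> r' \<le> r \<Longrightarrow> K \<le> K' \<Longrightarrow> Q i r' (K' :: real)"
  shows "\<exists>r>0. \<exists>K\<ge>0. \<forall>i\<in>B. Q i (r :: real) K"
  using assms(1) ex
proof (induction B)
  case empty
  then show ?case by (auto intro!: exI[of _ 1])
next
  case (insert j B)
  obtain r K where rK: "r > 0" "K \<ge> 0" "\<forall>i\<in>B. Q i r K" using insert.IH insert.prems by auto
  obtain s L where sL: "s > 0" "L \<ge> 0" "Q j s L" using insert.prems[of j] by auto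
  have "Q i (min r s) (max K L)" if "i \<in> insert j B" for i
    using that rK(3) sL(3) mono[of i r K "min r s" "max K L"] mono[of j s L "min r s" "max K L"] by auto
  then show ?case using rK sL by (intro exI[of _ "min r s"] conjI exI[of _ "max K L"]) auto
qed

lemma ck3_taylor:
  fixes f :: "real^'n \<Rightarrow> real"
  assumes U: "open U" "x0 \<in> U" and f: "ck_on 3 f U"
  shows "\<exists>r>0. \<exists>K\<ge>0. cball x0 r \<subseteq> U \<and> taylor_bound f x0 r K \<and> taylor_bound (grad f) x0 r K"
proof -
  have f': "ck_on (Suc 2) f U" using f by (simp add: numeral_3_eq_3 numeral_2_eq_2)
  obtain r1 K1 where 1: "r1 > 0" "K1 \<ge> 0" "cball x0 r1 \<subseteq> U" "taylor_bound f x0 r1 K1"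
    using ck2_Taylor_near[OF U ck_on_Suc_imp[OF f']] unfolding taylor_bound_def by blast
  obtain r2 K2 where 2: "r2 > 0" "K2 \<ge> 0" "cball x0 r2 \<subseteq> U" "taylor_bound (grad f) x0 r2 K2"
    using ck2_Taylor_near[OF U ck_on_grad[OF U(1) f']] unfolding taylor_bound_def by blast
  show ?thesis
  proof (intro exI conjI)
    show "taylor_bound f x0 (min r1 r2) (max K1 K2)" by (rule taylor_bound_mono[OF 1(4)]) auto
    show "taylor_bound (grad f) x0 (min r1 r2) (max K1 K2)" by (rule taylor_bound_mono[OF 2(4)]) auto
    show "cball x0 (min r1 r2) \<subseteq> U" using 1(3) by (rule order_trans[rotated]) auto
  qed (use 1 2 in auto)
qed

lemma ck3_differentiable:
  fixes f :: "real^'n \<Rightarrow> real"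
  assumes U: "open U" "x \<in> U" and f: "ck_on 3 f U"
  shows "f differentiable at x" "(grad f has_derivative hessian_map f x) (at x)"
proof -
  have f': "ck_on (Suc 2) f U" using f by (simp add: numeral_3_eq_3 numeral_2_eq_2)
  show "f differentiable at x" using f'[unfolded ck_on.simps(2)] U(2) by blast
  have "ck_on (Suc 1) (grad f) U" using ck_on_grad[OF U(1) f'] by (simp add: numeral_2_eq_2)
  then have "grad f differentiable at x" using U(2) by simp
  then show "(grad f has_derivative hessian_map f x) (at x)"
    by (simp add: hessian_map_def flip: frechet_derivative_works)
qed

lemma linear_hessian_map:
  assumes "open U" "x \<in> U" "ck_on 3 f U"
  shows "linear (hessian_map f x)"
  using has_derivative_linear[OF ck3_differentiable(2)[OF assms]] .

text \<open>The semidefinite term of the Lagrangian is affine in \<open>x\<close>, so the Hessian does not involve \<open>V\<close>.\<close>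
lemma hess_lagrangian:
  fixes P :: "('n::finite, 'm::finite, 'q::finite) sisdp_data"
  assumes U: "open U" "x \<in> U" and obj: "ck_on 3 (obj P) UNIV"
    and gh: "\<And>i. i \<in> B \<Longrightarrow> ck_on 3 (ghat P i) U"
  shows "hess (lagrangian P B y V) x *v d = lagrangian_hessian P B x y d"
proof -
  have g: "grad (lagrangian P B y V) x' = stationarity P B x' y V" if x': "x' \<in> U" for x'
  proof (rule grad_eqI)
    have F: "((\<lambda>x. mat_inner (Fmap P x) V) has_derivative (\<lambda>h. Fadj P V \<bullet> h)) (at x')"
    proof -
      have "mat_inner (Fmap P x) V = mat_inner (F0 P) V + Fadj P V \<bullet> x" for x
        by (simp add: Fmap_def linear_add[OF linear_mat_inner_left] Fadj_adjoint)
      then show ?thesis by (auto intro!: derivative_eq_intros)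
    qed
    have "(lagrangian P B y V has_derivative (\<lambda>h. grad (obj P) x' \<bullet> h
        + (\<Sum>i\<in>B. y i * (grad (ghat P i) x' \<bullet> h)) - Fadj P V \<bullet> h)) (at x')"
      unfolding lagrangian_def
      by (intro has_derivative_diff has_derivative_add has_derivative_sum has_derivative_mult_right F
        has_derivative_grad ck3_differentiable(1)[OF open_UNIV UNIV_I obj] ck3_differentiable(1)[OF U(1) x' gh])
    then show "(lagrangian P B y V has_derivative (\<lambda>h. stationarity P B x' y V \<bullet> h)) (at x')"
      by (simp add: stationarity_def inner_diff_left inner_add_left inner_sum_left)
  qed
  have "((\<lambda>x. stationarity P B x y V) has_derivative lagrangian_hessian P B x y) (at x)"
    unfolding stationarity_def lagrangian_hessian_def
    using has_derivative_diff[OF has_derivative_add[OF ck3_differentiable(2)[OF open_UNIV UNIV_I obj]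
       has_derivative_sum[of B "\<lambda>i x. y i *\<^sub>R grad (ghat P i) x" "\<lambda>i h. y i *\<^sub>R hessian_map (ghat P i) x h"]] has_derivative_const]
      ck3_differentiable(2)[OF U gh]
    by (simp add: has_derivative_scaleR_right)
  then have D: "(grad (lagrangian P B y V) has_derivative lagrangian_hessian P B x y) (at x)"
    by (rule has_derivative_transform_within_open[OF _ U]) (simp add: g)
  then have "grad (lagrangian P B y V) differentiable at x" by (rule differentiableI)
  then have "(grad (lagrangian P B y V) has_derivative
      (\<lambda>h. jacobian (grad (lagrangian P B y V)) (at x) *v h)) (at x)"
    by (simp only: jacobian_works)
  from fun_cong[OF has_derivative_unique[OF this D]] show ?thesis by (simp add: hess_def)
qed

text \<open>The limit point \<open>(xs, ys, Vs)\<close> with the functions \<open>B\<close> of its local reduction and the active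
  indices \<open>I\<close>.\<close>
locale reduced_system =
  fixes P :: "('n::finite, 'm::{finite,linorder}, 'q::finite) sisdp_data"
    and U :: "(real^'n) set" and B I :: "('n, 'q) branch set"
    and xs :: "real^'n" and ys :: "('n, 'q) branch \<Rightarrow> real" and Vs :: "((real, 'm) vec, 'm) vec"
  assumes sisdp: "sisdp P"
    and U: "open U" "xs \<in> U" and B: "finite B" "I \<subseteq> B"
    and obj3: "ck_on 3 (obj P) UNIV" and ghat3: "\<And>i. i \<in> B \<Longrightarrow> ck_on 3 (ghat P i) U"
    and inactive: "\<And>i. i \<in> B - I \<Longrightarrow> ys i = 0"
    and Vs: "Vs \<in> Sym"
    and nonsing: "Phi0_jacobian_nonsingular P I (xs, ys, Vs)"
begin

lemma finite_I: "finite I"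
  using B finite_subset by blast

abbreviation gr :: "('n, 'q) branch \<Rightarrow> real^'n \<Rightarrow> real^'n" where
  "gr i x \<equiv> grad (ghat P i) x"

lemmas obj_diff = ck3_differentiable[OF open_UNIV UNIV_I obj3]

lemma ghat_diff:
  assumes "i \<in> B" "x \<in> U"
  shows "(ghat P i has_derivative (\<lambda>h. gr i x \<bullet> h)) (at x)"
    "(gr i has_derivative hessian_map (ghat P i) x) (at x)" "linear (hessian_map (ghat P i) x)"
  using ck3_differentiable[OF U(1) assms(2) ghat3[OF assms(1)]]
    linear_hessian_map[OF U(1) assms(2) ghat3[OF assms(1)]]
  by (auto intro: has_derivative_grad)

text \<open>The sum over \<open>I\<close> of the second-order terms is one over \<open>B\<close> because the inactive multipliers
  vanish; so the Hessian of the full Lagrangian appears, as in the Newton system.\<close>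
lemma Phi0_jacobian_eq:
  assumes dy: "\<And>i. i \<notin> I \<Longrightarrow> dy i = 0"
  shows "Phi0_jacobian P I (xs, ys, Vs) (dx, dy, dV) =
    (lagrangian_hessian P B xs ys dx + (\<Sum>i\<in>I. dy i *\<^sub>R gr i xs) - Fadj P dV,
     \<lambda>i. if i \<in> I then gr i xs \<bullet> dx else 0,
     svec (jprod (Fmap P xs) dV + jprod Vs (Flin P dx)))"
proof -
  have line: "((\<lambda>t. xs + t *\<^sub>R dx) has_derivative (\<lambda>t. t *\<^sub>R dx)) (at 0)"
    by (auto intro!: derivative_eq_intros)
  have along: "((\<lambda>t. f (xs + t *\<^sub>R dx)) has_vector_derivative D dx) (at 0)"
    if "(f has_derivative D) (at xs)" for f :: "real^'n \<Rightarrow> 'z::real_normed_vector" and D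
  proof -
    have "((\<lambda>t. f (xs + t *\<^sub>R dx)) has_derivative (\<lambda>t. D (t *\<^sub>R dx))) (at 0)"
      by (rule has_derivative_compose[OF line]) (use that in simp)
    then show ?thesis
      by (simp add: has_vector_derivative_def linear_scale[OF has_derivative_linear[OF that]])
  qed
  have lin_vd: "((\<lambda>t. f (a + t *\<^sub>R d)) has_vector_derivative f d) (at 0)"
    if "linear f" for f :: "'y::euclidean_space \<Rightarrow> 'z::real_normed_vector" and a d
    by (auto simp: linear_add[OF that] linear_scale[OF that] intro!: derivative_eq_intros)
  have IB: "i \<in> B" if "i \<in> I" for i using that B by auto
  have sumI: "(\<Sum>i\<in>I. ys i *\<^sub>R f i) = (\<Sum>i\<in>B. ys i *\<^sub>R f i)" for f :: "_ \<Rightarrow> real^'n"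
    using B inactive by (intro sum.mono_neutral_left) auto
  have 1: "((\<lambda>t. grad (obj P) (xs + t *\<^sub>R dx) + (\<Sum>i\<in>I. (ys i + t * dy i) *\<^sub>R gr i (xs + t *\<^sub>R dx))
        - Fadj P (Vs + t *\<^sub>R dV)) has_vector_derivative
      (hessian_map (obj P) xs dx + (\<Sum>i\<in>I. ys i *\<^sub>R hessian_map (ghat P i) xs dx + dy i *\<^sub>R gr i xs)
        - Fadj P dV)) (at 0)"
  proof (intro has_vector_derivative_diff has_vector_derivative_add has_vector_derivative_sum
      along obj_diff lin_vd linear_Fadj)
    fix i assume "i \<in> I"
    have "((\<lambda>t. ys i + t * dy i) has_field_derivative dy i) (at 0)"
      by (auto intro!: derivative_eq_intros)
    from has_vector_derivative_scaleR[OF this along[OF ghat_diff(2)[OF IB[OF \<open>i \<in> I\<close>] U(2)]]]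
    show "((\<lambda>t. (ys i + t * dy i) *\<^sub>R gr i (xs + t *\<^sub>R dx)) has_vector_derivative
        ys i *\<^sub>R hessian_map (ghat P i) xs dx + dy i *\<^sub>R gr i xs) (at 0)"
      by simp
  qed
  have 2: "((\<lambda>t. if i \<in> I then ghat P i (xs + t *\<^sub>R dx) else 0) has_vector_derivative
      (if i \<in> I then gr i xs \<bullet> dx else 0)) (at 0)" for i
    using along[OF ghat_diff(1)[OF IB U(2)]] by (auto intro!: derivative_eq_intros)
  have lin_svec: "linear (svec :: ((real, 'm) vec, 'm) vec \<Rightarrow> _)"
    by (auto simp: linear_iff svec_def vec_eq_iff algebra_simps)
  have 3: "((\<lambda>t. svec (jprod (Fmap P (xs + t *\<^sub>R dx)) (Vs + t *\<^sub>R dV))) has_vector_derivative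
      svec (jprod (Fmap P xs) dV + jprod Vs (Flin P dx))) (at 0)"
  proof -
    have F: "((\<lambda>t. Fmap P (xs + t *\<^sub>R dx)) has_vector_derivative Flin P dx) (at 0)"
      unfolding Fmap_add linear_scale[OF linear_Flin] by (auto intro!: derivative_eq_intros)
    have V: "((\<lambda>t. Vs + t *\<^sub>R dV) has_vector_derivative dV) (at 0)"
      by (auto intro!: derivative_eq_intros)
    have "jprod Vs (Flin P dx) = jprod (Flin P dx) Vs" by (simp add: jprod_def add.commute)
    then have "((\<lambda>t. jprod (Fmap P (xs + t *\<^sub>R dx)) (Vs + t *\<^sub>R dV)) has_vector_derivative
        (jprod (Fmap P xs) dV + jprod Vs (Flin P dx))) (at 0)"
      using jp.has_vector_derivative[OF F V] by simp
    then show ?thesis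
      by (rule bounded_linear.has_vector_derivative[OF linear_conv_bounded_linear[THEN iffD1, OF lin_svec]])
  qed
  show ?thesis
    using vector_derivative_at[OF 1] vector_derivative_at[OF 2] vector_derivative_at[OF 3]
    by (simp add: Phi0_jacobian_def Phi0_def vstep_def lagrangian_hessian_def sum.distrib sumI
       algebra_simps)
qed

lemma jacobian_kernel:
  assumes 1: "lagrangian_hessian P B xs ys dx + (\<Sum>i\<in>I. dy i *\<^sub>R gr i xs) - Fadj P dV = 0"
    and 2: "\<And>i. i \<in> I \<Longrightarrow> gr i xs \<bullet> dx = 0"
    and 3: "jprod (Fmap P xs) dV + jprod Vs (Flin P dx) = 0" and dV: "dV \<in> Sym"
  shows "dx = 0" "dV = 0" "\<And>i. i \<in> I \<Longrightarrow> dy i = 0"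
proof -
  let ?J = "Phi0_jacobian P I (xs, ys, Vs)"
  let ?X = "UNIV \<times> {u. \<forall>i. i \<notin> I \<longrightarrow> u i = 0} \<times> (Sym :: (((real, 'm) vec, 'm) vec) set)"
  define dy' where "dy' i = (if i \<in> I then dy i else 0)" for i
  have inj: "inj_on ?J ?X" using nonsing by (simp add: Phi0_jacobian_nonsingular_def bij_betw_def)
  have s: "(\<Sum>i\<in>I. dy' i *\<^sub>R gr i xs) = (\<Sum>i\<in>I. dy i *\<^sub>R gr i xs)"
    by (intro sum.cong) (auto simp: dy'_def)
  have h0: "lagrangian_hessian P B xs ys 0 = 0"
    unfolding lagrangian_hessian_def
    using linear_0[OF ghat_diff(3)] linear_0[OF linear_hessian_map[OF open_UNIV UNIV_I obj3]] U(2)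
    by (simp add: sum.neutral)
  have "?J (dx, dy', dV) = (0, \<lambda>i. 0, svec 0)"
    using 1 2 3 by (subst Phi0_jacobian_eq) (auto simp: dy'_def s)
  moreover have "?J (0, \<lambda>i. 0, 0) = (0, \<lambda>i. 0, svec 0)"
    by (subst Phi0_jacobian_eq)
      (auto simp: h0 linear_0[OF linear_Fadj] linear_0[OF linear_Flin] jp.zero_right)
  ultimately have "(dx, dy', dV) = (0, \<lambda>i. 0, 0)"
    using inj_onD[OF inj, of "(dx, dy', dV)" "(0, \<lambda>i. 0, 0)"] dV subspace_0[OF subspace_Sym]
    by (auto simp: dy'_def)
  then show "dx = 0" "dV = 0" "\<And>i. i \<in> I \<Longrightarrow> dy i = 0" by (auto simp: dy'_def fun_eq_iff split: if_splits)
qed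

lemma active_gradients_prescribed:
  assumes "\<And>i. i \<notin> I \<Longrightarrow> c i = 0"
  obtains dx where "\<And>i. i \<in> I \<Longrightarrow> gr i xs \<bullet> dx = c i"
proof -
  let ?J = "Phi0_jacobian P I (xs, ys, Vs)"
  let ?X = "UNIV \<times> {u. \<forall>i. i \<notin> I \<longrightarrow> u i = 0} \<times> (Sym :: (((real, 'm) vec, 'm) vec) set)"
  have im: "?J ` ?X = UNIV \<times> {u. \<forall>i. i \<notin> I \<longrightarrow> u i = 0} \<times> svec ` (Sym :: (((real, 'm) vec, 'm) vec) set)"
    using nonsing by (simp add: Phi0_jacobian_nonsingular_def bij_betw_def)
  have "svec (0 :: ((real, 'm) vec, 'm) vec) \<in> svec ` Sym"
    by (rule imageI) (rule subspace_0[OF subspace_Sym])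
  then have "(0, c, svec (0 :: ((real, 'm) vec, 'm) vec)) \<in> ?J ` ?X"
    using assms unfolding im by simp
  then obtain d where d: "?J d = (0, c, svec (0 :: ((real, 'm) vec, 'm) vec))" "d \<in> ?X"
    by (rule imageE[OF _ that[OF sym]]) 
  obtain dx dy dV where e: "d = (dx, dy, dV)" by (rule prod_cases3)
  have "dy i = 0" if "i \<notin> I" for i using d(2) that by (simp add: e)
  from Phi0_jacobian_eq[where dx = dx and dV = dV, OF this] d(1)
  have "(\<lambda>i. if i \<in> I then gr i xs \<bullet> dx else 0) = c" by (simp add: e)
  from fun_cong[OF this] have "gr i xs \<bullet> dx = c i" if "i \<in> I" for i using that by (metis (full_types))
  then show ?thesis by (rule that)
qed

text \<open>Multipliers are functions on a set of functions and carry no norm. Surjectivity of the Jacobian makes the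
  active gradients linearly independent (test a relation with a direction whose products with the
  gradients are the coefficients of the relation), so there are at most \<open>n\<close> active indices, and multipliers
  can be stored in vectors of \<open>\<real>\<^sup>n\<close>.\<close>
lemma active_embedding: "\<exists>e :: ('n, 'q) branch \<Rightarrow> 'n. inj_on e I"
proof -
  have lin_indep: "c i = 0" if z: "(\<Sum>i\<in>I. c i *\<^sub>R gr i xs) = 0" and i: "i \<in> I" for c i
  proof -
    obtain dx where dx: "\<And>i. i \<in> I \<Longrightarrow> gr i xs \<bullet> dx = (if i \<in> I then c i else 0)"
      using active_gradients_prescribed[of "\<lambda>i. if i \<in> I then c i else 0"] by auto
    have "(\<Sum>i\<in>I. c i *\<^sub>R gr i xs) \<bullet> dx = (\<Sum>i\<in>I. c i * c i)"
      using dx by (simp add: inner_sum_left)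
    then have "(\<Sum>i\<in>I. c i * c i) = 0" using z by simp
    then show ?thesis using i finite_I by (subst (asm) sum_nonneg_eq_0_iff) auto
  qed
  let ?g = "\<lambda>i. gr i xs"
  have inj: "inj_on ?g I"
  proof
    fix i j assume ij: "i \<in> I" "j \<in> I" "?g i = ?g j"
    show "i = j"
    proof (rule ccontr)
      assume n: "i \<noteq> j"
      let ?c = "\<lambda>k. if k = i then 1 else if k = j then - 1 else (0::real)"
      have "(\<Sum>k\<in>I. ?c k *\<^sub>R ?g k) = (\<Sum>k\<in>{i, j}. ?c k *\<^sub>R ?g k)"
        using ij finite_I by (intro sum.mono_neutral_right) auto
      also have "\<dots> = 0" using ij n by simp
      finally show False using lin_indep[of ?c i] ij by simp
    qed
  qed
  have "independent (?g ` I)"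
    unfolding independent_explicit_finite_subsets
  proof (intro allI impI ballI)
    fix A u v assume A: "A \<subseteq> ?g ` I" "finite A" "(\<Sum>v\<in>A. u v *\<^sub>R v) = 0" "v \<in> A"
    define c where "c i = (if ?g i \<in> A then u (?g i) else 0)" for i
    have "(\<Sum>i\<in>I. c i *\<^sub>R ?g i) = (\<Sum>w\<in>?g ` I. (if w \<in> A then u w else 0) *\<^sub>R w)"
      by (simp add: sum.reindex[OF inj] c_def)
    also have "\<dots> = (\<Sum>w\<in>A. u w *\<^sub>R w)"
      using A finite_I by (intro sum.mono_neutral_cong_right) auto
    finally have z: "(\<Sum>i\<in>I. c i *\<^sub>R ?g i) = 0" using A by simp
    obtain i where "i \<in> I" "v = ?g i" using A by auto
    then show "u v = 0" using lin_indep[OF z \<open>i \<in> I\<close>] A by (simp add: c_def)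
  qed
  then have "card (?g ` I) \<le> CARD('n)" using independent_bound[of "?g ` I"] by simp
  then have "card I \<le> card (UNIV :: 'n set)" using card_image[OF inj] by simp
  then show ?thesis using card_le_inj[OF finite_I finite[of "UNIV :: 'n set"]] by blast
qed

end

section \<open>Uniform solvability of the Newton system\<close>

text \<open>On a finite-dimensional space, bijectivity and the lower bound of a linear bijection survive
  perturbations of small norm.\<close>
lemma linear_perturbation:
  fixes M0 :: "'a::euclidean_space \<Rightarrow> 'a"
  assumes "linear M0" "inj M0"
  obtains c where "c > 0"
    "\<And>M. linear M \<Longrightarrow> (\<And>u. norm (M u - M0 u) \<le> c * norm u) \<Longrightarrow> surj M \<and> (\<forall>u. c * norm u \<le> norm (M u))"
proof -
  obtain b where b: "b > 0" "\<And>u. b * norm u \<le> norm (M0 u)"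
    using linear_inj_bounded_below_pos[OF assms] by blast
  show ?thesis
  proof (rule that[of "b / 2"])
    fix M :: "'a \<Rightarrow> 'a" assume M: "linear M" "\<And>u. norm (M u - M0 u) \<le> b / 2 * norm u"
    have low: "b / 2 * norm u \<le> norm (M u)" for u
      using b(2)[of u] M(2)[of u] norm_triangle_ineq2[of "M0 u" "M u"]
      by (simp add: norm_minus_commute)
    have "inj M"
      unfolding linear_injective_0[OF M(1)]
    proof (intro allI impI)
      fix u assume "M u = 0"
      then have "b / 2 * norm u \<le> 0" using low[of u] by simp
      then show "u = 0" using b(1) by (simp add: mult_le_0_iff)
    qed
    then show "surj M \<and> (\<forall>u. b / 2 * norm u \<le> norm (M u))"
      using linear_injective_imp_surjective[OF M(1)] low by blast
  qed (use b in simp)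
qed

definition sym_part :: "real^'m^'m \<Rightarrow> real^'m^'m" where
  "sym_part W = (1/2) *\<^sub>R (W + transpose W)"

definition skew_part :: "real^'m^'m \<Rightarrow> real^'m^'m" where
  "skew_part W = (1/2) *\<^sub>R (W - transpose W)"

lemma sym_part_Sym: "sym_part W \<in> Sym"
  by (simp add: sym_part_def Sym_def transpose_linear add.commute)

lemma linear_sym_part: "linear (sym_part :: real^'m^'m \<Rightarrow> _)"
  by (simp add: linear_iff sym_part_def transpose_linear algebra_simps)

lemma linear_skew_part: "linear (skew_part :: real^'m^'m \<Rightarrow> _)"
  by (simp add: linear_iff skew_part_def transpose_linear algebra_simps)

lemma sym_part_eq: "W \<in> Sym \<Longrightarrow> sym_part W = W" and skew_part_eq: "W \<in> Sym \<Longrightarrow> skew_part W = 0"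
  by (simp_all add: sym_part_def skew_part_def Sym_transpose scaleR_2[symmetric])

lemma norm_sym_part: "norm (sym_part W) \<le> norm W"
  using norm_triangle_ineq[of W "transpose W"] by (simp add: sym_part_def norm_transpose)

lemma Sym_if_skew_part_balanced:
  fixes S W :: "real^'m^'m"
  assumes "S \<in> Sym" "S + skew_part W \<in> Sym"
  shows "W \<in> Sym"
proof -
  have "skew_part W = (S + skew_part W) - S" by simp
  then have "skew_part W \<in> Sym" using subspace_diff[OF subspace_Sym assms(2,1)] by simp
  then have "transpose (skew_part W) = skew_part W" by (rule Sym_transpose)
  moreover have "transpose (skew_part W) = - skew_part W"
    by (simp add: skew_part_def transpose_linear flip: scaleR_minus_right)
  ultimately have "2 *\<^sub>R skew_part W = 0" by (simp add: scaleR_2)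
  then show ?thesis by (simp add: skew_part_def Sym_def)
qed

text \<open>The Newton operator on the Euclidean space \<open>\<real>\<^sup>n \<times> \<real>\<^sup>n \<times> \<real>\<^sup>m\<^sup>\<times>\<^sup>m\<close>. The genuine unknowns occupy the
  coordinates \<open>e ` I\<close> of the second factor and the symmetric matrices in the third; on the remaining coordinates
  and on the skew part the operator is the identity, which makes it an endomorphism.\<close>
definition reduced_operator :: "('n::finite, 'm::finite, 'q::finite) sisdp_data \<Rightarrow> (('n, 'q) branch \<Rightarrow> 'n) \<Rightarrow>
    ('n, 'q) branch set \<Rightarrow> (real^'n \<Rightarrow> real^'n) \<Rightarrow> (('n, 'q) branch \<Rightarrow> real^'n) \<Rightarrow> real^'m^'m \<Rightarrow>
    (real^'n \<Rightarrow> real^'m^'m) \<Rightarrow> (real^'n) \<times> (real^'n) \<times> (real^'m^'m) \<Rightarrow> (real^'n) \<times> (real^'n) \<times> (real^'m^'m)" where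
  "reduced_operator P e I H G A K = (\<lambda>(a, b, W).
     (H a + (\<Sum>i\<in>I. (b $ e i) *\<^sub>R G i) - Fadj P W,
      (\<chi> j. if j \<in> e ` I then G (inv_into I e j) \<bullet> a else b $ j),
      jprod A (sym_part W) + K a + skew_part W))"

lemma linear_reduced_operator:
  assumes "linear H" "linear K"
  shows "linear (reduced_operator P e I H G A K)"
proof -
  have "linear (\<lambda>u :: (real^'a) \<times> (real^'a) \<times> (real^'b^'b). 
      (H (fst u) + (\<Sum>i\<in>I. (fst (snd u) $ e i) *\<^sub>R G i) - Fadj P (snd (snd u)),
      (\<chi> j. if j \<in> e ` I then G (inv_into I e j) \<bullet> fst u else fst (snd u) $ j),
      jprod A (sym_part (snd (snd u))) + K (fst u) + skew_part (snd (snd u))))"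
    by (auto simp: linear_iff linear_add[OF assms(1)] linear_add[OF assms(2)] linear_scale[OF assms(1)]
      linear_scale[OF assms(2)] linear_add[OF linear_Fadj] linear_scale[OF linear_Fadj]
      linear_add[OF linear_sym_part] linear_scale[OF linear_sym_part] jp.add_right jp.scaleR_right
      linear_add[OF linear_skew_part] linear_scale[OF linear_skew_part] sum.distrib scaleR_add_left
      scaleR_add_right scaleR_diff_right scaleR_sum_right inner_add_right vec_eq_iff)
  then show ?thesis by (simp add: reduced_operator_def case_prod_unfold)
qed

lemma norm_triple_le: "norm (a, b, c) \<le> norm a + norm b + norm c"
  using norm_Pair_le[of a "(b, c)"] norm_Pair_le[of b c] by simp

lemma norm_triple_ge:
  "norm a \<le> norm (a, b, c)" "norm b \<le> norm (a, b, c)" "norm c \<le> norm (a, b, c)"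
proof -
  show "norm a \<le> norm (a, b, c)" by (rule norm_fst_le)
  show "norm b \<le> norm (a, b, c)" by (rule order_trans[OF norm_fst_le norm_snd_le])
  show "norm c \<le> norm (a, b, c)" by (rule order_trans[OF norm_snd_le norm_snd_le])
qed

text \<open>The factor counts three \<open>d\<close> from \<open>H\<close>, \<open>A\<close>, \<open>K\<close> and, for each active index, one \<open>d\<close> from the sum of
  multipliers and one from the linearized constraint.\<close>
lemma reduced_operator_diff:
  fixes P :: "('n::finite, 'm::finite, 'q::finite) sisdp_data"
  assumes I: "finite I" and d: "d \<ge> 0"
    and H: "\<And>a. norm (H1 a - H0 a) \<le> d * norm a" and G: "\<And>i. i \<in> I \<Longrightarrow> norm (G1 i - G0 i) \<le> d"
    and A: "norm (A1 - A0) \<le> d" and K: "\<And>a. norm (K1 a - K0 a) \<le> d * norm a"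
  shows "norm (reduced_operator P e I H1 G1 A1 K1 u - reduced_operator P e I H0 G0 A0 K0 u)
    \<le> (3 + 2 * real (card I)) * d * norm u"
proof -
  obtain a b W where u: "u = (a, b, W)" by (cases u)
  note nu = norm_triple_ge[where a = a and b = b and c = W, folded u]
  have 1: "norm ((H1 a - H0 a) + (\<Sum>i\<in>I. (b $ e i) *\<^sub>R (G1 i - G0 i))) \<le> d * norm u + real (card I) * (d * norm u)"
  proof (intro norm_triangle_le add_mono)
    show "norm (H1 a - H0 a) \<le> d * norm u"
      using H[of a] mult_left_mono[OF nu(1) d] by linarith
    have "norm (\<Sum>i\<in>I. (b $ e i) *\<^sub>R (G1 i - G0 i)) \<le> (\<Sum>i\<in>I. d * norm u)"
    proof (rule sum_norm_le)
      fix i assume i: "i \<in> I"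
      have "\<bar>b $ e i\<bar> \<le> norm u" using component_le_norm_cart[of b "e i"] nu(2) by simp
      then have "\<bar>b $ e i\<bar> * norm (G1 i - G0 i) \<le> norm u * d" using G[OF i] by (intro mult_mono) auto
      then show "norm ((b $ e i) *\<^sub>R (G1 i - G0 i)) \<le> d * norm u" by (simp add: mult.commute)
    qed
    then show "norm (\<Sum>i\<in>I. (b $ e i) *\<^sub>R (G1 i - G0 i)) \<le> real (card I) * (d * norm u)" by simp
  qed
  let ?c = "\<chi> j. if j \<in> e ` I then (G1 (inv_into I e j) - G0 (inv_into I e j)) \<bullet> a else 0"
  have 2: "norm ?c \<le> real (card I) * (d * norm u)"
  proof -
    have "norm ?c \<le> (\<Sum>j\<in>UNIV. \<bar>?c $ j\<bar>)" by (rule norm_le_l1_cart)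
    also have "\<dots> = (\<Sum>j\<in>e ` I. \<bar>(G1 (inv_into I e j) - G0 (inv_into I e j)) \<bullet> a\<bar>)"
      by (intro sum.mono_neutral_cong_right) auto
    also have "\<dots> \<le> (\<Sum>j\<in>e ` I. d * norm u)"
    proof (rule sum_mono)
      fix j assume "j \<in> e ` I"
      then have i: "inv_into I e j \<in> I" by (rule inv_into_into)
      have "\<bar>(G1 (inv_into I e j) - G0 (inv_into I e j)) \<bullet> a\<bar> \<le> norm (G1 (inv_into I e j) - G0 (inv_into I e j)) * norm a"
        by (rule Cauchy_Schwarz_ineq2)
      also have "\<dots> \<le> d * norm u" using G[OF i] nu(1) d by (intro mult_mono) auto
      finally show "\<bar>(G1 (inv_into I e j) - G0 (inv_into I e j)) \<bullet> a\<bar> \<le> d * norm u" .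
    qed
    also have "\<dots> \<le> real (card I) * (d * norm u)"
      using card_image_le[OF I, of e] d by (simp add: mult_right_mono)
    finally show ?thesis .
  qed
  have 3: "norm (jprod (A1 - A0) (sym_part W) + (K1 a - K0 a)) \<le> d * norm u + d * norm u"
  proof (intro norm_triangle_le add_mono)
    have "norm (jprod (A1 - A0) (sym_part W)) \<le> norm (A1 - A0) * norm (sym_part W)" by (rule norm_jprod)
    also have "\<dots> \<le> d * norm u" using A d norm_sym_part[of W] nu(3) by (intro mult_mono) auto
    finally show "norm (jprod (A1 - A0) (sym_part W)) \<le> d * norm u" .
    show "norm (K1 a - K0 a) \<le> d * norm u" using K[of a] mult_left_mono[OF nu(1) d] by linarith
  qed
  have "reduced_operator P e I H1 G1 A1 K1 u - reduced_operator P e I H0 G0 A0 K0 u =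
     ((H1 a - H0 a) + (\<Sum>i\<in>I. (b $ e i) *\<^sub>R (G1 i - G0 i)), ?c, jprod (A1 - A0) (sym_part W) + (K1 a - K0 a))"
    by (simp add: reduced_operator_def u scaleR_diff_right sum_subtractf jp.diff_left inner_diff_left
        vec_eq_iff algebra_simps)
  also have "norm \<dots> \<le> d * norm u + real (card I) * (d * norm u) + real (card I) * (d * norm u) + (d * norm u + d * norm u)"
    using norm_triple_le[of "(H1 a - H0 a) + (\<Sum>i\<in>I. (b $ e i) *\<^sub>R (G1 i - G0 i))" ?c
      "jprod (A1 - A0) (sym_part W) + (K1 a - K0 a)"] 1 2 3 by linarith
  also have "\<dots> = (3 + 2 * real (card I)) * d * norm u" by (simp add: algebra_simps)
  finally show ?thesis .
qed

text \<open>The operator applied to \<open>\<Delta>x\<close> in equation (b), split into its unscaled part and half of the scaling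
  defect.\<close>

definition scaled_map :: "('n::finite, 'm::finite, 'q::finite) sisdp_data \<Rightarrow> real^'n \<Rightarrow> real^'m^'m \<Rightarrow> real^'n \<Rightarrow> real^'m^'m" where
  "scaled_map P x V a = jprod V (Flin P a) + (1/2) *\<^sub>R scaling_defect (Fmap P x) V (Flin P a)"

lemma scaling_defect_Sym: "A \<in> Pd \<Longrightarrow> V \<in> Sym \<Longrightarrow> Z \<in> Sym \<Longrightarrow> scaling_defect A V Z \<in> Sym"
  by (simp add: scaling_defect_def subspace_diff[OF subspace_Sym] jprod_Sym jinv_Sym Pd_Sym)

lemma scaled_map_Sym:
  assumes "sisdp P" "Fmap P x \<in> Pd" "V \<in> Sym"
  shows "scaled_map P x V a \<in> Sym"
  unfolding scaled_map_def
  by (intro subspace_add[OF subspace_Sym] subspace_scale[OF subspace_Sym] jprod_Sym scaling_defect_Sym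
      assms Flin_Sym)

lemma linear_scaled_map:
  assumes "sisdp P" "Fmap P x \<in> Pd"
  shows "linear (scaled_map P x V)"
  using jinv_linear[OF assms(2) Flin_Sym[OF assms(1)] Flin_Sym[OF assms(1)]]
  by (simp add: linear_iff scaled_map_def scaling_defect_def linear_add[OF linear_Flin]
      linear_scale[OF linear_Flin] jp.add_right jp.scaleR_right algebra_simps)

definition dsize :: "('n, 'q) branch set \<Rightarrow> ('n::finite, 'm::finite, 'q::finite) vtriple \<Rightarrow> real" where
  "dsize B = (\<lambda>(dx, dy, dV). norm dx + (\<Sum>i\<in>B. \<bar>dy i\<bar>) + norm dV)"

context reduced_system
begin

text \<open>Points close to the limit and, relative to \<open>k\<close>, close to \<open>F(x) \<circ> V = k I\<close>. The relative
  closeness is what controls the scaling defect.\<close>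
definition near :: "real \<Rightarrow> real \<Rightarrow> real^'n \<Rightarrow> (('n, 'q) branch \<Rightarrow> real) \<Rightarrow> ((real, 'm) vec, 'm) vec \<Rightarrow> bool" where
  "near r k x y V \<longleftrightarrow> x \<in> cball xs r \<and> (\<forall>i\<in>B. \<bar>y i - ys i\<bar> \<le> r) \<and> norm (V - Vs) \<le> r \<and> V \<in> Sym \<and>
     Fmap P x \<in> Pd \<and> 0 < k \<and> norm (jprod (Fmap P x) V - k *\<^sub>R mat 1) \<le> r * k"

definition residual :: "real \<Rightarrow> real^'n \<Rightarrow> (('n, 'q) branch \<Rightarrow> real) \<Rightarrow> ((real, 'm) vec, 'm) vec \<Rightarrow> real" where
  "residual m x y V = norm (stationarity P B x y V) + (\<Sum>i\<in>I. \<bar>ghat P i x\<bar>) + (\<Sum>i\<in>B - I. \<bar>y i\<bar>)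
     + norm (jprod (Fmap P x) V - m *\<^sub>R mat 1)"

lemma sum_split_active: "(\<Sum>i\<in>B. f i) = (\<Sum>i\<in>I. f i) + (\<Sum>i\<in>B - I. f i)" for f :: "_ \<Rightarrow> 'a::ab_group_add"
  using sum.subset_diff[OF B(2,1), of f] by (simp add: add.commute)

lemma corrector_sys_iff:
  assumes x: "x \<in> U"
  shows "corrector_sys P B I m (x, y, V) (dx, dy, dV) \<longleftrightarrow> dV \<in> Sym \<and> (\<forall>i\<in>B - I. dy i = - y i) \<and>
    lagrangian_hessian P B x y dx + (\<Sum>i\<in>I. dy i *\<^sub>R gr i x) - Fadj P dV
      = - stationarity P B x y V + (\<Sum>i\<in>B - I. y i *\<^sub>R gr i x) \<and>
    (\<forall>i\<in>I. gr i x \<bullet> dx = - ghat P i x) \<and>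
    jprod (Fmap P x) dV + scaled_map P x V dx = m *\<^sub>R mat 1 - jprod (Fmap P x) V"
proof -
  have b: "eq_b P m (x, y, V) (dx, dy, dV) \<longleftrightarrow>
      jprod (Fmap P x) dV + scaled_map P x V dx = m *\<^sub>R mat 1 - jprod (Fmap P x) V"
  proof -
    have "(1/2) *\<^sub>R (jprod V (Flin P dx) + jprod (Fmap P x) (jprod V (jinv (Fmap P x) (Flin P dx))))
        = scaled_map P x V dx"
      by (simp add: scaled_map_def scaling_defect_def scaleR_add_right scaleR_diff_right
          flip: scaleR_add_left)
    then show ?thesis by (auto simp: eq_b_def jp.add_right algebra_simps)
  qed
  have a: "eq_a P B (x, y, V) (dx, dy, dV) \<longleftrightarrow>
      lagrangian_hessian P B x y dx + (\<Sum>i\<in>I. dy i *\<^sub>R gr i x) - Fadj P dV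
      = - stationarity P B x y V + (\<Sum>i\<in>B - I. y i *\<^sub>R gr i x)"
    if "\<forall>i\<in>B - I. dy i = - y i"
  proof -
    have "(\<Sum>i\<in>B. (y i + dy i) *\<^sub>R gr i x) = (\<Sum>i\<in>I. (y i + dy i) *\<^sub>R gr i x)"
      using that B by (intro sum.mono_neutral_right) auto
    also have "\<dots> = (\<Sum>i\<in>B. y i *\<^sub>R gr i x) - (\<Sum>i\<in>B - I. y i *\<^sub>R gr i x) + (\<Sum>i\<in>I. dy i *\<^sub>R gr i x)"
      by (simp add: scaleR_add_left sum.distrib sum_split_active)
    finally have S: "(\<Sum>i\<in>B. (y i + dy i) *\<^sub>R gr i x) = \<dots>" .
    have H: "hess (lagrangian P B y V) x *v dx = lagrangian_hessian P B x y dx"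
      by (rule hess_lagrangian[OF U(1) x obj3 ghat3])
    have E: "grad (obj P) x + hess (lagrangian P B y V) x *v dx + (\<Sum>i\<in>B. (y i + dy i) *\<^sub>R gr i x) - Fadj P (V + dV)
      = (lagrangian_hessian P B x y dx + (\<Sum>i\<in>I. dy i *\<^sub>R gr i x) - Fadj P dV)
        - (- stationarity P B x y V + (\<Sum>i\<in>B - I. y i *\<^sub>R gr i x))"
      unfolding S H linear_add[OF linear_Fadj] stationarity_def
      by (simp add: algebra_simps)
    show ?thesis unfolding eq_a_def prod.case E by (rule right_minus_eq)
  qed
  have c: "(\<forall>i\<in>B - I. y i + dy i = 0) \<longleftrightarrow> (\<forall>i\<in>B - I. dy i = - y i)"
    by (auto simp: add_eq_0_iff)
  show ?thesis
    using a by (auto simp: corrector_sys_def b c lin_ghat_def add_eq_0_iff)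
qed

lemma common_taylor_radius:
  "\<exists>r>0. \<exists>K\<ge>0. cball xs r \<subseteq> U \<and> taylor_bound (grad (obj P)) xs r K \<and>
     (\<forall>i\<in>B. taylor_bound (ghat P i) xs r K \<and> taylor_bound (\<lambda>x. gr i x) xs r K)"
proof -
  obtain r0 K0 where 0: "r0 > 0" "K0 \<ge> 0" "taylor_bound (grad (obj P)) xs r0 K0"
    using ck3_taylor[OF open_UNIV UNIV_I obj3, of xs] by blast
  obtain r1 where 1: "r1 > 0" "cball xs r1 \<subseteq> U" using U open_contains_cball by metis
  let ?Q = "\<lambda>i r K. taylor_bound (ghat P i) xs r K \<and> taylor_bound (grad (ghat P i)) xs r K"
  have "\<exists>r>0. \<exists>K\<ge>0. \<forall>i\<in>B. ?Q i r K"
  proof (rule finite_common_radius[OF B(1)])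
    fix i assume "i \<in> B"
    show "\<exists>r>0. \<exists>K\<ge>0. ?Q i r K" using ck3_taylor[OF U ghat3[OF \<open>i \<in> B\<close>]] by blast
  next
    fix i r K r' K' assume "?Q i r K" "r' \<le> r" "K \<le> (K' :: real)"
    then show "?Q i r' K'"
      using taylor_bound_mono[of "ghat P i" xs r K r' K'] taylor_bound_mono[of "grad (ghat P i)" xs r K r' K'] by simp
  qed
  then obtain r2 K2 where 2: "r2 > 0" "K2 \<ge> 0" "\<And>i. i \<in> B \<Longrightarrow> ?Q i r2 K2" by blast
  define r where "r = min r0 (min r1 r2)"
  define K where "K = max K0 K2"
  have rK: "r \<le> r0" "r \<le> r1" "r \<le> r2" "K0 \<le> K" "K2 \<le> K" by (auto simp: r_def K_def)
  show ?thesis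
  proof (intro exI conjI ballI)
    show "r > 0" using 0 1 2 by (simp add: r_def)
    show "K \<ge> 0" using 0 by (simp add: K_def)
    show "cball xs r \<subseteq> U" by (rule order_trans[OF subset_cball[OF rK(2)] 1(2)])
    show "taylor_bound (grad (obj P)) xs r K" by (rule taylor_bound_mono[OF 0(3) rK(1,4)])
    show "taylor_bound (ghat P i) xs r K" if "i \<in> B" for i
      by (rule taylor_bound_mono[OF conjunct1[OF 2(3)[OF that]] rK(3,5)])
    show "taylor_bound (\<lambda>x. gr i x) xs r K" if "i \<in> B" for i
      by (rule taylor_bound_mono[OF conjunct2[OF 2(3)[OF that]] rK(3,5)])
  qed
qed

text \<open>All coefficients of the Newton operator converge to those at the limit: the smooth ones by continuity,
  the scaled matrix part because its defect is bounded by a multiple of \<open>r\<close> near the limit.\<close>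
lemma near_coefficients:
  assumes d: "d > 0"
  shows "\<exists>r>0. r \<le> 1/2 \<and> cball xs r \<subseteq> U \<and> (\<forall>k x y V. near r k x y V \<longrightarrow>
    (\<forall>a. norm (lagrangian_hessian P B x y a - lagrangian_hessian P B xs ys a) \<le> d * norm a) \<and>
    (\<forall>i\<in>B. norm (gr i x - gr i xs) \<le> d) \<and> norm (Fmap P x - Fmap P xs) \<le> d \<and>
    (\<forall>a. norm (scaled_map P x V a - jprod Vs (Flin P a)) \<le> d * norm a))"
proof -
  obtain r0 K where T: "r0 > 0" "K \<ge> 0" "cball xs r0 \<subseteq> U" "taylor_bound (grad (obj P)) xs r0 K"
    "\<And>i. i \<in> B \<Longrightarrow> taylor_bound (\<lambda>x. gr i x) xs r0 K"
    using common_taylor_radius by blast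
  obtain CF where CF: "CF > 0" "\<And>h. norm (Flin P h) \<le> CF * norm h"
    using linear_bound_pos[OF linear_Flin] by blast
  have "\<forall>i\<in>B. \<exists>M>0. \<forall>a. norm (hessian_map (ghat P i) xs a) \<le> M * norm a"
    using linear_bound_pos[OF ghat_diff(3)[OF _ U(2)]] by metis
  then obtain M where M: "\<And>i. i \<in> B \<Longrightarrow> M i > 0"
    "\<And>i a. i \<in> B \<Longrightarrow> norm (hessian_map (ghat P i) xs a) \<le> M i * norm a" by metis
  define C1 where "C1 = K + (\<Sum>i\<in>B. (\<bar>ys i\<bar> + 1) * K + M i)"
  define C4 where "C4 = CF + (norm Vs + 1) * CF"
  define C where "C = C1 + K + CF + C4 + 1"
  have nn: "C1 \<ge> 0" "C4 \<ge> 0"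
  proof -
    have "0 \<le> (\<bar>ys i\<bar> + 1) * K + M i" if "i \<in> B" for i
      using T(2) M(1)[OF that] by (intro add_nonneg_nonneg mult_nonneg_nonneg) auto
    then have "0 \<le> (\<Sum>i\<in>B. (\<bar>ys i\<bar> + 1) * K + M i)" by (rule sum_nonneg)
    then show "C1 \<ge> 0" unfolding C1_def using T(2) by simp
    show "C4 \<ge> 0" unfolding C4_def using CF(1) by (intro add_nonneg_nonneg mult_nonneg_nonneg) auto
  qed
  have C: "C > 0" "C1 \<le> C" "K \<le> C" "CF \<le> C" "C4 \<le> C" using nn T(2) CF(1) by (auto simp: C_def)
  define r where "r = min (min r0 (1/2)) (d / C)"
  have r: "r > 0" "r \<le> r0" "r \<le> 1/2"
  proof -
    show "r > 0" using T(1) C d by (simp add: r_def)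
    show "r \<le> r0" "r \<le> 1/2" unfolding r_def by linarith+
  qed
  have "r \<le> d / C" by (simp add: r_def)
  then have rC: "C * r \<le> d" using C(1) by (simp add: field_simps)
  have le: "c * r \<le> d" if "c \<le> C" for c using rC mult_right_mono[OF that, of r] r by linarith
  have "(\<forall>a. norm (lagrangian_hessian P B x y a - lagrangian_hessian P B xs ys a) \<le> d * norm a) \<and>
    (\<forall>i\<in>B. norm (gr i x - gr i xs) \<le> d) \<and> norm (Fmap P x - Fmap P xs) \<le> d \<and>
    (\<forall>a. norm (scaled_map P x V a - jprod Vs (Flin P a)) \<le> d * norm a)" if nr: "near r k x y V" for k x y V
  proof -
    have xr: "norm (x - xs) \<le> r" using nr by (simp add: near_def dist_norm norm_minus_commute)
    have in0: "xs \<in> cball xs r0" "x \<in> cball xs r0" using T(1) xr r by (auto simp: dist_norm norm_minus_commute)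
    have hl: "norm (frechet_derivative f (at x) v - frechet_derivative f (at xs) v) \<le> K * r * norm v"
      and fl: "norm (f x - f xs) \<le> K * r"
      if "taylor_bound f xs r0 K" for f :: "real^'n \<Rightarrow> real^'n" and v
    proof -
      note t = that[unfolded taylor_bound_def, rule_format, OF in0]
      have "K * norm (x - xs) \<le> K * r" using xr T(2) by (rule mult_left_mono)
      then show "norm (f x - f xs) \<le> K * r"
        "norm (frechet_derivative f (at x) v - frechet_derivative f (at xs) v) \<le> K * r * norm v"
        using t mult_right_mono[of "K * norm (x - xs)" "K * r" "norm v"] by (auto intro: order_trans)
    qed
    have 1: "norm (lagrangian_hessian P B x y a - lagrangian_hessian P B xs ys a) \<le> d * norm a" for a
    proof -
      have "lagrangian_hessian P B x y a - lagrangian_hessian P B xs ys a =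
        (hessian_map (obj P) x a - hessian_map (obj P) xs a) +
        (\<Sum>i\<in>B. y i *\<^sub>R (hessian_map (ghat P i) x a - hessian_map (ghat P i) xs a) + (y i - ys i) *\<^sub>R hessian_map (ghat P i) xs a)"
        by (simp add: lagrangian_hessian_def scaleR_diff_right scaleR_diff_left sum.distrib sum_subtractf)
      also have "norm \<dots> \<le> K * r * norm a + (\<Sum>i\<in>B. (((\<bar>ys i\<bar> + 1) * K + M i) * r) * norm a)"
      proof (rule norm_triangle_le, rule add_mono, goal_cases)
        case 1
        show "norm (hessian_map (obj P) x a - hessian_map (obj P) xs a) \<le> K * r * norm a"
          unfolding hessian_map_def by (rule hl[OF T(4)])
      next
        case 2
        show ?case
        proof (rule sum_norm_le)
        fix i assume i: "i \<in> B"
        have yi: "\<bar>y i - ys i\<bar> \<le> r" using nr i by (simp add: near_def)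
        then have yi': "\<bar>y i\<bar> \<le> \<bar>ys i\<bar> + 1" using r by linarith
        have "norm (y i *\<^sub>R (hessian_map (ghat P i) x a - hessian_map (ghat P i) xs a)) \<le> (\<bar>ys i\<bar> + 1) * (K * r * norm a)"
          unfolding norm_scaleR hessian_map_def using hl[OF T(5)[OF i]] yi' by (intro mult_mono) auto
        moreover have "norm ((y i - ys i) *\<^sub>R hessian_map (ghat P i) xs a) \<le> r * (M i * norm a)"
          unfolding norm_scaleR using M(2)[OF i] yi r by (intro mult_mono) auto
        moreover have "(\<bar>ys i\<bar> + 1) * (K * r * norm a) + r * (M i * norm a) = (((\<bar>ys i\<bar> + 1) * K + M i) * r) * norm a"
          by (simp add: algebra_simps)
        ultimately show "norm (y i *\<^sub>R (hessian_map (ghat P i) x a - hessian_map (ghat P i) xs a) +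
            (y i - ys i) *\<^sub>R hessian_map (ghat P i) xs a) \<le> (((\<bar>ys i\<bar> + 1) * K + M i) * r) * norm a"
          by (intro norm_triangle_le) linarith
        qed
      qed
      also have "\<dots> = (C1 * r) * norm a"
        by (simp only: C1_def sum_distrib_right distrib_right)
      also have "\<dots> \<le> d * norm a" using le[OF C(2)] by (rule mult_right_mono) simp
      finally show ?thesis .
    qed
    have 2: "norm (gr i x - gr i xs) \<le> d" if "i \<in> B" for i
      using fl[OF T(5)[OF that]] le[OF C(3)] by linarith
    have 3: "norm (Fmap P x - Fmap P xs) \<le> d"
      unfolding Fmap_diff using CF(2)[of "x - xs"] mult_left_mono[OF xr, of CF] CF(1) le[OF C(4)] by linarith
    have 4: "norm (scaled_map P x V a - jprod Vs (Flin P a)) \<le> d * norm a" for a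
    proof -
      have V: "V \<in> Sym" "norm (V - Vs) \<le> r" and A: "Fmap P x \<in> Pd" and k: "k > 0"
        and E: "norm (jprod (Fmap P x) V - k *\<^sub>R mat 1) \<le> r * k" using nr by (auto simp: near_def)
      have nV: "norm V \<le> norm Vs + 1" using norm_triangle_sub[of V Vs] V(2) r by linarith
      have Ek: "norm (jprod (Fmap P x) V - k *\<^sub>R mat 1) / k \<le> r" using E k by (simp add: pos_divide_le_eq)
      have "norm (jprod (Fmap P x) V - k *\<^sub>R mat 1) \<le> k / 2"
        using E mult_right_mono[OF r(3), of k] k by linarith
      from scaling_defect_bound[OF A V(1) Flin_Sym[OF sisdp] k this, of a]
      have "norm (scaling_defect (Fmap P x) V (Flin P a)) \<le> 2 * norm V * (norm (jprod (Fmap P x) V - k *\<^sub>R mat 1) / k) * norm (Flin P a)" .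
      also have "\<dots> \<le> 2 * (norm Vs + 1) * r * (CF * norm a)"
        using nV Ek CF r k by (intro mult_mono) auto
      finally have "norm (scaling_defect (Fmap P x) V (Flin P a)) \<le> 2 * ((norm Vs + 1) * r * (CF * norm a))"
        by (simp only: mult.assoc)
      then have s: "norm ((1/2) *\<^sub>R scaling_defect (Fmap P x) V (Flin P a)) \<le> (norm Vs + 1) * r * (CF * norm a)"
        unfolding norm_scaleR by simp
      have j: "norm (jprod (V - Vs) (Flin P a)) \<le> r * (CF * norm a)"
        by (rule order_trans[OF norm_jprod]) (use V(2) CF r in \<open>auto intro!: mult_mono\<close>)
      have "scaled_map P x V a - jprod Vs (Flin P a) = jprod (V - Vs) (Flin P a) + (1/2) *\<^sub>R scaling_defect (Fmap P x) V (Flin P a)"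
        by (simp add: scaled_map_def jp.diff_left)
      also have "norm \<dots> \<le> r * (CF * norm a) + (norm Vs + 1) * r * (CF * norm a)"
        by (intro norm_triangle_le add_mono s j)
      also have "\<dots> = C4 * r * norm a" by (simp add: C4_def algebra_simps)
      also have "\<dots> \<le> d * norm a" using le[OF C(5)] by (rule mult_right_mono) simp
      finally show ?thesis .
    qed
    show ?thesis using 1 2 3 4 by blast
  qed
  moreover have "cball xs r \<subseteq> U" by (rule order_trans[OF subset_cball[OF r(2)] T(3)])
  ultimately show ?thesis using r by blast
qed

end

context reduced_system
begin

lemma linear_lagrangian_hessian:
  assumes "x \<in> U"
  shows "linear (lagrangian_hessian P B x y)"
  unfolding lagrangian_hessian_def
  by (intro linear_compose_add linear_compose_sum linear_hessian_map[OF open_UNIV UNIV_I obj3] ballI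
      linear_compose_scale_right ghat_diff(3) assms)

lemma linear_limit_scaled_map: "linear (\<lambda>a. jprod Vs (Flin P a))"
  by (simp add: linear_iff linear_add[OF linear_Flin] linear_scale[OF linear_Flin] jp.add_right jp.scaleR_right)

text \<open>An element of the kernel has a symmetric third component, because the other terms of the third
  equation are symmetric; the rest is the kernel of the Jacobian.\<close>
lemma inj_reduced_operator:
  fixes e :: "('n, 'q) branch \<Rightarrow> 'n"
  assumes e: "inj_on e I"
  shows "inj (reduced_operator P e I (lagrangian_hessian P B xs ys) (\<lambda>i. gr i xs) (Fmap P xs)
     (\<lambda>a. jprod Vs (Flin P a)))" (is "inj ?M")
proof -
  have lin: "linear ?M"
    by (rule linear_reduced_operator[OF linear_lagrangian_hessian[OF U(2)] linear_limit_scaled_map])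
  show ?thesis unfolding linear_injective_0[OF lin]
  proof (intro allI impI)
    fix u assume z: "?M u = 0"
    obtain a b W where u: "u = (a, b, W)" by (rule prod_cases3)
    have 1: "lagrangian_hessian P B xs ys a + (\<Sum>i\<in>I. (b $ e i) *\<^sub>R gr i xs) - Fadj P W = 0"
      and 2: "\<And>j. (if j \<in> e ` I then gr (inv_into I e j) xs \<bullet> a else b $ j) = 0"
      and 3: "jprod (Fmap P xs) (sym_part W) + jprod Vs (Flin P a) + skew_part W = 0"
      using z by (auto simp: u reduced_operator_def zero_prod_def vec_eq_iff)
    have W: "W \<in> Sym"
      by (rule Sym_if_skew_part_balanced[of "jprod (Fmap P xs) (sym_part W) + jprod Vs (Flin P a)"])
        (simp_all add: 3 subspace_0[OF subspace_Sym] subspace_add[OF subspace_Sym] jprod_Sym sym_part_Sym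
          Fmap_Sym[OF sisdp] Flin_Sym[OF sisdp] Vs)
    have g: "gr i xs \<bullet> a = 0" if "i \<in> I" for i
      using 2[of "e i"] that e by simp
    have h3: "jprod (Fmap P xs) W + jprod Vs (Flin P a) = 0"
      using 3 by (simp add: sym_part_eq[OF W] skew_part_eq[OF W])
    note ker = jacobian_kernel[of a "\<lambda>i. b $ e i" W, OF 1 g h3 W]
    have "b $ j = 0" for j
      using 2[of j] ker(3) e by (cases "j \<in> e ` I") auto
    then show "u = 0" using ker(1,2) by (simp add: u vec_eq_iff zero_prod_def)
  qed
qed

text \<open>The operator at a near point is a small perturbation of the bijective one at the limit. The inactive
  multipliers are determined by \<open>y + \<Delta>y = 0\<close> and are moved to the right-hand side.\<close>
lemma newton_solvable:
  obtains r C where "r > 0" "C \<ge> 0"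
    "\<And>k x y V m. near r k x y V \<Longrightarrow> \<exists>d. corrector_sys P B I m (x, y, V) d"
    "\<And>k x y V m d. near r k x y V \<Longrightarrow> corrector_sys P B I m (x, y, V) d \<Longrightarrow>
       dsize B d \<le> C * residual m x y V"
proof -
  obtain e :: "('n, 'q) branch \<Rightarrow> 'n" where e: "inj_on e I" using active_embedding by blast
  obtain c where c: "c > 0"
    "\<And>M. linear M \<Longrightarrow> (\<And>u. norm (M u - reduced_operator P e I (lagrangian_hessian P B xs ys) (\<lambda>i. gr i xs) (Fmap P xs)
     (\<lambda>a. jprod Vs (Flin P a)) u) \<le> c * norm u) \<Longrightarrow> surj M \<and> (\<forall>u. c * norm u \<le> norm (M u))"
    using linear_perturbation[OF linear_reduced_operator[OF linear_lagrangian_hessian[OF U(2)] linear_limit_scaled_map]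
      inj_reduced_operator[OF e]] by metis
  define d0 where "d0 = c / (3 + 2 * real (card I))"
  have d0: "d0 > 0" using c(1) by (simp add: d0_def)
  have d0c: "(3 + 2 * real (card I)) * d0 = c" by (simp add: d0_def)
  obtain r where r: "r > 0" "cball xs r \<subseteq> U" and nr:
    "\<And>k x y V a. near r k x y V \<Longrightarrow> norm (lagrangian_hessian P B x y a - lagrangian_hessian P B xs ys a) \<le> d0 * norm a"
    "\<And>k x y V i. near r k x y V \<Longrightarrow> i \<in> B \<Longrightarrow> norm (gr i x - gr i xs) \<le> d0"
    "\<And>k x y V. near r k x y V \<Longrightarrow> norm (Fmap P x - Fmap P xs) \<le> d0"
    "\<And>k x y V a. near r k x y V \<Longrightarrow> norm (scaled_map P x V a - jprod Vs (Flin P a)) \<le> d0 * norm a"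
    using near_coefficients[OF d0] by metis
  define G where "G = (\<Sum>i\<in>B. norm (gr i xs)) + d0"
  have G0: "G \<ge> 0" using d0 by (simp add: G_def sum_nonneg add_nonneg_nonneg)
  define C where "C = (2 + real (card I)) * ((1 + G) / c) + 1"
  have C0: "C \<ge> 0" using c(1) G0 by (simp add: C_def)
  have main: "(\<exists>d. corrector_sys P B I m (x, y, V) d) \<and>
     (\<forall>d. corrector_sys P B I m (x, y, V) d \<longrightarrow> dsize B d \<le> C * residual m x y V)" if n: "near r k x y V" for k x y V m
  proof -
    have xU: "x \<in> U" and V: "V \<in> Sym" and A: "Fmap P x \<in> Pd" using n r(2) by (auto simp: near_def)
    define M where "M = reduced_operator P e I (lagrangian_hessian P B x y) (\<lambda>i. gr i x) (Fmap P x) (scaled_map P x V)"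
    have linM: "linear M" unfolding M_def
      by (rule linear_reduced_operator[OF linear_lagrangian_hessian[OF xU] linear_scaled_map[OF sisdp A]])
    have IB: "i \<in> B" if "i \<in> I" for i using that B by blast
    have "norm (M u - reduced_operator P e I (lagrangian_hessian P B xs ys) (\<lambda>i. gr i xs) (Fmap P xs)
     (\<lambda>a. jprod Vs (Flin P a)) u) \<le> c * norm u" for u
      unfolding M_def d0c[symmetric]
      using nr(1)[OF n] nr(2)[OF n IB] nr(3)[OF n] nr(4)[OF n] d0
      by (intro reduced_operator_diff finite_I) auto
    from c(2)[OF linM this] have surj: "surj M" and low: "\<And>u. c * norm u \<le> norm (M u)" by blast+
    define R where "R = (- stationarity P B x y V + (\<Sum>i\<in>B - I. y i *\<^sub>R gr i x),
      (\<chi> j. if j \<in> e ` I then - ghat P (inv_into I e j) x else 0) :: (real, 'n) vec,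
      m *\<^sub>R mat 1 - jprod (Fmap P x) V)"
    have Gx: "norm (gr i x) \<le> G" if "i \<in> B" for i
    proof -
      have "norm (gr i xs) \<le> (\<Sum>i\<in>B. norm (gr i xs))" using B that by (intro member_le_sum) auto
      then show ?thesis using nr(2)[OF n that] norm_triangle_sub[of "gr i x" "gr i xs"] by (simp add: G_def)
    qed
    define rho where "rho = residual m x y V"
    have yI: "(\<Sum>i\<in>B - I. \<bar>y i\<bar>) \<le> rho"
      unfolding rho_def residual_def by (simp add: sum_nonneg)
    have R: "norm R \<le> (1 + G) * rho"
    proof -
      have "norm (\<Sum>i\<in>B - I. y i *\<^sub>R gr i x) \<le> (\<Sum>i\<in>B - I. G * \<bar>y i\<bar>)"
      proof (rule sum_norm_le)
        fix i assume "i \<in> B - I"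
        then have "\<bar>y i\<bar> * norm (gr i x) \<le> \<bar>y i\<bar> * G" using Gx by (intro mult_left_mono) auto
        then show "norm (y i *\<^sub>R gr i x) \<le> G * \<bar>y i\<bar>" by (simp add: mult.commute)
      qed
      also have "\<dots> \<le> G * rho" using yI G0 by (simp flip: sum_distrib_left add: mult_left_mono)
      finally have 1: "norm (- stationarity P B x y V + (\<Sum>i\<in>B - I. y i *\<^sub>R gr i x)) \<le> norm (stationarity P B x y V) + G * rho"
        using norm_triangle_ineq[of "- stationarity P B x y V" "\<Sum>i\<in>B - I. y i *\<^sub>R gr i x"] by simp
      have 2: "norm ((\<chi> j. if j \<in> e ` I then - ghat P (inv_into I e j) x else 0) :: (real, 'n) vec) \<le> (\<Sum>i\<in>I. \<bar>ghat P i x\<bar>)"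
      proof -
        have "norm ((\<chi> j. if j \<in> e ` I then - ghat P (inv_into I e j) x else 0) :: (real, 'n) vec)
           \<le> (\<Sum>j\<in>UNIV. \<bar>if j \<in> e ` I then - ghat P (inv_into I e j) x else 0\<bar>)"
          by (rule order_trans[OF norm_le_l1_cart]) simp
        also have "\<dots> = (\<Sum>j\<in>e ` I. \<bar>ghat P (inv_into I e j) x\<bar>)"
          by (intro sum.mono_neutral_cong_right) auto
        also have "\<dots> = (\<Sum>i\<in>I. \<bar>ghat P i x\<bar>)" using e by (simp add: sum.reindex)
        finally show ?thesis .
      qed
      have "norm R \<le> norm (stationarity P B x y V) + G * rho + (\<Sum>i\<in>I. \<bar>ghat P i x\<bar>) + norm (jprod (Fmap P x) V - m *\<^sub>R mat 1)"
        unfolding R_def using norm_triple_le 1 2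
        by (intro order_trans[OF norm_triple_le] add_mono) (simp_all add: norm_minus_commute)
      also have "\<dots> \<le> (1 + G) * rho"
        by (simp add: rho_def residual_def algebra_simps sum_nonneg)
      finally show ?thesis .
    qed
    have ex: "\<exists>d. corrector_sys P B I m (x, y, V) d"
    proof -
      obtain u where "R = M u" using surjD[OF surj] by blast
      moreover obtain a b W where u: "u = (a, b, W)" by (rule prod_cases3)
      ultimately have
        1: "lagrangian_hessian P B x y a + (\<Sum>i\<in>I. (b $ e i) *\<^sub>R gr i x) - Fadj P W
           = - stationarity P B x y V + (\<Sum>i\<in>B - I. y i *\<^sub>R gr i x)" and
        2: "\<And>j. (if j \<in> e ` I then gr (inv_into I e j) x \<bullet> a else b $ j)
              = (if j \<in> e ` I then - ghat P (inv_into I e j) x else 0)" and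
        3: "jprod (Fmap P x) (sym_part W) + scaled_map P x V a + skew_part W = m *\<^sub>R mat 1 - jprod (Fmap P x) V"
        by (auto simp: R_def M_def reduced_operator_def vec_eq_iff)
      have W: "W \<in> Sym"
        by (rule Sym_if_skew_part_balanced[of "jprod (Fmap P x) (sym_part W) + scaled_map P x V a"])
          (simp_all add: 3 subspace_add[OF subspace_Sym] subspace_diff[OF subspace_Sym] subspace_scale[OF subspace_Sym]
            jprod_Sym sym_part_Sym Fmap_Sym[OF sisdp] scaled_map_Sym[OF sisdp A V] V Pd_Sym[OF mat_1_Pd])
      have "corrector_sys P B I m (x, y, V) (a, \<lambda>i. if i \<in> I then b $ e i else - y i, W)"
        unfolding corrector_sys_iff[OF xU]
      proof (intro conjI ballI W)
        show "lagrangian_hessian P B x y a + (\<Sum>i\<in>I. (if i \<in> I then b $ e i else - y i) *\<^sub>R gr i x) - Fadj P W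
           = - stationarity P B x y V + (\<Sum>i\<in>B - I. y i *\<^sub>R gr i x)"
          using 1 by (simp cong: sum.cong)
        show "gr i x \<bullet> a = - ghat P i x" if "i \<in> I" for i using 2[of "e i"] that e by simp
        show "jprod (Fmap P x) W + scaled_map P x V a = m *\<^sub>R mat 1 - jprod (Fmap P x) V"
          using 3 by (simp add: sym_part_eq[OF W] skew_part_eq[OF W])
      qed auto
      then show ?thesis by blast
    qed
    have "dsize B d \<le> C * rho" if d: "corrector_sys P B I m (x, y, V) d" for d
    proof -
      obtain dx dy dV where dd: "d = (dx, dy, dV)" by (rule prod_cases3)
      note cs = d[unfolded dd corrector_sys_iff[OF xU]]
      have dV: "dV \<in> Sym" using cs by blast
      define b :: "(real, 'n) vec" where "b = (\<chi> j. if j \<in> e ` I then dy (inv_into I e j) else 0)"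
      have be: "b $ e i = dy i" if "i \<in> I" for i using that e by (simp add: b_def)
      have "M (dx, b, dV) = R"
      proof -
        have "(\<Sum>i\<in>I. (b $ e i) *\<^sub>R gr i x) = (\<Sum>i\<in>I. dy i *\<^sub>R gr i x)"
          by (intro sum.cong refl) (simp add: be)
        moreover have "(\<chi> j. if j \<in> e ` I then gr (inv_into I e j) x \<bullet> dx else b $ j)
            = (\<chi> j. if j \<in> e ` I then - ghat P (inv_into I e j) x else 0)"
          using cs by (auto simp: vec_eq_iff b_def inv_into_into)
        ultimately show ?thesis
          using cs by (simp add: M_def R_def reduced_operator_def sym_part_eq[OF dV] skew_part_eq[OF dV])
      qed
      then have "c * norm (dx, b, dV) \<le> (1 + G) * rho" using low[of "(dx, b, dV)"] R by simp
      then have nu: "norm (dx, b, dV) \<le> (1 + G) / c * rho" using c(1) by (simp add: field_simps)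
      have "(\<Sum>i\<in>I. \<bar>dy i\<bar>) \<le> (\<Sum>i\<in>I. norm (dx, b, dV))"
      proof (rule sum_mono)
        fix i assume "i \<in> I"
        then have "\<bar>dy i\<bar> \<le> norm b" using component_le_norm_cart[of b "e i"] be by simp
        also have "\<dots> \<le> norm (dx, b, dV)" by (rule norm_triple_ge)
        finally show "\<bar>dy i\<bar> \<le> norm (dx, b, dV)" .
      qed
      then have 1: "(\<Sum>i\<in>I. \<bar>dy i\<bar>) \<le> real (card I) * norm (dx, b, dV)" by simp
      have 2: "(\<Sum>i\<in>B - I. \<bar>dy i\<bar>) \<le> rho" using cs yI by simp
      have "dsize B d \<le> (2 + real (card I)) * norm (dx, b, dV) + rho"
        using 1 2 norm_triple_ge(1)[of dx b dV] norm_triple_ge(3)[of dV dx b]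
        by (simp add: dsize_def dd sum_split_active[of "\<lambda>i. \<bar>dy i\<bar>"] algebra_simps)
      also have "\<dots> \<le> (2 + real (card I)) * ((1 + G) / c * rho) + rho"
        using nu by (intro add_mono mult_left_mono) auto
      also have "\<dots> = C * rho" by (simp only: C_def distrib_right mult.assoc mult_1)
      finally show ?thesis .
    qed
    then show ?thesis using ex by (simp add: rho_def)
  qed
  show ?thesis
  proof (rule that[OF r(1) C0])
    fix k x y V m assume n: "near r k x y V"
    show "\<exists>d. corrector_sys P B I m (x, y, V) d" by (rule conjunct1[OF main[OF n]])
    fix d assume "corrector_sys P B I m (x, y, V) d"
    then show "dsize B d \<le> C * residual m x y V" using main[OF n, of m] by blast
  qed
qed

text \<open>Subtracting the Newton equations leaves Taylor remainders, products of two components of the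
  direction, and in the matrix equation also half of the scaling defect. The last estimate
  covers the whole segment, as positive definiteness has to be followed along it.\<close>
lemma newton_step_residual:
  obtains r C where "r > 0" "C \<ge> 0"
    "\<And>k x y V m dx dy dV. near r k x y V \<Longrightarrow> x + dx \<in> cball xs r \<Longrightarrow>
       corrector_sys P B I m (x, y, V) (dx, dy, dV) \<Longrightarrow>
       norm (stationarity P B (x + dx) (\<lambda>i. y i + dy i) (V + dV)) \<le> C * (dsize B (dx, dy, dV))\<^sup>2"
    "\<And>k x y V m dx dy dV i. near r k x y V \<Longrightarrow> x + dx \<in> cball xs r \<Longrightarrow>
       corrector_sys P B I m (x, y, V) (dx, dy, dV) \<Longrightarrow> i \<in> I \<Longrightarrow>
       \<bar>ghat P i (x + dx)\<bar> \<le> C * (dsize B (dx, dy, dV))\<^sup>2"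
    "\<And>k x y V m dx dy dV t. near r k x y V \<Longrightarrow> x + dx \<in> cball xs r \<Longrightarrow>
       corrector_sys P B I m (x, y, V) (dx, dy, dV) \<Longrightarrow> 0 \<le> t \<Longrightarrow> t \<le> 1 \<Longrightarrow>
       norm (jprod (Fmap P (x + t *\<^sub>R dx)) (V + t *\<^sub>R dV)
         - ((1 - t) *\<^sub>R jprod (Fmap P x) V + (t * m) *\<^sub>R mat 1))
       \<le> C * ((dsize B (dx, dy, dV))\<^sup>2
            + norm (jprod (Fmap P x) V - k *\<^sub>R mat 1) / k * dsize B (dx, dy, dV))"
proof -
  obtain r0 K where T: "r0 > 0" "K \<ge> 0" "cball xs r0 \<subseteq> U" "taylor_bound (grad (obj P)) xs r0 K"
    "\<And>i. i \<in> B \<Longrightarrow> taylor_bound (\<lambda>x. gr i x) xs r0 K" "\<And>i. i \<in> B \<Longrightarrow> taylor_bound (ghat P i) xs r0 K"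
    using common_taylor_radius by blast
  obtain CF where CF: "CF > 0" "\<And>h. norm (Flin P h) \<le> CF * norm h"
    using linear_bound_pos[OF linear_Flin] by blast
  define r where "r = min r0 (1/2)"
  have r: "r > 0" "r \<le> r0" "r \<le> 1/2" using T(1) by (auto simp: r_def)
  define Y where "Y = (\<Sum>i\<in>B. \<bar>ys i\<bar> + 1)"
  define C where "C = K * (2 + Y) + (norm Vs + 1) * CF + CF"
  have Y0: "Y \<ge> 0" by (simp add: Y_def sum_nonneg)
  have CK: "K * (2 + Y) \<le> C" "K \<le> C" "(norm Vs + 1) * CF \<le> C" "CF \<le> C" "C \<ge> 0"
  proof -
    have "0 \<le> K * (1 + Y)" "0 \<le> (norm Vs + 1) * CF" using T(2) Y0 CF(1) by simp_all
    moreover have "K * (2 + Y) = K + K * (1 + Y)" by (simp add: algebra_simps)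
    ultimately show "K * (2 + Y) \<le> C" "K \<le> C" "(norm Vs + 1) * CF \<le> C" "CF \<le> C" "C \<ge> 0"
      using CF(1) T(2) by (auto simp: C_def)
  qed
  have main: "norm (stationarity P B (x + dx) (\<lambda>i. y i + dy i) (V + dV)) \<le> C * (dsize B (dx, dy, dV))\<^sup>2 \<and>
     (\<forall>i\<in>I. \<bar>ghat P i (x + dx)\<bar> \<le> C * (dsize B (dx, dy, dV))\<^sup>2) \<and>
     (\<forall>t. 0 \<le> t \<longrightarrow> t \<le> 1 \<longrightarrow> norm (jprod (Fmap P (x + t *\<^sub>R dx)) (V + t *\<^sub>R dV)
         - ((1 - t) *\<^sub>R jprod (Fmap P x) V + (t * m) *\<^sub>R mat 1))
       \<le> C * ((dsize B (dx, dy, dV))\<^sup>2 + norm (jprod (Fmap P x) V - k *\<^sub>R mat 1) / k * dsize B (dx, dy, dV)))"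
    if n: "near r k x y V" and x': "x + dx \<in> cball xs r" and cs: "corrector_sys P B I m (x, y, V) (dx, dy, dV)"
    for k x y V m dx dy dV
  proof -
    have xin: "x \<in> cball xs r0" "x + dx \<in> cball xs r0" using n x' r(2) by (auto simp: near_def)
    have xU: "x \<in> U" using xin T(3) by blast
    have V: "V \<in> Sym" "norm (V - Vs) \<le> r" and A: "Fmap P x \<in> Pd" and k: "k > 0"
      and E: "norm (jprod (Fmap P x) V - k *\<^sub>R mat 1) \<le> r * k" using n by (auto simp: near_def)
    note cs' = cs[unfolded corrector_sys_iff[OF xU]]
    define s where "s = dsize B (dx, dy, dV)"
    have dy0: "0 \<le> (\<Sum>i\<in>B. \<bar>dy i\<bar>)" by (simp add: sum_nonneg)
    have s: "norm dx \<le> s" "(\<Sum>i\<in>B. \<bar>dy i\<bar>) \<le> s" "norm dV \<le> s" "0 \<le> s"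
      using dy0 by (simp_all add: s_def dsize_def)
    have dx2: "(norm dx)\<^sup>2 \<le> s\<^sup>2" using s(1) by (rule power_mono) simp
    have tay: "norm (f (x + dx) - f x - frechet_derivative f (at x) dx) \<le> K * s\<^sup>2"
      "norm (f (x + dx) - f x) \<le> K * norm dx" if "taylor_bound f xs r0 K" for f :: "real^'n \<Rightarrow> 'z::real_normed_vector"
    proof -
      note t = that[unfolded taylor_bound_def, rule_format, OF xin, simplified]
      show "norm (f (x + dx) - f x - frechet_derivative f (at x) dx) \<le> K * s\<^sup>2"
        using t mult_left_mono[OF dx2 T(2)] by linarith
      show "norm (f (x + dx) - f x) \<le> K * norm dx" using t by blast
    qed
    have st: "norm (stationarity P B (x + dx) (\<lambda>i. y i + dy i) (V + dV)) \<le> C * s\<^sup>2"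
    proof -
      let ?Tf = "grad (obj P) (x + dx) - grad (obj P) x - hessian_map (obj P) x dx"
      let ?T = "\<lambda>i. gr i (x + dx) - gr i x - hessian_map (ghat P i) x dx"
      let ?L = "\<lambda>i. gr i (x + dx) - gr i x"
      have "(\<Sum>i\<in>B - I. dy i *\<^sub>R gr i x) = - (\<Sum>i\<in>B - I. y i *\<^sub>R gr i x)"
        using cs' by (simp flip: sum_negf)
      then have "stationarity P B x y V + (lagrangian_hessian P B x y dx + (\<Sum>i\<in>B. dy i *\<^sub>R gr i x) - Fadj P dV) = 0"
        using cs' by (simp add: sum_split_active[of "\<lambda>i. dy i *\<^sub>R gr i x"] algebra_simps)
      then have "stationarity P B (x + dx) (\<lambda>i. y i + dy i) (V + dV) = stationarity P B (x + dx) (\<lambda>i. y i + dy i) (V + dV)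
         - (stationarity P B x y V + (lagrangian_hessian P B x y dx + (\<Sum>i\<in>B. dy i *\<^sub>R gr i x) - Fadj P dV))" by simp
      also have "\<dots> = ?Tf + (\<Sum>i\<in>B. y i *\<^sub>R ?T i) + (\<Sum>i\<in>B. dy i *\<^sub>R ?L i)"
        by (simp add: stationarity_def lagrangian_hessian_def linear_add[OF linear_Fadj] scaleR_add_left
            scaleR_diff_right sum.distrib sum_subtractf)
      finally have eq: "stationarity P B (x + dx) (\<lambda>i. y i + dy i) (V + dV) = \<dots>" .
      have 1: "norm ?Tf \<le> K * s\<^sup>2" unfolding hessian_map_def by (rule tay(1)[OF T(4)])
      have 2: "norm (\<Sum>i\<in>B. y i *\<^sub>R ?T i) \<le> (\<Sum>i\<in>B. (\<bar>ys i\<bar> + 1) * (K * s\<^sup>2))"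
      proof (rule sum_norm_le)
        fix i assume i: "i \<in> B"
        have "\<bar>y i - ys i\<bar> \<le> r" using n i by (simp add: near_def)
        then have "\<bar>y i\<bar> \<le> \<bar>ys i\<bar> + 1" using r by linarith
        then show "norm (y i *\<^sub>R ?T i) \<le> (\<bar>ys i\<bar> + 1) * (K * s\<^sup>2)"
          unfolding norm_scaleR hessian_map_def using tay(1)[OF T(5)[OF i]] by (intro mult_mono) auto
      qed
      have 3: "norm (\<Sum>i\<in>B. dy i *\<^sub>R ?L i) \<le> (\<Sum>i\<in>B. \<bar>dy i\<bar> * (K * norm dx))"
        using tay(2)[OF T(5)] by (intro sum_norm_le) (simp add: mult_left_mono)
      also have "\<dots> = (\<Sum>i\<in>B. \<bar>dy i\<bar>) * (K * norm dx)" by (simp only: sum_distrib_right)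
      also have "\<dots> \<le> s * (K * s)" 
        by (rule mult_mono[OF s(2) mult_left_mono[OF s(1) T(2)] s(4)]) (use T(2) in simp)
      finally have 3: "norm (\<Sum>i\<in>B. dy i *\<^sub>R ?L i) \<le> K * s\<^sup>2" by (simp add: power2_eq_square algebra_simps)
      have "norm (stationarity P B (x + dx) (\<lambda>i. y i + dy i) (V + dV)) \<le> K * s\<^sup>2 + Y * (K * s\<^sup>2) + K * s\<^sup>2"
        unfolding eq using 1 2 3 by (intro norm_triangle_le add_mono) (simp_all add: Y_def sum_distrib_right)
      also have "\<dots> = K * (2 + Y) * s\<^sup>2" by (simp add: algebra_simps)
      also have "\<dots> \<le> C * s\<^sup>2" using CK(1) by (rule mult_right_mono) simp
      finally show ?thesis .
    qed
    have gh: "\<bar>ghat P i (x + dx)\<bar> \<le> C * s\<^sup>2" if i: "i \<in> I" for i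
    proof -
      have iB: "i \<in> B" using i B by blast
      have "frechet_derivative (ghat P i) (at x) dx = gr i x \<bullet> dx"
        by (rule grad_inner[symmetric, OF differentiableI[OF ghat_diff(1)[OF iB xU]]])
      then have "\<bar>ghat P i (x + dx)\<bar> \<le> K * s\<^sup>2" using tay(1)[OF T(6)[OF iB]] cs' i by simp
      also have "\<dots> \<le> C * s\<^sup>2" using CK(2) by (rule mult_right_mono) simp
      finally show ?thesis .
    qed
    have cp: "norm (jprod (Fmap P (x + t *\<^sub>R dx)) (V + t *\<^sub>R dV) - ((1 - t) *\<^sub>R jprod (Fmap P x) V + (t * m) *\<^sub>R mat 1))
       \<le> C * (s\<^sup>2 + norm (jprod (Fmap P x) V - k *\<^sub>R mat 1) / k * s)" if t: "0 \<le> t" "t \<le> 1" for t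
    proof -
      let ?Z = "Flin P dx" and ?e = "norm (jprod (Fmap P x) V - k *\<^sub>R mat 1) / k"
      let ?D = "scaling_defect (Fmap P x) V ?Z"
      have FZ: "norm ?Z \<le> CF * s" using CF(2)[of dx] mult_left_mono[OF s(1), of CF] CF(1) by linarith
      have comm: "jprod ?Z V = jprod V ?Z" by (simp add: jprod_def add.commute)
      have "jprod (Fmap P x) dV + jprod V ?Z + jprod (Fmap P x) V - m *\<^sub>R mat 1 = - ((1/2) *\<^sub>R ?D)"
      proof -
        have "jprod (Fmap P x) dV + (jprod V ?Z + (1/2) *\<^sub>R ?D) = m *\<^sub>R mat 1 - jprod (Fmap P x) V"
          using cs' unfolding scaled_map_def by blast
        then show ?thesis by (simp add: algebra_simps)
      qed
      then have "t *\<^sub>R (jprod (Fmap P x) dV + jprod V ?Z + jprod (Fmap P x) V - m *\<^sub>R mat 1) + t\<^sup>2 *\<^sub>R jprod ?Z dV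
          = - (t / 2) *\<^sub>R ?D + t\<^sup>2 *\<^sub>R jprod ?Z dV" by simp
      moreover have "jprod (Fmap P (x + t *\<^sub>R dx)) (V + t *\<^sub>R dV) - ((1 - t) *\<^sub>R jprod (Fmap P x) V + (t * m) *\<^sub>R mat 1)
        = t *\<^sub>R (jprod (Fmap P x) dV + jprod V ?Z + jprod (Fmap P x) V - m *\<^sub>R mat 1) + t\<^sup>2 *\<^sub>R jprod ?Z dV"
        by (simp add: Fmap_add linear_scale[OF linear_Flin] jp.add_left jp.add_right jp.scaleR_left jp.scaleR_right
          comm power2_eq_square algebra_simps)
      ultimately have "norm (jprod (Fmap P (x + t *\<^sub>R dx)) (V + t *\<^sub>R dV) - ((1 - t) *\<^sub>R jprod (Fmap P x) V + (t * m) *\<^sub>R mat 1))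
         \<le> norm (- (t / 2) *\<^sub>R ?D) + norm (t\<^sup>2 *\<^sub>R jprod ?Z dV)"
        by (simp only: norm_triangle_ineq)
      also have "\<dots> \<le> (norm Vs + 1) * CF * (?e * s) + CF * s\<^sup>2"
      proof (rule add_mono)
        have nV: "norm V \<le> norm Vs + 1" using norm_triangle_sub[of V Vs] V(2) r by linarith
        have "norm (jprod (Fmap P x) V - k *\<^sub>R mat 1) \<le> k / 2"
          using E mult_right_mono[OF r(3), of k] k by linarith
        from scaling_defect_bound[OF A V(1) Flin_Sym[OF sisdp] k this, of dx]
        have "norm ?D \<le> 2 * norm V * ?e * norm ?Z" .
        also have "\<dots> \<le> 2 * (norm Vs + 1) * ?e * (CF * s)"
          using nV FZ CF(1) k s(4) by (intro mult_mono) auto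
        finally have D: "norm ?D \<le> 2 * ((norm Vs + 1) * CF * (?e * s))" by (simp add: algebra_simps)
        have "norm (- (t / 2) *\<^sub>R ?D) = t / 2 * norm ?D" using t by simp
        also have "\<dots> \<le> 1 / 2 * norm ?D" using t by (intro mult_right_mono) auto
        also have "\<dots> \<le> (norm Vs + 1) * CF * (?e * s)" using D by linarith
        finally show "norm (- (t / 2) *\<^sub>R ?D) \<le> (norm Vs + 1) * CF * (?e * s)" .
        have t2: "t\<^sup>2 \<le> 1" using t by (simp add: power_le_one)
        have "norm (t\<^sup>2 *\<^sub>R jprod ?Z dV) \<le> 1 * norm (jprod ?Z dV)"
          unfolding norm_scaleR using t2 by (intro mult_right_mono) auto
        also have "\<dots> \<le> norm ?Z * norm dV" using norm_jprod[of ?Z dV] by simp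
        also have "\<dots> \<le> (CF * s) * s"
          using FZ s(3,4) CF(1) by (intro mult_mono) auto
        finally show "norm (t\<^sup>2 *\<^sub>R jprod ?Z dV) \<le> CF * s\<^sup>2" by (simp add: power2_eq_square algebra_simps)
      qed
      also have "\<dots> \<le> C * (?e * s) + C * s\<^sup>2"
        using CK(3,4) s(4) k by (intro add_mono mult_right_mono) auto
      finally show ?thesis by (simp add: algebra_simps)
    qed
    show ?thesis using st gh cp unfolding s_def by blast
  qed
  show ?thesis
  proof (rule that[OF r(1) CK(5)])
    fix k x y V m dx dy dV
    assume *: "near r k x y V" "x + dx \<in> cball xs r" "corrector_sys P B I m (x, y, V) (dx, dy, dV)"
    show "norm (stationarity P B (x + dx) (\<lambda>i. y i + dy i) (V + dV)) \<le> C * (dsize B (dx, dy, dV))\<^sup>2"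
      by (rule conjunct1[OF main[OF *]])
    show "\<bar>ghat P i (x + dx)\<bar> \<le> C * (dsize B (dx, dy, dV))\<^sup>2" if "i \<in> I" for i
      by (rule bspec[OF conjunct1[OF conjunct2[OF main[OF *]]] that])
    show "norm (jprod (Fmap P (x + t *\<^sub>R dx)) (V + t *\<^sub>R dV)
         - ((1 - t) *\<^sub>R jprod (Fmap P x) V + (t * m) *\<^sub>R mat 1))
       \<le> C * ((dsize B (dx, dy, dV))\<^sup>2
            + norm (jprod (Fmap P x) V - k *\<^sub>R mat 1) / k * dsize B (dx, dy, dV))"
      if "0 \<le> t" "t \<le> 1" for t
      by (rule conjunct2[OF conjunct2[OF main[OF *]], rule_format, OF that])
  qed
qed

end

text \<open>Along the segment \<open>F \<circ> V\<close> is within \<open>\<rho> + \<eta>\<close> of \<open>((1 - t) k + t m) I\<close>, and the coefficient is at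
  least \<open>m\<close>.\<close>
lemma newton_step_Pd:
  fixes P :: "('n::finite, 'm::finite, 'q::finite) sisdp_data"
  assumes P: "sisdp P" and A: "Fmap P x \<in> Pd" "V \<in> Pd" and dV: "dV \<in> Sym"
    and E: "norm (jprod (Fmap P x) V - k *\<^sub>R mat 1) \<le> \<rho>"
    and seg: "\<And>t. 0 \<le> t \<Longrightarrow> t \<le> 1 \<Longrightarrow> norm (jprod (Fmap P (x + t *\<^sub>R dx)) (V + t *\<^sub>R dV)
         - ((1 - t) *\<^sub>R jprod (Fmap P x) V + (t * m) *\<^sub>R mat 1)) \<le> \<eta>"
    and small: "\<rho> + \<eta> < m" "m \<le> k"
  shows "Fmap P (x + dx) \<in> Pd" "V + dV \<in> Pd" "step_size P \<delta> (x, y, V) (dx, dy, dV) = 1"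
proof -
  let ?F = "Fmap P x" and ?Z = "Flin P dx"
  have pos: "0 < v \<bullet> (jprod (?F + t *\<^sub>R ?Z) (V + t *\<^sub>R dV) *v v)" if t: "0 \<le> t" "t \<le> 1" and v: "v \<noteq> 0" for t v
  proof -
    let ?E = "jprod ?F V - k *\<^sub>R mat 1"
    let ?R = "jprod (?F + t *\<^sub>R ?Z) (V + t *\<^sub>R dV) - ((1 - t) *\<^sub>R jprod ?F V + (t * m) *\<^sub>R mat 1)"
    have R: "norm ?R \<le> \<eta>" using seg[OF t] by (simp add: Fmap_add linear_scale[OF linear_Flin])
    have vv: "v \<bullet> v > 0" using v by simp
    have r0: "\<rho> \<ge> 0" using E norm_ge_zero order_trans by blast
    have "jprod (?F + t *\<^sub>R ?Z) (V + t *\<^sub>R dV) = ?R + (1 - t) *\<^sub>R ?E + ((1 - t) * k + t * m) *\<^sub>R mat 1"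
      by (simp add: algebra_simps)
    from arg_cong[OF this, of "\<lambda>M. v \<bullet> (M *v v)"]
    have "v \<bullet> (jprod (?F + t *\<^sub>R ?Z) (V + t *\<^sub>R dV) *v v)
        = v \<bullet> ((?R + (1 - t) *\<^sub>R ?E + ((1 - t) * k + t * m) *\<^sub>R mat 1) *v v)" .
    also have "\<dots> = v \<bullet> (?R *v v) + (1 - t) * (v \<bullet> (?E *v v)) + ((1 - t) * k + t * m) * (v \<bullet> v)"
      by (simp only: matrix_vector_mult_add_rdistrib inner_add_right scaleR_matrix_vector_assoc[symmetric]
          inner_scaleR_right matrix_vector_mul_lid)
    finally have "v \<bullet> (jprod (?F + t *\<^sub>R ?Z) (V + t *\<^sub>R dV) *v v)
        = v \<bullet> (?R *v v) + (1 - t) * (v \<bullet> (?E *v v)) + ((1 - t) * k + t * m) * (v \<bullet> v)" .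
    moreover have "- (\<eta> * (v \<bullet> v)) \<le> v \<bullet> (?R *v v)"
      using quadratic_form_le_norm[of v ?R] mult_right_mono[OF R, of "v \<bullet> v"] vv by linarith
    moreover have "- (\<rho> * (v \<bullet> v)) \<le> (1 - t) * (v \<bullet> (?E *v v))"
    proof -
      have "\<bar>(1 - t) * (v \<bullet> (?E *v v))\<bar> = (1 - t) * \<bar>v \<bullet> (?E *v v)\<bar>" using t by (simp add: abs_mult)
      also have "\<dots> \<le> 1 * \<bar>v \<bullet> (?E *v v)\<bar>" using t by (intro mult_right_mono) auto
      also have "\<dots> \<le> \<rho> * (v \<bullet> v)"
        using quadratic_form_le_norm[of v ?E] mult_right_mono[OF E, of "v \<bullet> v"] vv by linarith
      finally show ?thesis by linarith
    qed
    moreover have "m * (v \<bullet> v) \<le> ((1 - t) * k + t * m) * (v \<bullet> v)"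
    proof (rule mult_right_mono)
      have "(1 - t) * m \<le> (1 - t) * k" using t small by (intro mult_left_mono) auto
      then show "m \<le> (1 - t) * k + t * m" by (simp add: algebra_simps)
    qed (use vv in simp)
    moreover have "(\<rho> + \<eta>) * (v \<bullet> v) < m * (v \<bullet> v)" using small vv by simp
    ultimately show ?thesis by (simp add: distrib_right)
  qed
  have Z: "?Z \<in> Sym" by (rule Flin_Sym[OF P])
  have F': "?F + ?Z \<in> Pd" and V': "V + dV \<in> Pd"
    using jprod_Pd_along_segment[OF A Z dV pos] by blast+
  show "Fmap P (x + dx) \<in> Pd" "V + dV \<in> Pd" using F' V' by (simp_all add: Fmap_add)
  show "step_size P \<delta> (x, y, V) (dx, dy, dV) = 1"
    using step_len_eq_1[OF A(1) Z F'] step_len_eq_1[OF A(2) dV V'] by (simp add: step_size_def)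
qed

section \<open>Asymptotics of one Newton step\<close>

lemma bigo_of_le:
  fixes f g :: "nat \<Rightarrow> real"
  assumes "\<forall>\<^sub>F k in sequentially. 0 \<le> f k \<and> f k \<le> C * g k"
  shows "f \<in> O(g)"
proof (rule bigoI[of _ "\<bar>C\<bar>"])
  show "\<forall>\<^sub>F k in sequentially. norm (f k) \<le> \<bar>C\<bar> * norm (g k)"
    using assms by eventually_elim (simp flip: abs_mult)
qed

lemma bigo_le:
  fixes f g h :: "nat \<Rightarrow> real"
  assumes "g \<in> O(h)" "\<forall>\<^sub>F k in sequentially. 0 \<le> f k \<and> f k \<le> g k"
  shows "f \<in> O(h)"
  by (rule landau_o.big_trans[OF bigo_of_le[of f 1 g] assms(1)]) (use assms(2) in simp)

lemma bigo_vanishing: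
  fixes f g :: "nat \<Rightarrow> real"
  assumes "f \<in> O(g)" "g \<longlonglongrightarrow> 0"
  shows "f \<longlonglongrightarrow> 0"
proof -
  have "g \<in> o(\<lambda>_. 1)" using assms(2) by (intro smalloI_tendsto) simp_all
  then have "f \<in> o(\<lambda>_. 1)" using assms(1) landau_o.big_small_trans by blast
  then show ?thesis using smalloD_tendsto by fastforce
qed

context reduced_system
begin

lemma eventually_near:
  assumes lim: "x \<longlonglongrightarrow> xs" "\<forall>i\<in>B. (\<lambda>k. y k i) \<longlonglongrightarrow> ys i" "V \<longlonglongrightarrow> Vs"
    and Pd: "\<forall>\<^sub>F k in sequentially. Fmap P (x k) \<in> Pd \<and> V k \<in> Pd \<and> 0 < \<kappa> k"
    and E: "(\<lambda>k. norm (jprod (Fmap P (x k)) (V k) - \<kappa> k *\<^sub>R mat 1)) \<in> O(\<rho>)"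
    and rk: "\<rho> \<in> o(\<kappa>)" and r: "r > 0"
  shows "\<forall>\<^sub>F k in sequentially. near r (\<kappa> k) (x k) (y k) (V k)"
proof -
  have "\<forall>\<^sub>F k in sequentially. dist (x k) xs < r" using lim(1) r by (rule tendstoD)
  moreover have "\<forall>\<^sub>F k in sequentially. \<forall>i\<in>B. dist (y k i) (ys i) < r"
    using lim(2) r by (intro eventually_ball_finite B ballI tendstoD) auto
  moreover have "\<forall>\<^sub>F k in sequentially. dist (V k) Vs < r" using lim(3) r by (rule tendstoD)
  moreover have "\<forall>\<^sub>F k in sequentially. norm (norm (jprod (Fmap P (x k)) (V k) - \<kappa> k *\<^sub>R mat 1)) \<le> r * norm (\<kappa> k)"
    by (rule landau_o.smallD[OF landau_o.big_small_trans[OF E rk] r])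
  ultimately show ?thesis using Pd
  proof eventually_elim
    case (elim k)
    show ?case unfolding near_def
    proof (intro conjI ballI)
      show "x k \<in> cball xs r" using elim(1) by (simp add: dist_commute)
      show "\<bar>y k i - ys i\<bar> \<le> r" if "i \<in> B" for i using elim(2) that by (auto simp: dist_real_def intro: less_imp_le)
      show "norm (V k - Vs) \<le> r" using elim(3) by (simp add: dist_norm)
      show "norm (jprod (Fmap P (x k)) (V k) - \<kappa> k *\<^sub>R mat 1) \<le> r * \<kappa> k" using elim(4,5) by simp
    qed (use elim(5) in \<open>auto simp: Pd_Sym\<close>)
  qed
qed

text \<open>A step from \<open>F \<circ> V \<approx> \<kappa> I\<close> with deviation \<open>\<rho>\<close> towards the target \<open>m\<close>, with total residual \<open>q\<close>.
  The predictor has \<open>\<kappa> = q = \<mu>\<^sub>k\<close> and \<open>\<rho> = \<mu>\<^sub>k\<^sup>1\<^sup>+\<^sup>\<alpha>\<close>; the corrector has \<open>\<kappa> = m = \<mu>\<^sub>k\<^sub>+\<^sub>1\<close> and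
  \<open>\<rho> = q = \<mu>\<^sub>k\<^sup>1\<^sup>+\<^sup>\<alpha>\<close>. The two conditions that relate to \<open>o(m)\<close> keep the
  segment positive definite.\<close>

lemma newton_step_asymptotics:
  fixes \<kappa> m \<rho> q :: "nat \<Rightarrow> real"
  assumes lim: "x \<longlonglongrightarrow> xs" "\<forall>i\<in>B. (\<lambda>k. y k i) \<longlonglongrightarrow> ys i" "V \<longlonglongrightarrow> Vs"
    and Pd: "\<forall>\<^sub>F k in sequentially. Fmap P (x k) \<in> Pd \<and> V k \<in> Pd \<and> 0 < \<kappa> k"
    and E: "(\<lambda>k. norm (jprod (Fmap P (x k)) (V k) - \<kappa> k *\<^sub>R mat 1)) \<in> O(\<rho>)"
    and rk: "\<rho> \<in> o(\<kappa>)"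
    and res: "(\<lambda>k. residual (m k) (x k) (y k) (V k)) \<in> O(q)" and q: "q \<longlonglongrightarrow> 0"
    and nn: "\<forall>\<^sub>F k in sequentially. 0 \<le> \<rho> k \<and> 0 \<le> q k"
  shows "\<forall>\<^sub>F k in sequentially. \<exists>d. corrector_sys P B I (m k) (x k, y k, V k) d"
    and "\<lbrakk>\<forall>\<^sub>F k in sequentially. corrector_sys P B I (m k) (x k, y k, V k) (dx k, dy k, dV k);
        \<forall>\<^sub>F k in sequentially. 0 < m k \<and> m k \<le> \<kappa> k; \<rho> \<in> o(m); (\<lambda>k. (q k)\<^sup>2 + \<rho> k / \<kappa> k * q k) \<in> o(m)\<rbrakk> \<Longrightarrow>
       (\<lambda>k. dsize B (dx k, dy k, dV k)) \<in> O(q) \<and>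
       (\<lambda>k. norm (stationarity P B (x k + dx k) (\<lambda>i. y k i + dy k i) (V k + dV k))) \<in> O(\<lambda>k. (q k)\<^sup>2) \<and>
       (\<forall>i\<in>I. (\<lambda>k. ghat P i (x k + dx k)) \<in> O(\<lambda>k. (q k)\<^sup>2)) \<and>
       (\<lambda>k. norm (jprod (Fmap P (x k + dx k)) (V k + dV k) - m k *\<^sub>R mat 1)) \<in> O(\<lambda>k. (q k)\<^sup>2 + \<rho> k / \<kappa> k * q k) \<and>
       (\<forall>\<^sub>F k in sequentially. (\<forall>i\<in>B - I. y k i + dy k i = 0) \<and> Fmap P (x k + dx k) \<in> Pd \<and> V k + dV k \<in> Pd \<and>
          step_size P \<delta> (x k, y k, V k) (dx k, dy k, dV k) = 1) \<and>
       (\<lambda>k. x k + dx k) \<longlonglongrightarrow> xs \<and> (\<forall>i\<in>B. (\<lambda>k. y k i + dy k i) \<longlonglongrightarrow> ys i) \<and> (\<lambda>k. V k + dV k) \<longlonglongrightarrow> Vs"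
proof -
  obtain r0 C0 where r0: "r0 > 0" "C0 \<ge> 0"
    "\<And>k x y V m. near r0 k x y V \<Longrightarrow> \<exists>d. corrector_sys P B I m (x, y, V) d"
    "\<And>k x y V m d. near r0 k x y V \<Longrightarrow> corrector_sys P B I m (x, y, V) d \<Longrightarrow>
       dsize B d \<le> C0 * residual m x y V"
    by (rule newton_solvable) blast
  have near: "\<forall>\<^sub>F k in sequentially. near r (\<kappa> k) (x k) (y k) (V k)" if "r > 0" for r
    by (rule eventually_near[OF lim Pd E rk that])
  show "\<forall>\<^sub>F k in sequentially. \<exists>d. corrector_sys P B I (m k) (x k, y k, V k) d"
    using near[OF r0(1)] by eventually_elim (rule r0(3))
  assume cs: "\<forall>\<^sub>F k in sequentially. corrector_sys P B I (m k) (x k, y k, V k) (dx k, dy k, dV k)"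
    and m: "\<forall>\<^sub>F k in sequentially. 0 < m k \<and> m k \<le> \<kappa> k"
    and rm: "\<rho> \<in> o(m)" and qm: "(\<lambda>k. (q k)\<^sup>2 + \<rho> k / \<kappa> k * q k) \<in> o(m)"
  define s where "s k = dsize B (dx k, dy k, dV k)" for k
  have s0: "norm (dx k) \<le> s k" "i \<in> B \<Longrightarrow> \<bar>dy k i\<bar> \<le> s k" "norm (dV k) \<le> s k" "0 \<le> s k" for k i
  proof -
    have a: "0 \<le> (\<Sum>i\<in>B. \<bar>dy k i\<bar>)" by (simp add: sum_nonneg)
    then show "norm (dx k) \<le> s k" "norm (dV k) \<le> s k" "0 \<le> s k" by (simp_all add: s_def dsize_def)
    assume "i \<in> B"
    then have "\<bar>dy k i\<bar> \<le> (\<Sum>i\<in>B. \<bar>dy k i\<bar>)" using B by (intro member_le_sum) auto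
    then show "\<bar>dy k i\<bar> \<le> s k" by (simp add: s_def dsize_def add.commute add_increasing2 add_increasing)
  qed
  have sq: "s \<in> O(q)"
  proof -
    have "s \<in> O(\<lambda>k. residual (m k) (x k) (y k) (V k))"
    proof (rule bigo_of_le[of _ C0])
      show "\<forall>\<^sub>F k in sequentially. 0 \<le> s k \<and> s k \<le> C0 * residual (m k) (x k) (y k) (V k)"
        using near[OF r0(1)] cs 
          by eventually_elim (use s0(4) in \<open>simp add: s_def r0(4)\<close>)
    qed
    then show ?thesis using res by (rule landau_o.big_trans)
  qed
  have s_lim: "s \<longlonglongrightarrow> 0" by (rule bigo_vanishing[OF sq q])
  have small: "d \<longlonglongrightarrow> 0" if "\<And>k. norm (d k) \<le> s k" for d :: "nat \<Rightarrow> 'z::real_normed_vector"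
    by (rule Lim_null_comparison[OF always_eventually s_lim]) (use that in simp)
  have xl: "(\<lambda>k. x k + dx k) \<longlonglongrightarrow> xs" using tendsto_add[OF lim(1) small[of dx, OF s0(1)]] by simp
  have Vl: "(\<lambda>k. V k + dV k) \<longlonglongrightarrow> Vs" using tendsto_add[OF lim(3) small[of dV, OF s0(3)]] by simp
  have yl: "(\<lambda>k. y k i + dy k i) \<longlonglongrightarrow> ys i" if "i \<in> B" for i
    using tendsto_add[OF bspec[OF lim(2) that] small[of "\<lambda>k. dy k i"]] s0(2)[OF that] by simp
  obtain r C where rC: "r > 0" "C \<ge> 0" and st:
    "\<And>k x y V m dx dy dV. near r k x y V \<Longrightarrow> x + dx \<in> cball xs r \<Longrightarrow> corrector_sys P B I m (x, y, V) (dx, dy, dV) \<Longrightarrow>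
     norm (stationarity P B (x + dx) (\<lambda>i. y i + dy i) (V + dV)) \<le> C * (dsize B (dx, dy, dV))\<^sup>2"
    "\<And>k x y V m dx dy dV i. near r k x y V \<Longrightarrow> x + dx \<in> cball xs r \<Longrightarrow> corrector_sys P B I m (x, y, V) (dx, dy, dV) \<Longrightarrow>
     i \<in> I \<Longrightarrow> \<bar>ghat P i (x + dx)\<bar> \<le> C * (dsize B (dx, dy, dV))\<^sup>2"
    "\<And>k x y V m dx dy dV t. near r k x y V \<Longrightarrow> x + dx \<in> cball xs r \<Longrightarrow> corrector_sys P B I m (x, y, V) (dx, dy, dV) \<Longrightarrow>
     0 \<le> t \<Longrightarrow> t \<le> 1 \<Longrightarrow> norm (jprod (Fmap P (x + t *\<^sub>R dx)) (V + t *\<^sub>R dV)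
         - ((1 - t) *\<^sub>R jprod (Fmap P x) V + (t * m) *\<^sub>R mat 1))
       \<le> C * ((dsize B (dx, dy, dV))\<^sup>2 + norm (jprod (Fmap P x) V - k *\<^sub>R mat 1) / k * dsize B (dx, dy, dV))"
    by (rule newton_step_residual) blast
  define E where "E k = norm (jprod (Fmap P (x k)) (V k) - \<kappa> k *\<^sub>R mat 1)" for k
  define h where "h k = (s k)\<^sup>2 + E k / \<kappa> k * s k" for k
  have ev: "\<forall>\<^sub>F k in sequentially. near r (\<kappa> k) (x k) (y k) (V k) \<and> x k + dx k \<in> cball xs r \<and>
      corrector_sys P B I (m k) (x k, y k, V k) (dx k, dy k, dV k)"
    using near[OF rC(1)] tendstoD[OF xl rC(1)] cs by eventually_elim (simp add: dist_commute)
  have s2: "(\<lambda>k. (s k)\<^sup>2) \<in> O(\<lambda>k. (q k)\<^sup>2)"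
    unfolding power2_eq_square by (rule landau_o.big_mult[OF sq sq])
  have b1: "(\<lambda>k. norm (stationarity P B (x k + dx k) (\<lambda>i. y k i + dy k i) (V k + dV k))) \<in> O(\<lambda>k. (q k)\<^sup>2)"
  proof (rule landau_o.big_trans[OF bigo_of_le[of _ C] s2])
    show "\<forall>\<^sub>F k in sequentially. 0 \<le> norm (stationarity P B (x k + dx k) (\<lambda>i. y k i + dy k i) (V k + dV k)) \<and>
       norm (stationarity P B (x k + dx k) (\<lambda>i. y k i + dy k i) (V k + dV k)) \<le> C * (s k)\<^sup>2"
      using ev unfolding s_def by eventually_elim (intro conjI norm_ge_zero st(1); blast)
  qed
  have b2: "(\<lambda>k. ghat P i (x k + dx k)) \<in> O(\<lambda>k. (q k)\<^sup>2)" if i: "i \<in> I" for i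
  proof -
    have "(\<lambda>k. \<bar>ghat P i (x k + dx k)\<bar>) \<in> O(\<lambda>k. (q k)\<^sup>2)"
    proof (rule landau_o.big_trans[OF bigo_of_le[of _ C] s2])
      show "\<forall>\<^sub>F k in sequentially. 0 \<le> \<bar>ghat P i (x k + dx k)\<bar> \<and> \<bar>ghat P i (x k + dx k)\<bar> \<le> C * (s k)\<^sup>2"
        using ev unfolding s_def by eventually_elim (intro conjI abs_ge_zero st(2)[OF _ _ _ i]; blast)
    qed
    then show ?thesis by simp
  qed
  have hO: "h \<in> O(\<lambda>k. (q k)\<^sup>2 + \<rho> k / \<kappa> k * q k)"
  proof -
    obtain c1 where c1: "c1 > 0" "\<forall>\<^sub>F k in sequentially. norm (E k) \<le> c1 * norm (\<rho> k)"
      using landau_o.bigE[OF assms(5)] by (auto simp: E_def)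
    obtain c2 where c2: "c2 > 0" "\<forall>\<^sub>F k in sequentially. norm (s k) \<le> c2 * norm (q k)"
      using landau_o.bigE[OF sq] by blast
    show ?thesis
    proof (rule bigo_of_le[of _ "c2 * c2 + c1 * c2"])
      show "\<forall>\<^sub>F k in sequentially. 0 \<le> h k \<and> h k \<le> (c2 * c2 + c1 * c2) * ((q k)\<^sup>2 + \<rho> k / \<kappa> k * q k)"
        using c1(2) c2(2) nn Pd
      proof eventually_elim
        case (elim k)
        have E0: "0 \<le> E k" by (simp add: E_def)
        have s: "s k \<le> c2 * q k" and E: "E k \<le> c1 * \<rho> k" and k: "0 < \<kappa> k" using elim E0 s0(4)[of k] by auto
        have "E k / \<kappa> k \<le> c1 * \<rho> k / \<kappa> k" using E k by (intro divide_right_mono) auto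
        then have "E k / \<kappa> k * s k \<le> c1 * \<rho> k / \<kappa> k * (c2 * q k)"
          using s E0 k s0(4)[of k] c1(1) elim(3) by (intro mult_mono) auto
        also have "\<dots> = c1 * c2 * (\<rho> k / \<kappa> k * q k)" by simp
        finally have 1: "E k / \<kappa> k * s k \<le> c1 * c2 * (\<rho> k / \<kappa> k * q k)" .
        have "(s k)\<^sup>2 \<le> (c2 * q k)\<^sup>2" using s s0(4)[of k] by (rule power_mono)
        then have 2: "(s k)\<^sup>2 \<le> c2 * c2 * (q k)\<^sup>2" by (simp add: power2_eq_square mult_ac)
        have 3: "0 \<le> c1 * c2 * (q k)\<^sup>2" "0 \<le> c2 * c2 * (\<rho> k / \<kappa> k * q k)" using c1(1) c2(1) elim(3) k by simp_all
        have "0 \<le> h k" unfolding h_def using E0 k s0(4)[of k] by simp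
        moreover have "h k \<le> (c2 * c2 + c1 * c2) * ((q k)\<^sup>2 + \<rho> k / \<kappa> k * q k)"
          unfolding h_def using 1 2 3 by (simp only: distrib_left distrib_right)
        ultimately show ?case by blast
      qed
    qed
  qed
  have seg: "\<forall>\<^sub>F k in sequentially. \<forall>t. 0 \<le> t \<longrightarrow> t \<le> 1 \<longrightarrow> norm (jprod (Fmap P (x k + t *\<^sub>R dx k)) (V k + t *\<^sub>R dV k)
         - ((1 - t) *\<^sub>R jprod (Fmap P (x k)) (V k) + (t * m k) *\<^sub>R mat 1)) \<le> C * h k"
    using ev
  proof eventually_elim
    case (elim k)
    then show ?case unfolding h_def s_def E_def by (intro allI impI st(3)) auto
  qed
  have b3: "(\<lambda>k. norm (jprod (Fmap P (x k + dx k)) (V k + dV k) - m k *\<^sub>R mat 1)) \<in> O(\<lambda>k. (q k)\<^sup>2 + \<rho> k / \<kappa> k * q k)"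
  proof (rule landau_o.big_trans[OF bigo_of_le[of _ C h] hO])
    show "\<forall>\<^sub>F k in sequentially. 0 \<le> norm (jprod (Fmap P (x k + dx k)) (V k + dV k) - m k *\<^sub>R mat 1) \<and>
        norm (jprod (Fmap P (x k + dx k)) (V k + dV k) - m k *\<^sub>R mat 1) \<le> C * h k"
      using seg
    proof eventually_elim
      case (elim k)
      show ?case using elim[rule_format, of 1] by simp
    qed
  qed
  have "(\<lambda>k. E k + C * h k) \<in> o(m)"
  proof (rule sum_in_smallo)
    show "E \<in> o(m)" using landau_o.big_small_trans[OF assms(5) rm] by (simp add: E_def[abs_def])
    show "(\<lambda>k. C * h k) \<in> o(m)" using landau_o.big_small_trans[OF hO qm] by (cases "C = 0") auto
  qed
  then have "\<forall>\<^sub>F k in sequentially. norm (E k + C * h k) \<le> (1/2) * norm (m k)"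
    by (rule landau_o.smallD) simp
  then have b4: "\<forall>\<^sub>F k in sequentially. (\<forall>i\<in>B - I. y k i + dy k i = 0) \<and> Fmap P (x k + dx k) \<in> Pd \<and> V k + dV k \<in> Pd \<and>
          step_size P \<delta> (x k, y k, V k) (dx k, dy k, dV k) = 1"
    using m seg Pd cs
  proof eventually_elim
    case (elim k)
    have dV: "dV k \<in> Sym" and y0: "\<forall>i\<in>B - I. y k i + dy k i = 0" using elim(5) by (auto simp: corrector_sys_def)
    have "0 < m k" using elim(2) by blast
    then have small: "E k + C * h k < m k"
      using elim(1) abs_ge_self[of "E k + C * h k"] unfolding real_norm_def by linarith
    note N = newton_step_Pd[OF sisdp, of "x k" "V k" "dV k" "\<kappa> k" "E k" "dx k" "m k" "C * h k"]
    have "Fmap P (x k + dx k) \<in> Pd" "V k + dV k \<in> Pd" "step_size P \<delta> (x k, y k, V k) (dx k, dy k, dV k) = 1"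
      using elim dV small by (intro N; simp add: E_def)+
    then show ?case using y0 by blast
  qed
  show "(\<lambda>k. dsize B (dx k, dy k, dV k)) \<in> O(q) \<and>
       (\<lambda>k. norm (stationarity P B (x k + dx k) (\<lambda>i. y k i + dy k i) (V k + dV k))) \<in> O(\<lambda>k. (q k)\<^sup>2) \<and>
       (\<forall>i\<in>I. (\<lambda>k. ghat P i (x k + dx k)) \<in> O(\<lambda>k. (q k)\<^sup>2)) \<and>
       (\<lambda>k. norm (jprod (Fmap P (x k + dx k)) (V k + dV k) - m k *\<^sub>R mat 1)) \<in> O(\<lambda>k. (q k)\<^sup>2 + \<rho> k / \<kappa> k * q k) \<and>
       (\<forall>\<^sub>F k in sequentially. (\<forall>i\<in>B - I. y k i + dy k i = 0) \<and> Fmap P (x k + dx k) \<in> Pd \<and> V k + dV k \<in> Pd \<and>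
          step_size P \<delta> (x k, y k, V k) (dx k, dy k, dV k) = 1) \<and>
       (\<lambda>k. x k + dx k) \<longlonglongrightarrow> xs \<and> (\<forall>i\<in>B. (\<lambda>k. y k i + dy k i) \<longlonglongrightarrow> ys i) \<and> (\<lambda>k. V k + dV k) \<longlonglongrightarrow> Vs"
    using sq[unfolded s_def[abs_def]] b1 b2 b3 b4 xl yl Vl by (intro conjI ballI)
qed

end

section \<open>The semi-infinite residual on the reduced data\<close>

lemma
  fixes P :: "('n::finite, 'm::finite, 'q::finite) sisdp_data"
  assumes P: "sisdp P"
  shows con_le_theta: "\<tau> \<in> Tset P \<Longrightarrow> con P x \<tau> \<le> theta P x"
    and theta_nonneg: "0 \<le> theta P x"
    and theta_leI: "0 \<le> c \<Longrightarrow> (\<And>\<tau>. \<tau> \<in> Tset P \<Longrightarrow> con P x \<tau> \<le> c) \<Longrightarrow> theta P x \<le> c"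
    and con_attains_sup: "\<exists>\<tau>\<in>Tset P. \<forall>\<tau>'\<in>Tset P. con P x \<tau>' \<le> con P x \<tau>"
proof -
  have T: "compact (Tset P)" "Tset P \<noteq> {}" using P by (auto simp: sisdp_def)
  have "continuous_on (Tset P) (\<lambda>\<tau>. (\<lambda>(x, \<tau>). con P x \<tau>) (x, \<tau>))"
    by (rule continuous_on_compose2[of "UNIV \<times> Tset P"])
      (use P in \<open>auto simp: sisdp_def intro!: continuous_intros\<close>)
  then have c: "continuous_on (Tset P) (con P x)" by simp
  show sup: "\<exists>\<tau>\<in>Tset P. \<forall>\<tau>'\<in>Tset P. con P x \<tau>' \<le> con P x \<tau>"
    by (rule continuous_attains_sup[OF T c])
  then obtain \<tau>0 where \<tau>0: "\<tau>0 \<in> Tset P" "\<And>\<tau>'. \<tau>' \<in> Tset P \<Longrightarrow> con P x \<tau>' \<le> con P x \<tau>0" by blast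
  have bdd: "bdd_above ((\<lambda>\<tau>. max (con P x \<tau>) 0) ` Tset P)"
    by (rule bdd_aboveI2[of _ _ "max (con P x \<tau>0) 0"]) (intro max.mono \<tau>0(2) order_refl)
  have le: "max (con P x \<tau>) 0 \<le> theta P x" if "\<tau> \<in> Tset P" for \<tau>
    unfolding theta_def by (rule cSUP_upper[OF that bdd])
  show "con P x \<tau> \<le> theta P x" if "\<tau> \<in> Tset P" using le[OF that] by simp
  show "0 \<le> theta P x" using le[OF \<tau>0(1)] by simp
  show "theta P x \<le> c" if "0 \<le> c" "\<And>\<tau>. \<tau> \<in> Tset P \<Longrightarrow> con P x \<tau> \<le> c"
    unfolding theta_def by (rule cSUP_least[OF T(2)]) (use that in auto)
qed

text \<open>A global maximizer is a local one whose value exceeds the supremum minus \<open>\<sigma>\<close>, hence is a value of one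
  of the functions of the reduction.\<close>
lemma local_reduction_max:
  fixes P :: "('n::finite, 'm::finite, 'q::finite) sisdp_data"
  assumes P: "sisdp P" and \<sigma>: "0 < \<sigma>" and R: "local_reduction P \<sigma> xb U B" and x: "x \<in> U" and \<tau>: "\<tau> \<in> Tset P"
  shows "\<exists>i\<in>B. con P x \<tau> \<le> ghat P i x"
proof -
  obtain t where t: "t \<in> Tset P" "\<And>\<tau>'. \<tau>' \<in> Tset P \<Longrightarrow> con P x \<tau>' \<le> con P x t"
    using con_attains_sup[OF P, of x] by blast
  have "(SUP \<tau>'\<in>Tset P. con P x \<tau>') \<le> con P x t" using t by (intro cSUP_least) auto
  moreover have "t \<in> locmax P x"
    using t by (auto simp: locmax_def eventually_at_filter intro!: always_eventually)
  ultimately have "t \<in> locmax_sigma P \<sigma> x" using \<sigma> by (simp add: locmax_sigma_def)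
  moreover have "(\<lambda>i. i x) ` B = locmax_sigma P \<sigma> x"
    using R x by (auto simp: local_reduction_def bij_betw_def)
  ultimately obtain i where "i \<in> B" "t = i x" by blast
  then show ?thesis using t(2)[OF \<tau>] by (auto simp: ghat_def)
qed

lemma grad_ghat:
  fixes P :: "('n::finite, 'm::finite, 'q::finite) sisdp_data"
  assumes P: "sisdp P" and R: "local_reduction P \<sigma> xb U B" and x: "x \<in> U" and i: "i \<in> B"
    and C3: "ck_on 3 (ghat P i) U"
  shows "grad (ghat P i) x = grad (\<lambda>x'. con P x' (i x)) x"
proof -
  have U: "open U" using R by (simp add: local_reduction_def)
  have ck: "ck_on 2 i U" and iT: "i \<in> U \<rightarrow> Tset P"
    and max: "\<forall>\<^sub>F \<tau>' in at (i x) within Tset P. con P x \<tau>' < con P x (i x)"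
    using R i x by (auto simp: local_reduction_def PiE_def)
  have "ck_on 0 i U"
    using ck_on_Suc_imp[OF ck_on_Suc_imp, of 0 i U] ck by (simp only: numeral_2_eq_2)
  then have cont: "continuous_on U i" by simp
  have ix: "i x \<in> Tset P" using iT x by auto
  have d1: "(\<lambda>x'. con P x' (i x)) differentiable at x" using P ix by (auto simp: sisdp_def)
  have "ghat P i differentiable at x" by (rule ck3_differentiable(1)[OF U x C3])
  then have d2: "(\<lambda>x'. con P x' (i x')) differentiable at x" by (simp add: ghat_def[abs_def])
  have "grad (\<lambda>x'. con P x' (i x')) x = grad (\<lambda>x'. con P x' (i x)) x"
  proof (rule grad_local_maximum_value[OF U x iT cont _ _ d1 d2])
    show "continuous_on (UNIV \<times> Tset P) (\<lambda>(x, \<tau>). con P x \<tau>)" using P by (simp add: sisdp_def)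
    show "convex_on UNIV (\<lambda>x. con P x \<tau>)" if "\<tau> \<in> Tset P" for \<tau> using P that by (simp add: sisdp_def)
    show "\<forall>\<^sub>F \<tau>' in at (i x) within Tset P. con P x \<tau>' \<le> con P x (i x)"
      using max by (rule eventually_mono) simp
  qed
  then show ?thesis by (simp add: ghat_def[abs_def])
qed

lemma phi_discrete:
  fixes P :: "('n::finite, 'm::finite, 'q::finite) sisdp_data"
  assumes P: "sisdp P" and R: "local_reduction P \<sigma> xb U B" and x: "x \<in> U"
    and C3: "\<And>i. i \<in> B \<Longrightarrow> ck_on 3 (ghat P i) U"
    and y: "y \<in> Mplus (Tset P)" and ae: "AE \<tau> in y. \<tau> \<in> supp (Tset P) y"
    and su: "supp (Tset P) y \<subseteq> (\<lambda>i. i x) ` B"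
  shows "phi1 P (x, y, V) = stationarity P B x (\<lambda>i. measure y {i x}) V"
    and "phi2 P (x, y, V) = (\<Sum>i\<in>B. measure y {i x} * ghat P i x)"
proof -
  have B: "finite B" "inj_on (\<lambda>i. i x) B" and iT: "\<And>i. i \<in> B \<Longrightarrow> i x \<in> Tset P"
    using R x by (auto simp: local_reduction_def bij_betw_def)
  have T: "closed (Tset P)" using P by (auto simp: sisdp_def compact_imp_closed)
  have fin: "finite_measure y" and sets: "sets y = sets (restrict_space borel (Tset P))" using y by (auto simp: Mplus_def)
  have ae': "AE \<tau> in y. \<tau> \<in> (\<lambda>i. i x) ` B" using ae su by (auto elim: eventually_mono)
  have int: "(\<integral>\<tau>. h \<tau> \<partial>y) = (\<Sum>i\<in>B. measure y {i x} *\<^sub>R h (i x))"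
    if h: "h \<in> borel_measurable (restrict_space borel (Tset P))" for h :: "real^'q \<Rightarrow> 'z::euclidean_space"
  proof -
    have h': "h \<in> borel_measurable y" using h sets by (simp cong: measurable_cong_sets)
    have "(\<integral>\<tau>. h \<tau> \<partial>y) = (\<Sum>\<tau>\<in>(\<lambda>i. i x) ` B. measure y {\<tau>} *\<^sub>R h \<tau>)"
      by (rule integral_discrete_measure[OF fin _ _ ae' h'])
        (use B iT Mplus_singleton[OF y T] in auto)
    then show ?thesis by (simp add: sum.reindex[OF B(2)])
  qed
  show "phi2 P (x, y, V) = (\<Sum>i\<in>B. measure y {i x} * ghat P i x)"
    using int[OF borel_measurable_con[OF P, of x]] by (simp add: phi2_def ghat_def)
  have "(\<integral>\<tau>. grad (\<lambda>x'. con P x' \<tau>) x \<partial>y) = (\<Sum>i\<in>B. measure y {i x} *\<^sub>R grad (ghat P i) x)"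
    unfolding int[OF borel_measurable_grad_con[OF P, of x]]
    by (intro sum.cong refl) (simp add: grad_ghat[OF P R x _ C3])
  then show "phi1 P (x, y, V) = stationarity P B x (\<lambda>i. measure y {i x}) V"
    by (simp add: phi1_def stationarity_def)
qed

lemma phi_as_measure:
  fixes P :: "('n::finite, 'm::finite, 'q::finite) sisdp_data"
  assumes P: "sisdp P" and R: "local_reduction P \<sigma> xb U B" and x: "x \<in> U"
    and C3: "\<And>i. i \<in> B \<Longrightarrow> ck_on 3 (ghat P i) U" and y: "\<And>i. i \<in> B \<Longrightarrow> 0 \<le> y i"
  shows "phi1 P (as_measure (Tset P) B (x, y, V)) = stationarity P B x y V"
    and "phi2 P (as_measure (Tset P) B (x, y, V)) = (\<Sum>i\<in>B. y i * ghat P i x)"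
    and "fst (snd (as_measure (Tset P) B (x, y, V))) \<in> Mplus (Tset P)"
proof -
  have B: "finite B" and iT: "\<And>i. i \<in> B \<Longrightarrow> i x \<in> Tset P"
    using R x by (auto simp: local_reduction_def)
  obtain Y where Y: "as_measure (Tset P) B (x, y, V) = (x, Y, V)" by (simp add: as_measure_def)
  have int: "(\<integral>\<tau>. h \<tau> \<partial>Y) = (\<Sum>i\<in>B. y i *\<^sub>R h (i x))"
    if "h \<in> borel_measurable (restrict_space borel (Tset P))" for h :: "real^'q \<Rightarrow> 'z::euclidean_space"
  proof -
    have "(\<integral>\<tau>. h \<tau> \<partial>(fst (snd (as_measure (Tset P) B (x, y, V))))) = (\<Sum>i\<in>B. y i *\<^sub>R h (i x))"
      by (rule integral_as_measure) (use iT B y that in auto)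
    then show ?thesis by (simp add: Y)
  qed
  show "fst (snd (as_measure (Tset P) B (x, y, V))) \<in> Mplus (Tset P)"
    by (rule as_measure_Mplus) (use iT B y in auto)
  show "phi2 P (as_measure (Tset P) B (x, y, V)) = (\<Sum>i\<in>B. y i * ghat P i x)"
    using int[OF borel_measurable_con[OF P, of x]] by (simp add: Y phi2_def ghat_def)
  have "(\<integral>\<tau>. grad (\<lambda>x'. con P x' \<tau>) x \<partial>Y) = (\<Sum>i\<in>B. y i *\<^sub>R grad (ghat P i) x)"
    unfolding int[OF borel_measurable_grad_con[OF P, of x]]
    by (intro sum.cong refl) (simp add: grad_ghat[OF P R x _ C3])
  then show "phi1 P (as_measure (Tset P) B (x, y, V)) = stationarity P B x y V"
    by (simp add: Y phi1_def stationarity_def)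
qed

lemma norm_phi3:
  assumes "sisdp P" "V \<in> Sym"
  shows "norm (phi3 P \<mu> (x, y, V)) = norm (jprod (Fmap P x) V - \<mu> *\<^sub>R mat 1)"
  unfolding phi3_def prod.case
  by (intro norm_svec subspace_diff[OF subspace_Sym] subspace_scale[OF subspace_Sym] jprod_Sym
    Fmap_Sym assms Pd_Sym[OF mat_1_Pd])

lemma Rres_components:
  assumes "Rres P \<mu> w \<le> \<epsilon>"
  shows "\<bar>theta P (fst w)\<bar> \<le> \<epsilon>" "norm (phi1 P w) \<le> \<epsilon>" "\<bar>phi2 P w\<bar> \<le> \<epsilon>" "norm (phi3 P \<mu> w) \<le> \<epsilon>"
proof -
  have *: "\<bar>a\<bar> \<le> \<epsilon>" if "a\<^sup>2 \<le> (theta P (fst w))\<^sup>2 + (norm (phi1 P w))\<^sup>2 + (phi2 P w)\<^sup>2 + (norm (phi3 P \<mu> w))\<^sup>2" for a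
  proof -
    have "\<bar>a\<bar> = sqrt (a\<^sup>2)" by simp
    also have "\<dots> \<le> Rres P \<mu> w" unfolding Rres_def using that by (rule real_sqrt_le_mono)
    finally show ?thesis using assms by linarith
  qed
  show "\<bar>theta P (fst w)\<bar> \<le> \<epsilon>" "norm (phi1 P w) \<le> \<epsilon>" "\<bar>phi2 P w\<bar> \<le> \<epsilon>" "norm (phi3 P \<mu> w) \<le> \<epsilon>"
    using *[of "theta P (fst w)"] *[of "norm (phi1 P w)"] *[of "phi2 P w"] *[of "norm (phi3 P \<mu> w)"] by simp_all
qed

lemma Rres_le_sum: "Rres P \<mu> w \<le> \<bar>theta P (fst w)\<bar> + norm (phi1 P w) + \<bar>phi2 P w\<bar> + norm (phi3 P \<mu> w)"
proof -
  have "sqrt (a\<^sup>2 + b\<^sup>2 + c\<^sup>2 + d\<^sup>2) \<le> \<bar>a\<bar> + \<bar>b\<bar> + \<bar>c\<bar> + \<bar>d\<bar>" for a b c d :: real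
    using sqrt_sum_squares_le_sum_abs[of a b] sqrt_sum_squares_le_sum_abs[of "sqrt (a\<^sup>2 + b\<^sup>2)" c]
      sqrt_sum_squares_le_sum_abs[of "sqrt (a\<^sup>2 + b\<^sup>2 + c\<^sup>2)" d] by simp
  from this[of "theta P (fst w)" "norm (phi1 P w)" "phi2 P w" "norm (phi3 P \<mu> w)"]
  show ?thesis by (simp add: Rres_def)
qed

text \<open>Each product is at most \<open>\<epsilon> y\<^sub>i\<close>, so none can be very negative while their sum is almost \<open>0\<close>. In this
  way the two scalar residuals \<open>\<theta>\<close> and \<open>\<phi>\<^sub>2\<close> control complementarity index by index.\<close>
lemma complementary_products_bound:
  fixes y g :: "'i \<Rightarrow> real"
  assumes B: "finite B" and y: "\<And>i. i \<in> B \<Longrightarrow> 0 \<le> y i" and g: "\<And>i. i \<in> B \<Longrightarrow> g i \<le> \<epsilon>"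
    and s: "\<bar>\<Sum>i\<in>B. y i * g i\<bar> \<le> \<epsilon>" and j: "j \<in> B"
  shows "\<bar>y j * g j\<bar> \<le> (1 + (\<Sum>i\<in>B. y i)) * \<epsilon>"
proof -
  have e: "\<epsilon> \<ge> 0" using s by linarith
  have le: "y i * g i \<le> y i * \<epsilon>" if "i \<in> B" for i using y g that by (intro mult_left_mono) auto
  have yj: "y j \<le> (\<Sum>i\<in>B. y i)" using B y j by (intro member_le_sum) auto
  have "(\<Sum>i\<in>B - {j}. y i * g i) \<le> (\<Sum>i\<in>B - {j}. y i * \<epsilon>)" using le by (intro sum_mono) auto
  also have "\<dots> \<le> (\<Sum>i\<in>B. y i * \<epsilon>)" using B y e by (intro sum_mono2) auto
  finally have 1: "(\<Sum>i\<in>B - {j}. y i * g i) \<le> (\<Sum>i\<in>B. y i) * \<epsilon>" by (simp only: sum_distrib_right)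
  have "(\<Sum>i\<in>B. y i * g i) = y j * g j + (\<Sum>i\<in>B - {j}. y i * g i)" using B j by (rule sum.remove)
  moreover have "y j * g j \<le> (\<Sum>i\<in>B. y i) * \<epsilon>"
    using le[OF j] mult_right_mono[OF yj e] by linarith
  ultimately show ?thesis using 1 s e by (simp add: distrib_right)
qed

section \<open>From the algorithm to the reduced system\<close>

lemma bigo_cancel:
  fixes a b h :: "nat \<Rightarrow> real"
  assumes ab: "(\<lambda>k. a k * b k) \<in> O(h)" and b: "b \<longlonglongrightarrow> b0" "b0 \<noteq> 0"
  shows "a \<in> O(h)"
proof -
  obtain c where c: "c > 0" "\<forall>\<^sub>F k in sequentially. norm (a k * b k) \<le> c * norm (h k)"
    using landau_o.bigE[OF ab] by blast
  have "\<forall>\<^sub>F k in sequentially. dist (b k) b0 < \<bar>b0\<bar> / 2" using b by (intro tendstoD) auto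
  then have "\<forall>\<^sub>F k in sequentially. norm (a k) \<le> (2 * c / \<bar>b0\<bar>) * norm (h k)"
    using c(2)
  proof eventually_elim
    case (elim k)
    have "\<bar>b0\<bar> / 2 \<le> \<bar>b k\<bar>" using elim(1) unfolding dist_real_def by linarith
    then have "\<bar>a k\<bar> * (\<bar>b0\<bar> / 2) \<le> \<bar>a k\<bar> * \<bar>b k\<bar>" by (rule mult_left_mono) simp
    then have "\<bar>a k\<bar> * (\<bar>b0\<bar> / 2) \<le> c * \<bar>h k\<bar>" using elim(2) by (simp add: abs_mult)
    then show ?case using b(2) by (simp add: field_simps)
  qed
  then show ?thesis by (rule bigoI)
qed

text \<open>The complementarity sum has terms of one sign, so each of them vanishes.\<close>
lemma predictor_imp_corrector:
  fixes P :: "('n::finite, 'm::finite, 'q::finite) sisdp_data"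
  assumes B: "finite B" and pr: "predictor_sys P B m z d"
  shows "corrector_sys P B {i\<in>B. lin_ghat P (fst z) (fst d) i = 0} m z d"
proof -
  obtain x y V where z: "z = (x, y, V)" by (rule prod_cases3)
  obtain dx dy dV where d: "d = (dx, dy, dV)" by (rule prod_cases3)
  have a: "\<And>i. i \<in> B \<Longrightarrow> 0 \<le> y i + dy i" "\<And>i. i \<in> B \<Longrightarrow> lin_ghat P x dx i \<le> 0"
    and s: "(\<Sum>i\<in>B. (y i + dy i) * lin_ghat P x dx i) = 0"
    using pr by (auto simp: predictor_sys_def cond_c_def z d)
  have "(y i + dy i) * lin_ghat P x dx i = 0" if "i \<in> B" for i
  proof -
    have "(\<Sum>i\<in>B. - ((y i + dy i) * lin_ghat P x dx i)) = 0" using s by (simp add: sum_negf)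
    moreover have "\<forall>i\<in>B. 0 \<le> - ((y i + dy i) * lin_ghat P x dx i)"
      using a by (simp add: mult_le_0_iff)
    ultimately show ?thesis using B that sum_nonneg_eq_0_iff[of B "\<lambda>i. - ((y i + dy i) * lin_ghat P x dx i)"] by simp
  qed
  then show ?thesis using pr by (auto simp: predictor_sys_def corrector_sys_def z d)
qed

lemma vdist_components:
  assumes "finite B"
  shows "norm (x - x') \<le> vdist B (x, y, V) (x', y', V')"
    and "i \<in> B \<Longrightarrow> \<bar>y i - y' i\<bar> \<le> vdist B (x, y, V) (x', y', V')"
    and "norm (svec (V - V')) \<le> vdist B (x, y, V) (x', y', V')"
proof -
  have *: "\<bar>a\<bar> \<le> vdist B (x, y, V) (x', y', V')"
    if "a\<^sup>2 \<le> (norm (x - x'))\<^sup>2 + (\<Sum>i\<in>B. (y i - y' i)\<^sup>2) + (norm (svec (V - V')))\<^sup>2" for a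
    using real_sqrt_le_mono[OF that] by (simp add: vdist_def)
  have s: "0 \<le> (\<Sum>i\<in>B. (y i - y' i)\<^sup>2)" by (simp add: sum_nonneg)
  show "norm (x - x') \<le> vdist B (x, y, V) (x', y', V')" using *[of "norm (x - x')"] s by simp
  show "norm (svec (V - V')) \<le> vdist B (x, y, V) (x', y', V')" using *[of "norm (svec (V - V'))"] s by simp
  assume "i \<in> B"
  then have "(y i - y' i)\<^sup>2 \<le> (\<Sum>i\<in>B. (y i - y' i)\<^sup>2)" using assms by (intro member_le_sum) auto
  then show "\<bar>y i - y' i\<bar> \<le> vdist B (x, y, V) (x', y', V')" by (intro *) (simp add: add_increasing add_increasing2)
qed

lemma vdist_le_sum:
  "vdist B (x, y, V) (x', y', V') \<le> norm (x - x') + (\<Sum>i\<in>B. \<bar>y i - y' i\<bar>) + norm (svec (V - V'))"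
proof -
  let ?b = "L2_set (\<lambda>i. y i - y' i) B"
  have "vdist B (x, y, V) (x', y', V') = sqrt ((sqrt ((norm (x - x'))\<^sup>2 + ?b\<^sup>2))\<^sup>2 + (norm (svec (V - V')))\<^sup>2)"
    by (simp add: vdist_def L2_set_def sum_nonneg)
  also have "\<dots> \<le> \<bar>sqrt ((norm (x - x'))\<^sup>2 + ?b\<^sup>2)\<bar> + \<bar>norm (svec (V - V'))\<bar>"
    by (rule sqrt_sum_squares_le_sum_abs)
  also have "\<dots> \<le> (norm (x - x') + ?b) + norm (svec (V - V'))"
    using sqrt_sum_squares_le_sum_abs[of "norm (x - x')" ?b] by (simp add: L2_set_nonneg)
  also have "?b \<le> (\<Sum>i\<in>B. \<bar>y i - y' i\<bar>)" by (rule L2_set_le_sum_abs)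
  finally show ?thesis by simp
qed

lemma Nbhd_reduced:
  fixes P :: "('n::finite, 'm::{finite,linorder}, 'q::finite) sisdp_data"
  assumes P: "sisdp P" and R: "local_reduction P \<sigma> xb U B" and x: "x \<in> U"
    and C3: "\<And>i. i \<in> B \<Longrightarrow> ck_on 3 (ghat P i) U"
    and N: "(x, y, V) \<in> Nbhd P \<mu> \<epsilon>" and ae: "AE \<tau> in y. \<tau> \<in> supp (Tset P) y"
    and su: "supp (Tset P) y \<subseteq> (\<lambda>i. i x) ` B"
  defines "Y \<equiv> \<lambda>i. measure y {i x}"
  shows "V \<in> Pd" "Fmap P x \<in> Pd" "norm (stationarity P B x Y V) \<le> \<epsilon>"
    "\<And>i. i \<in> B \<Longrightarrow> \<bar>Y i * ghat P i x\<bar> \<le> (1 + (\<Sum>i\<in>B. Y i)) * \<epsilon>"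
    "norm (jprod (Fmap P x) V - \<mu> *\<^sub>R mat 1) \<le> \<epsilon>"
proof -
  have y: "y \<in> Mplus (Tset P)" and V: "V \<in> Pd" and F: "Fmap P x \<in> Pd" and r: "Rres P \<mu> (x, y, V) \<le> \<epsilon>"
    using N by (auto simp: Nbhd_def)
  show "V \<in> Pd" "Fmap P x \<in> Pd" using V F .
  note c = Rres_components[OF r]
  note ph = phi_discrete[OF P R x C3 y ae su, of V]
  show "norm (stationarity P B x Y V) \<le> \<epsilon>" using c(2) ph(1) by (simp add: Y_def)
  show "norm (jprod (Fmap P x) V - \<mu> *\<^sub>R mat 1) \<le> \<epsilon>" using c(4) norm_phi3[OF P Pd_Sym[OF V]] by simp
  show "\<bar>Y i * ghat P i x\<bar> \<le> (1 + (\<Sum>i\<in>B. Y i)) * \<epsilon>" if "i \<in> B" for i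
  proof (rule complementary_products_bound[OF _ _ _ _ that])
    show "finite B" using R by (simp add: local_reduction_def)
    show "\<And>i. i \<in> B \<Longrightarrow> 0 \<le> Y i" by (simp add: Y_def)
    show "\<bar>\<Sum>i\<in>B. Y i * ghat P i x\<bar> \<le> \<epsilon>" using c(3) ph(2) by (simp add: Y_def)
    show "ghat P j x \<le> \<epsilon>" if "j \<in> B" for j
    proof -
      have "j x \<in> Tset P" using R x that by (auto simp: local_reduction_def)
      then have "ghat P j x \<le> theta P x" unfolding ghat_def by (rule con_le_theta[OF P])
      then show ?thesis using c(1) by simp
    qed
  qed
qed

text \<open>Inactive indices contribute neither to \<open>\<theta>\<close>, their values being nonpositive, nor to
  \<open>\<phi>\<^sub>2\<close>, their masses being \<open>0\<close>.\<close>
lemma in_Nbhd_reduced: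
  fixes P :: "('n::finite, 'm::{finite,linorder}, 'q::finite) sisdp_data"
  assumes P: "sisdp P" and \<sigma>: "0 < \<sigma>" and R: "local_reduction P \<sigma> xb U B" and x: "x \<in> U"
    and C3: "\<And>i. i \<in> B \<Longrightarrow> ck_on 3 (ghat P i) U" and y: "\<And>i. i \<in> B \<Longrightarrow> 0 \<le> y i"
    and Pd: "V \<in> Pd" "Fmap P x \<in> Pd" and I: "I \<subseteq> B" and y0: "\<And>i. i \<in> B - I \<Longrightarrow> y i = 0 \<and> ghat P i x \<le> 0"
    and small: "(\<Sum>i\<in>I. \<bar>ghat P i x\<bar>) + norm (stationarity P B x y V) + (\<Sum>i\<in>I. \<bar>y i * ghat P i x\<bar>)
      + norm (jprod (Fmap P x) V - \<mu> *\<^sub>R mat 1) \<le> \<epsilon>"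
  shows "in_Nbhd P U B \<mu> \<epsilon> (x, y, V)"
proof -
  have fB: "finite B" using R by (simp add: local_reduction_def)
  have fI: "finite I" using fB I finite_subset by blast
  obtain Y where Y: "as_measure (Tset P) B (x, y, V) = (x, Y, V)" by (simp add: as_measure_def)
  note ph = phi_as_measure[where V = V and y = y, OF P R x C3 y, unfolded Y]
  have g0: "0 \<le> (\<Sum>i\<in>I. \<bar>ghat P i x\<bar>)" by (simp add: sum_nonneg)
  have th: "theta P x \<le> (\<Sum>i\<in>I. \<bar>ghat P i x\<bar>)"
  proof (rule theta_leI[OF P g0])
    fix \<tau> assume "\<tau> \<in> Tset P"
    then obtain i where i: "i \<in> B" "con P x \<tau> \<le> ghat P i x" using local_reduction_max[OF P \<sigma> R x] by blast
    show "con P x \<tau> \<le> (\<Sum>i\<in>I. \<bar>ghat P i x\<bar>)"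
    proof (cases "i \<in> I")
      case True
      then have "\<bar>ghat P i x\<bar> \<le> (\<Sum>i\<in>I. \<bar>ghat P i x\<bar>)" using fI by (intro member_le_sum) auto
      then show ?thesis using i(2) by linarith
    next
      case False
      then have "ghat P i x \<le> 0" using y0[of i] i(1) by simp
      then show ?thesis using i(2) g0 by linarith
    qed
  qed
  have "(\<Sum>i\<in>B. y i * ghat P i x) = (\<Sum>i\<in>I. y i * ghat P i x)"
    using I fB y0 by (intro sum.mono_neutral_right) auto
  then have "phi2 P (x, Y, V) = (\<Sum>i\<in>I. y i * ghat P i x)"
    using ph(2) by simp
  then have p2: "\<bar>phi2 P (x, Y, V)\<bar> \<le> (\<Sum>i\<in>I. \<bar>y i * ghat P i x\<bar>)" by (simp add: sum_abs)
  have "Rres P \<mu> (x, Y, V) \<le> \<epsilon>"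
    using Rres_le_sum[of P \<mu> "(x, Y, V)"] th theta_nonneg[OF P, of x] p2 small ph(1)
      norm_phi3[OF P Pd_Sym[OF Pd(1)], of \<mu> x Y] by simp
  then show ?thesis
    using x y Pd ph(3) by (simp add: in_Nbhd_def Y Nbhd_def)
qed

lemma exponent_condition:
  assumes v: "valid_param p" and ct: "1/2 < ct" "ct < (1 - cexp p) / (1 + cexp p * alpha p)"
  shows "cexp p * (alpha p + 2) < 1" "cexp p < 1"
proof -
  have p: "0 < cexp p" "0 < alpha p" using v by (auto simp: valid_param_def)
  then have "0 < 1 + cexp p * alpha p" by (simp add: add_pos_pos)
  moreover have "1/2 < (1 - cexp p) / (1 + cexp p * alpha p)" using ct by linarith
  ultimately have "1 + cexp p * alpha p < 2 * (1 - cexp p)" by (simp add: field_simps)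
  then show *: "cexp p * (alpha p + 2) < 1" by (simp add: algebra_simps)
  have "cexp p * 1 \<le> cexp p * (alpha p + 2)" using p by (intro mult_left_mono) auto
  then show "cexp p < 1" using * by simp
qed

text \<open>All comparisons between \<open>\<mu>\<^sub>k\<close>, \<open>\<mu>\<^sub>k\<^sub>+\<^sub>1\<close> and \<open>N\<^sub>k = \<mu>\<^sub>k\<^sup>1\<^sup>+\<^sup>\<alpha>\<close> that the two steps use.\<close>
lemma barrier_rates:
  assumes v: "valid_param p" and c: "cexp p * (alpha p + 2) < 1" "cexp p < 1"
    and N_def: "\<And>k. N k = mu p k powr (1 + alpha p)"
  shows "N \<in> o(mu p)" "N \<in> o(\<lambda>k. mu p (Suc k))" "N \<longlonglongrightarrow> 0"
    "(\<lambda>k. (mu p k)\<^sup>2) \<in> O(N)" "(\<lambda>k. (mu p k)\<^sup>2 + N k / mu p k * mu p k) \<in> O(N)"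
    "(\<lambda>k. (N k)\<^sup>2 + N k / mu p (Suc k) * N k) \<in> O(\<lambda>k. (N k)\<^sup>2 / mu p (Suc k))"
    "(\<lambda>k. (N k)\<^sup>2 + N k / mu p (Suc k) * N k) \<in> o(\<lambda>k. mu p (Suc k))"
    "(\<lambda>k. (N k)\<^sup>2 + N k / mu p (Suc k) * N k) \<in> o(\<lambda>k. mu p (Suc k) powr (1 + alpha p))"
    "(\<lambda>k. (N k)\<^sup>2) \<in> O(\<lambda>k. (N k)\<^sup>2 + N k / mu p (Suc k) * N k)"
proof -
  have a: "0 < alpha p" "alpha p < 1" using v by (auto simp: valid_param_def)
  have mp: "mu p k > 0" for k using mu_pos[OF v] .
  have Np: "N k > 0" for k using mp[of k] by (simp add: N_def)
  have le1: "\<forall>\<^sub>F k in sequentially. mu p k \<le> 1"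
    using order_tendstoD(2)[OF mu_tendsto_0[OF v], of 1] by (auto elim: eventually_mono)
  have N_abs: "N = (\<lambda>k. mu p k powr (1 + alpha p))" by (simp add: N_def fun_eq_iff)
  show N0: "N \<longlonglongrightarrow> 0" unfolding N_abs using a by (intro mu_powr_tendsto_0[OF v]) auto
  show "N \<in> o(mu p)"
  proof (rule smalloI_tendsto)
    have "N k / mu p k = mu p k powr alpha p" for k using mp[of k] by (simp add: N_def powr_add)
    then show "(\<lambda>k. N k / mu p k) \<longlonglongrightarrow> 0" using mu_powr_tendsto_0[OF v a(1)] by simp
    show "\<forall>\<^sub>F k in sequentially. mu p k \<noteq> 0" using mp by (simp add: less_imp_neq[symmetric])
  qed
  show Nm: "N \<in> o(\<lambda>k. mu p (Suc k))"
  proof (rule smalloI_tendsto)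
    show "(\<lambda>k. N k / mu p (Suc k)) \<longlonglongrightarrow> 0" unfolding N_def by (rule mu_ratio_predictor[OF v c(2)])
    show "\<forall>\<^sub>F k in sequentially. mu p (Suc k) \<noteq> 0" using mp by (simp add: less_imp_neq[symmetric] del: mu.simps)
  qed
  show sqN: "(\<lambda>k. (mu p k)\<^sup>2) \<in> O(N)"
  proof (rule bigo_of_le[of _ 1])
    show "\<forall>\<^sub>F k in sequentially. 0 \<le> (mu p k)\<^sup>2 \<and> (mu p k)\<^sup>2 \<le> 1 * N k"
      using le1
    proof eventually_elim
      case (elim k)
      have "(mu p k)\<^sup>2 = mu p k powr 2" using mp[of k] by simp
      also have "\<dots> \<le> N k" unfolding N_def using a elim mp[of k] by (intro powr_mono') auto
      finally show ?case by simp
    qed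
  qed
  show "(\<lambda>k. (mu p k)\<^sup>2 + N k / mu p k * mu p k) \<in> O(N)"
  proof (rule sum_in_bigo)
    have "N k / mu p k * mu p k = N k" for k using mp[of k] by simp
    then show "(\<lambda>k. N k / mu p k * mu p k) \<in> O(N)" by simp
  qed (rule sqN)
  show O2: "(\<lambda>k. (N k)\<^sup>2 + N k / mu p (Suc k) * N k) \<in> O(\<lambda>k. (N k)\<^sup>2 / mu p (Suc k))"
  proof (rule bigo_of_le[of _ 2])
    have "\<forall>\<^sub>F k in sequentially. mu p (Suc k) \<le> 1" 
      by (rule eventually_sequentially_Suc[of "\<lambda>k. mu p k \<le> 1", THEN iffD2, OF le1])
    then show "\<forall>\<^sub>F k in sequentially. 0 \<le> (N k)\<^sup>2 + N k / mu p (Suc k) * N k \<and>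
        (N k)\<^sup>2 + N k / mu p (Suc k) * N k \<le> 2 * ((N k)\<^sup>2 / mu p (Suc k))"
    proof eventually_elim
      case (elim k)
      have "(N k)\<^sup>2 * mu p (Suc k) \<le> (N k)\<^sup>2 * 1" using elim by (intro mult_left_mono) auto
      then have "(N k)\<^sup>2 \<le> (N k)\<^sup>2 / mu p (Suc k)" using mp[of "Suc k"] by (simp add: pos_le_divide_eq del: mu.simps)
      moreover have "0 \<le> N k / mu p (Suc k) * N k" using Np[of k] mp[of "Suc k"] by (simp del: mu.simps)
      ultimately show ?case by (simp add: power2_eq_square del: mu.simps)
    qed
  qed
  show "(\<lambda>k. (N k)\<^sup>2 + N k / mu p (Suc k) * N k) \<in> o(\<lambda>k. mu p (Suc k) powr (1 + alpha p))"
  proof (rule landau_o.big_small_trans[OF O2], rule smalloI_tendsto)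
    show "(\<lambda>k. (N k)\<^sup>2 / mu p (Suc k) / mu p (Suc k) powr (1 + alpha p)) \<longlonglongrightarrow> 0"
      unfolding N_def by (rule mu_ratio_corrector[OF v c(1)])
    show "\<forall>\<^sub>F k in sequentially. mu p (Suc k) powr (1 + alpha p) \<noteq> 0"
      using mp by (simp add: less_imp_neq[symmetric] del: mu.simps)
  qed
  show "(\<lambda>k. (N k)\<^sup>2 + N k / mu p (Suc k) * N k) \<in> o(\<lambda>k. mu p (Suc k))"
  proof -
    have "(\<lambda>k. N k / mu p (Suc k)) \<longlonglongrightarrow> 0" unfolding N_def by (rule mu_ratio_predictor[OF v c(2)])
    then have "(\<lambda>k. (N k + N k / mu p (Suc k)) * (N k / mu p (Suc k))) \<longlonglongrightarrow> 0"
      using tendsto_mult[OF tendsto_add[OF N0]] by fastforce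
    moreover have "((N k)\<^sup>2 + N k / mu p (Suc k) * N k) / mu p (Suc k) = (N k + N k / mu p (Suc k)) * (N k / mu p (Suc k))" for k
      by (simp add: power2_eq_square field_simps del: mu.simps)
    ultimately show ?thesis using mp by (intro smalloI_tendsto) (simp_all add: less_imp_neq[symmetric] del: mu.simps)
  qed
  show "(\<lambda>k. (N k)\<^sup>2) \<in> O(\<lambda>k. (N k)\<^sup>2 + N k / mu p (Suc k) * N k)"
    using Np mp by (intro bigo_of_le[of _ 1] always_eventually allI) (simp add: less_imp_le del: mu.simps)
qed

text \<open>In the proof all sequences are indexed by \<open>k\<close> such that the iterate is \<open>w (Suc k)\<close>: that iterate lies in the
  neighborhood of \<open>mu p k\<close>, and its directions aim at \<open>mu p (Suc k)\<close>.\<close>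
theorem proposition7:
  fixes P :: "('n::finite, 'm::{finite,linorder}, 'q::finite) sisdp_data"
    and p :: alg_param and \<sigma> ct :: real
    and U :: "real^'n \<Rightarrow> (real^'n) set" and B :: "real^'n \<Rightarrow> ('n, 'q) branch set"
    and w :: "nat \<Rightarrow> ('n, 'm, 'q) mtriple" and ws :: "('n, 'm, 'q) mtriple"
    and dh d1 :: "nat \<Rightarrow> ('n, 'm, 'q) vtriple"
  assumes "sisdp P" and "valid_param p" and "0 < \<sigma>"
    and "1/2 < ct" and "ct < (1 - cexp p) / (1 + cexp p * alpha p)"
    and "\<And>x. nondegenerate P \<sigma> x \<Longrightarrow> local_reduction P \<sigma> x (U x) (B x)"
    and "generated_by_algorithm P \<sigma> p U B w dh d1"
    and "assumption_B P \<sigma> U B w ws"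
    and "assumption_C P U B w dh ws"
  shows "(\<forall>\<^sub>F k in sequentially. corrector_solution P p U B w dh k (d1 k) \<and> s_one P p w dh d1 k = 1) \<and>
         (\<forall>\<^sub>F k in sequentially.
            in_Nbhd P (U (fst (w k))) (B (fst (w k))) (mu p k) (eps p k)
              (vstep (w_half P p w dh k) 1 (d1 k))) \<and>
         (\<lambda>k. vdist (B (fst ws)) (vstep (w_half P p w dh k) 1 (d1 k)) (masses ws))
           \<in> O(\<lambda>k. vdist (B (fst ws)) (w_half P p w dh k) (masses ws))"
proof -
  note P = assms(1) and v = assms(2)
  define xs where "xs = fst ws"
  define ys where "ys = (\<lambda>i. measure (fst (snd ws)) {i xs})"
  define Vs where "Vs = snd (snd ws)"
  define Us where "Us = U xs"
  define Bs where "Bs = B xs"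
  define I where "I = I_act P B xs"
  have zs: "masses ws = (xs, ys, Vs)" by (simp add: masses_def xs_def ys_def Vs_def case_prod_unfold)
  define x where "x k = fst (w (Suc k))" for k
  define ym where "ym k = fst (snd (w (Suc k)))" for k
  define V where "V k = snd (snd (w (Suc k)))" for k
  define y where "y k = (\<lambda>i. measure (ym k) {i (x k)})" for k
  have wk: "w (Suc k) = (x k, ym k, V k)" for k by (simp add: x_def ym_def V_def)
  have zk: "masses (w (Suc k)) = (x k, y k, V k)" for k by (simp add: wk masses_def y_def)
  define N where "N k = mu p k powr (1 + alpha p)" for k
  note exps = exponent_condition[OF v assms(4,5)]
  note rates = barrier_rates[of p N, OF v exps N_def]
  have mp: "mu p k > 0" for k by (rule mu_pos[OF v])
  have g1: "gamma1 p > 0" using v by (simp add: valid_param_def)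
  have Np: "N k > 0" for k using mp[of k] by (simp add: N_def)

  have kkt: "kkt_point P ws" and nondeg: "nondegenerate P \<sigma> xs"
    and vd: "(\<lambda>k. vdist Bs (masses (w k)) (xs, ys, Vs)) \<longlonglongrightarrow> 0"
    using assms(8) by (auto simp: assumption_B_def xs_def Bs_def zs[unfolded xs_def])
  have ev0: "\<forall>\<^sub>F k in sequentially. U (fst (w k)) = Us \<and> B (fst (w k)) = Bs \<and>
        (AE \<tau> in fst (snd (w k)). \<tau> \<in> supp (Tset P) (fst (snd (w k)))) \<and>
        supp (Tset P) (fst (snd (w k))) \<subseteq> (\<lambda>i. i (fst (w k))) ` Bs"
    using assms(8) by (simp add: assumption_B_def xs_def Us_def Bs_def)
  have R: "local_reduction P \<sigma> xs Us Bs" unfolding Us_def Bs_def by (rule assms(6)[OF nondeg])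
  have Us: "open Us" "xs \<in> Us" and Bs: "finite Bs" and iT: "\<And>i x. i \<in> Bs \<Longrightarrow> x \<in> Us \<Longrightarrow> i x \<in> Tset P"
    using R by (auto simp: local_reduction_def)
  have IB: "I \<subseteq> Bs" and I_iff: "\<And>i. i \<in> Bs \<Longrightarrow> i \<in> I \<longleftrightarrow> ghat P i xs = 0" by (auto simp: I_def I_act_def Bs_def)
  have fI: "finite I" using Bs IB finite_subset by blast
  have obj3: "ck_on 3 (obj P) UNIV" and gh3: "\<And>i. i \<in> Bs \<Longrightarrow> ck_on 3 (ghat P i) Us"
    and Jact: "\<forall>\<^sub>F k in sequentially. J_act P B w dh k = I"
    and sc: "\<And>i. i \<in> Bs \<Longrightarrow> - ghat P i xs + ys i > 0"
    and nonsing: "Phi0_jacobian_nonsingular P I (xs, ys, Vs)"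
    using assms(9) by (auto simp: assumption_C_def xs_def[symmetric] Us_def Bs_def I_def zs)
  have gh_cont: "(\<lambda>k. ghat P i (u k)) \<longlonglongrightarrow> ghat P i xs" if "i \<in> Bs" "u \<longlonglongrightarrow> xs" for i and u :: "nat \<Rightarrow> real^'n"
  proof -
    have "isCont (ghat P i) xs"
      by (rule differentiable_imp_continuous_within[OF ck3_differentiable(1)[OF Us gh3[OF that(1)]]])
    then show ?thesis using that(2) by (rule isCont_tendsto_compose)
  qed
  have Vs: "Vs \<in> Sym" and FVs: "jprod (Fmap P xs) Vs = 0" and feas: "\<And>\<tau>. \<tau> \<in> Tset P \<Longrightarrow> con P xs \<tau> \<le> 0"
    using kkt by (auto simp: kkt_point_def Psd_def xs_def Vs_def case_prod_unfold)
  have gh_neg: "ghat P i xs < 0" if "i \<in> Bs - I" for i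
    using that feas[OF iT[OF _ Us(2)]] I_iff[of i] by (auto simp: ghat_def less_le)

  (* both branches of the algorithm end in the neighborhood *)
  have nb: "w (Suc k) \<in> Nbhd P (mu p k) (eps p k)" for k
  proof -
    have "if corrector_solution P p U B w dh k (d1 k) \<and>
            in_Nbhd P (U (fst (w k))) (B (fst (w k))) (mu p k) (eps p k) (w_trial P p w dh d1 k)
         then w (Suc k) = as_measure (Tset P) (B (fst (w k))) (w_trial P p w dh d1 k)
         else w (Suc k) \<in> Nbhd P (mu p k) (eps p k)"
      using assms(7) unfolding generated_by_algorithm_def by blast
    then show ?thesis by (auto simp: in_Nbhd_def split: if_splits)
  qed
  have vdS: "(\<lambda>k. vdist Bs (x k, y k, V k) (xs, ys, Vs)) \<longlonglongrightarrow> 0"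
    using LIMSEQ_Suc[OF vd] by (simp add: zk)
  note vc = vdist_components[OF Bs]
  have V_Sym: "V k \<in> Sym" for k using nb[of k] by (auto simp: wk Nbhd_def Pd_Sym)
  have xl: "x \<longlonglongrightarrow> xs"
  proof (rule LIM_zero_cancel, rule Lim_null_comparison[OF always_eventually vdS], rule allI)
    show "norm (x k - xs) \<le> vdist Bs (x k, y k, V k) (xs, ys, Vs)" for k by (rule vc)
  qed
  have yl: "(\<lambda>k. y k i) \<longlonglongrightarrow> ys i" if "i \<in> Bs" for i
  proof (rule LIM_zero_cancel, rule Lim_null_comparison[OF always_eventually vdS], rule allI)
    show "norm (y k i - ys i) \<le> vdist Bs (x k, y k, V k) (xs, ys, Vs)" for k
      unfolding real_norm_def by (rule vc(2)[OF that])
  qed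
  have Vl: "V \<longlonglongrightarrow> Vs"
  proof (rule LIM_zero_cancel, rule Lim_null_comparison[OF always_eventually vdS], rule allI)
    show "norm (V k - Vs) \<le> vdist Bs (x k, y k, V k) (xs, ys, Vs)" for k
      using vc(3)[of "V k" Vs] norm_svec[OF subspace_diff[OF subspace_Sym V_Sym Vs]] by simp
  qed
  have ev1: "\<forall>\<^sub>F k in sequentially. U (x k) = Us \<and> B (x k) = Bs \<and> x k \<in> Us \<and>
        (AE \<tau> in ym k. \<tau> \<in> supp (Tset P) (ym k)) \<and> supp (Tset P) (ym k) \<subseteq> (\<lambda>i. i (x k)) ` Bs \<and>
        J_act P B w dh (Suc k) = I"
  proof -
    have "\<forall>\<^sub>F k in sequentially. U (fst (w (Suc k))) = Us \<and> B (fst (w (Suc k))) = Bs \<and>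
        (AE \<tau> in fst (snd (w (Suc k))). \<tau> \<in> supp (Tset P) (fst (snd (w (Suc k))))) \<and>
        supp (Tset P) (fst (snd (w (Suc k)))) \<subseteq> (\<lambda>i. i (fst (w (Suc k)))) ` Bs"
      using ev0 by (rule eventually_sequentially_Suc[THEN iffD2])
    moreover have "\<forall>\<^sub>F k in sequentially. J_act P B w dh (Suc k) = I"
      using Jact by (rule eventually_sequentially_Suc[THEN iffD2])
    moreover have "\<forall>\<^sub>F k in sequentially. x k \<in> Us" by (rule topological_tendstoD[OF xl Us])
    ultimately show ?thesis by eventually_elim (unfold x_def ym_def, blast)
  qed
  have red: "\<forall>\<^sub>F k in sequentially. V k \<in> Pd \<and> Fmap P (x k) \<in> Pd \<and>
      norm (stationarity P Bs (x k) (y k) (V k)) \<le> gamma1 p * N k \<and>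
      (\<forall>i\<in>Bs. \<bar>y k i * ghat P i (x k)\<bar> \<le> (1 + (\<Sum>i\<in>Bs. y k i)) * (gamma1 p * N k)) \<and>
      norm (jprod (Fmap P (x k)) (V k) - mu p k *\<^sub>R mat 1) \<le> gamma1 p * N k"
    using ev1
  proof eventually_elim
    case (elim k)
    have "(x k, ym k, V k) \<in> Nbhd P (mu p k) (gamma1 p * N k)"
      using nb[of k] by (simp add: wk eps_def N_def)
    moreover have "x k \<in> Us" "AE \<tau> in ym k. \<tau> \<in> supp (Tset P) (ym k)"
      "supp (Tset P) (ym k) \<subseteq> (\<lambda>i. i (x k)) ` Bs" using elim by blast+
    ultimately show ?case
      unfolding y_def using Nbhd_reduced[OF P R _ gh3, of "x k" "ym k" "V k" "mu p k" "gamma1 p * N k"] by blast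
  qed

  have stO: "(\<lambda>k. norm (stationarity P Bs (x k) (y k) (V k))) \<in> O(N)"
    by (rule bigo_of_le[of _ "gamma1 p"]) (use red in \<open>auto elim: eventually_mono\<close>)
  have EO: "(\<lambda>k. norm (jprod (Fmap P (x k)) (V k) - mu p k *\<^sub>R mat 1)) \<in> O(N)"
    by (rule bigo_of_le[of _ "gamma1 p"]) (use red in \<open>auto elim: eventually_mono\<close>)
  have prodO: "(\<lambda>k. y k i * ghat P i (x k)) \<in> O(N)" if i: "i \<in> Bs" for i
  proof -
    have "(\<lambda>k. \<Sum>i\<in>Bs. y k i) \<longlonglongrightarrow> (\<Sum>i\<in>Bs. ys i)" by (intro tendsto_sum yl)
    then have "\<forall>\<^sub>F k in sequentially. (\<Sum>i\<in>Bs. y k i) < (\<Sum>i\<in>Bs. ys i) + 1" by (rule order_tendstoD) simp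
    then have "\<forall>\<^sub>F k in sequentially. 0 \<le> \<bar>y k i * ghat P i (x k)\<bar> \<and>
       \<bar>y k i * ghat P i (x k)\<bar> \<le> ((2 + (\<Sum>i\<in>Bs. ys i)) * gamma1 p) * N k"
      using red
    proof eventually_elim
      case (elim k)
      have "\<bar>y k i * ghat P i (x k)\<bar> \<le> (1 + (\<Sum>i\<in>Bs. y k i)) * (gamma1 p * N k)" using elim(2) i by blast
      also have "\<dots> \<le> (2 + (\<Sum>i\<in>Bs. ys i)) * (gamma1 p * N k)"
        using elim(1) g1 Np[of k] by (intro mult_right_mono) auto
      finally show ?case by (simp add: mult.assoc)
    qed
    then have "(\<lambda>k. \<bar>y k i * ghat P i (x k)\<bar>) \<in> O(N)" by (rule bigo_of_le)
    then show ?thesis by simp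
  qed
  have ys_pos: "ys i > 0" if "i \<in> I" for i using sc[of i] I_iff[of i] that IB by auto
  (* complementarity is O(N); dividing by the factor with nonzero limit bounds the other factor *)
  have ghO: "(\<lambda>k. ghat P i (x k)) \<in> O(N)" if i: "i \<in> I" for i
  proof (rule bigo_cancel[of _ "\<lambda>k. y k i"])
    show "(\<lambda>k. ghat P i (x k) * y k i) \<in> O(N)" using prodO[of i] i IB by (simp add: mult.commute subset_eq)
    show "(\<lambda>k. y k i) \<longlonglongrightarrow> ys i" using yl i IB by blast
    show "ys i \<noteq> 0" using ys_pos[OF i] by simp
  qed
  have yO: "(\<lambda>k. y k i) \<in> O(N)" if i: "i \<in> Bs - I" for i
  proof (rule bigo_cancel[OF _ gh_cont[OF _ xl]])
    show "(\<lambda>k. y k i * ghat P i (x k)) \<in> O(N)" "i \<in> Bs" using prodO[of i] i by blast+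
    show "ghat P i xs \<noteq> 0" using gh_neg[OF i] by simp
  qed
  have inactive: "ys i = 0" if i: "i \<in> Bs - I" for i
    using LIMSEQ_unique[OF yl bigo_vanishing[OF yO[OF i] rates(3)]] i by blast

  interpret rs: reduced_system P Us Bs I xs ys Vs
    by (unfold_locales; (fact P Us Bs IB obj3 gh3 inactive Vs nonsing)?)

  (* the change of the target from mu p k to mu p (Suc k) dominates the residual of the predictor *)
  let ?m = "\<lambda>k. mu p (Suc k)"
  have NO: "N \<in> O(mu p)" by (rule landau_o.small_imp_big[OF rates(1)])
  have Pd0: "\<forall>\<^sub>F k in sequentially. Fmap P (x k) \<in> Pd \<and> V k \<in> Pd \<and> 0 < mu p k"
    using red by eventually_elim (simp add: mp)
  have mle: "\<forall>\<^sub>F k in sequentially. 0 < ?m k \<and> ?m k \<le> mu p k"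
    using mp mu_Suc_le[OF v] by (intro always_eventually) blast
  have nn0: "\<forall>\<^sub>F k in sequentially. 0 \<le> N k \<and> 0 \<le> mu p k"
    using mp Np by (intro always_eventually) (simp add: less_imp_le)
  have sumO: "(\<lambda>k. \<Sum>i\<in>J. \<bar>f i k\<bar>) \<in> O(h)" if "\<And>i. i \<in> J \<Longrightarrow> f i \<in> O(h)" for J :: "('n, 'q) branch set" and f and h :: "nat \<Rightarrow> real"
    by (rule big_sum_in_bigo) (use that in simp)
  have res0: "(\<lambda>k. rs.residual (?m k) (x k) (y k) (V k)) \<in> O(mu p)"
    unfolding rs.residual_def
  proof (intro sum_in_bigo)
    show "(\<lambda>k. norm (stationarity P Bs (x k) (y k) (V k))) \<in> O(mu p)" by (rule landau_o.big_trans[OF stO NO])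
    show "(\<lambda>k. \<Sum>i\<in>I. \<bar>ghat P i (x k)\<bar>) \<in> O(mu p)" by (rule landau_o.big_trans[OF sumO[OF ghO] NO])
    show "(\<lambda>k. \<Sum>i\<in>Bs - I. \<bar>y k i\<bar>) \<in> O(mu p)" by (rule landau_o.big_trans[OF sumO[OF yO] NO])
    have "(\<lambda>k. norm (jprod (Fmap P (x k)) (V k) - mu p k *\<^sub>R mat 1) + mu p k * norm (mat 1 :: ((real, 'm) vec, 'm) vec)) \<in> O(mu p)"
      by (rule sum_in_bigo[OF landau_o.big_trans[OF EO NO]]) simp
    then show "(\<lambda>k. norm (jprod (Fmap P (x k)) (V k) - ?m k *\<^sub>R mat 1)) \<in> O(mu p)"
    proof (rule bigo_le, intro always_eventually allI conjI norm_ge_zero)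
      fix k
      have "norm (jprod (Fmap P (x k)) (V k) - ?m k *\<^sub>R mat 1)
         = norm ((jprod (Fmap P (x k)) (V k) - mu p k *\<^sub>R mat 1) + (mu p k - ?m k) *\<^sub>R mat 1)"
        by (simp add: algebra_simps del: mu.simps)
      also have "\<dots> \<le> norm (jprod (Fmap P (x k)) (V k) - mu p k *\<^sub>R mat 1) + norm ((mu p k - ?m k) *\<^sub>R (mat 1 :: ((real, 'm) vec, 'm) vec))"
        by (rule norm_triangle_ineq)
      also have "norm ((mu p k - ?m k) *\<^sub>R (mat 1 :: ((real, 'm) vec, 'm) vec)) \<le> mu p k * norm (mat 1 :: ((real, 'm) vec, 'm) vec)"
        unfolding norm_scaleR using mu_Suc_le[OF v, of k] mp[of "Suc k"] by (intro mult_right_mono) (auto simp del: mu.simps)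
      finally show "norm (jprod (Fmap P (x k)) (V k) - ?m k *\<^sub>R mat 1)
         \<le> norm (jprod (Fmap P (x k)) (V k) - mu p k *\<^sub>R mat 1) + mu p k * norm (mat 1 :: ((real, 'm) vec, 'm) vec)"
        by simp
    qed
  qed
  define dx where "dx k = fst (dh (Suc k))" for k
  define dy where "dy k = fst (snd (dh (Suc k)))" for k
  define dV where "dV k = snd (snd (dh (Suc k)))" for k
  have dhk: "dh (Suc k) = (dx k, dy k, dV k)" for k by (simp add: dx_def dy_def dV_def)
  have cs0: "\<forall>\<^sub>F k in sequentially. corrector_sys P Bs I (?m k) (x k, y k, V k) (dx k, dy k, dV k)"
    using ev1
  proof eventually_elim
    case (elim k)
    have pr: "predictor_sys P (B (fst (w (Suc k)))) (?m k) (masses (w (Suc k))) (dh (Suc k))"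
      using assms(7) unfolding generated_by_algorithm_def by blast
    have J: "J_act P B w dh (Suc k) = {i \<in> Bs. lin_ghat P (x k) (dx k) i = 0}"
      using elim by (simp add: J_act_def wk dhk)
    show ?case
      using predictor_imp_corrector[OF Bs, of P "?m k" "(x k, y k, V k)" "(dx k, dy k, dV k)"] pr J elim
      by (simp add: wk zk[unfolded wk] dhk del: mu.simps)
  qed
  have ylB: "\<forall>i\<in>Bs. (\<lambda>k. y k i) \<longlonglongrightarrow> ys i" using yl by blast
  note pred = rs.newton_step_asymptotics(2)[where \<delta> = "delta p", OF xl ylB Vl Pd0 EO rates(1) res0 mu_tendsto_0[OF v] nn0 cs0 mle rates(2)
     landau_o.big_small_trans[OF rates(5) rates(2)]]
  define xh where "xh k = x k + dx k" for k
  define yh where "yh k = (\<lambda>i. y k i + dy k i)" for k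
  define Vh where "Vh k = V k + dV k" for k
  have sth: "(\<lambda>k. norm (stationarity P Bs (xh k) (yh k) (Vh k))) \<in> O(\<lambda>k. (mu p k)\<^sup>2)"
    and ghh: "\<And>i. i \<in> I \<Longrightarrow> (\<lambda>k. ghat P i (xh k)) \<in> O(\<lambda>k. (mu p k)\<^sup>2)"
    and Eh: "(\<lambda>k. norm (jprod (Fmap P (xh k)) (Vh k) - ?m k *\<^sub>R mat 1)) \<in> O(\<lambda>k. (mu p k)\<^sup>2 + N k / mu p k * mu p k)"
    and evh: "\<forall>\<^sub>F k in sequentially. (\<forall>i\<in>Bs - I. yh k i = 0) \<and> Fmap P (xh k) \<in> Pd \<and> Vh k \<in> Pd \<and>
          step_size P (delta p) (x k, y k, V k) (dx k, dy k, dV k) = 1"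
    and xhl: "xh \<longlonglongrightarrow> xs" and yhl: "\<And>i. i \<in> Bs \<Longrightarrow> (\<lambda>k. yh k i) \<longlonglongrightarrow> ys i" and Vhl: "Vh \<longlonglongrightarrow> Vs"
    using pred unfolding xh_def[abs_def] yh_def[abs_def] Vh_def[abs_def] by blast+
  have half: "\<forall>\<^sub>F k in sequentially. w_half P p w dh (Suc k) = (xh k, yh k, Vh k)"
    using evh by eventually_elim (simp add: w_half_def zk dhk vstep_def xh_def yh_def Vh_def)

  (* after the predictor every part of the residual is O(N), which the corrector takes as input *)
  have EhN: "(\<lambda>k. norm (jprod (Fmap P (xh k)) (Vh k) - ?m k *\<^sub>R mat 1)) \<in> O(N)"
    by (rule landau_o.big_trans[OF Eh rates(5)])
  have resh: "(\<lambda>k. rs.residual (?m k) (xh k) (yh k) (Vh k)) \<in> O(N)"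
    unfolding rs.residual_def
  proof (intro sum_in_bigo)
    show "(\<lambda>k. norm (stationarity P Bs (xh k) (yh k) (Vh k))) \<in> O(N)" by (rule landau_o.big_trans[OF sth rates(4)])
    show "(\<lambda>k. \<Sum>i\<in>I. \<bar>ghat P i (xh k)\<bar>) \<in> O(N)" by (rule landau_o.big_trans[OF sumO[OF ghh] rates(4)])
    show "(\<lambda>k. \<Sum>i\<in>Bs - I. \<bar>yh k i\<bar>) \<in> O(N)"
    proof (rule bigo_of_le[of _ 1])
      show "\<forall>\<^sub>F k in sequentially. 0 \<le> (\<Sum>i\<in>Bs - I. \<bar>yh k i\<bar>) \<and> (\<Sum>i\<in>Bs - I. \<bar>yh k i\<bar>) \<le> 1 * N k"
        using evh by eventually_elim (simp add: Np less_imp_le)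
    qed
    show "(\<lambda>k. norm (jprod (Fmap P (xh k)) (Vh k) - ?m k *\<^sub>R mat 1)) \<in> O(N)" by (rule EhN)
  qed
  have Pdh: "\<forall>\<^sub>F k in sequentially. Fmap P (xh k) \<in> Pd \<and> Vh k \<in> Pd \<and> 0 < ?m k"
    using evh mle by eventually_elim blast
  have nnh: "\<forall>\<^sub>F k in sequentially. 0 \<le> N k \<and> 0 \<le> N k" using Np by (simp add: less_imp_le)
  have yhlB: "\<forall>i\<in>Bs. (\<lambda>k. yh k i) \<longlonglongrightarrow> ys i" using yhl by blast
  note corr = rs.newton_step_asymptotics[OF xhl yhlB Vhl Pdh EhN rates(2) resh rates(3) nnh]
  have xhU: "\<forall>\<^sub>F k in sequentially. xh k \<in> Us" by (rule topological_tendstoD[OF xhl Us])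
  have csol: "\<forall>\<^sub>F k in sequentially. corrector_solution P p U B w dh (Suc k) (d1 (Suc k))"
    using corr(1) half ev1 xhU
  proof eventually_elim
    case (elim k)
    obtain d where "corrector_sys P Bs I (?m k) (xh k, yh k, Vh k) d" using elim(1) by blast
    then have "corrector_solution P p U B w dh (Suc k) d"
      using elim(2-4) by (simp add: corrector_solution_def wk del: mu.simps)
    moreover have "(\<exists>d. corrector_solution P p U B w dh (Suc k) d) \<longrightarrow> corrector_solution P p U B w dh (Suc k) (d1 (Suc k))"
      using assms(7) unfolding generated_by_algorithm_def by blast
    ultimately show ?case by blast
  qed
  define ux where "ux k = fst (d1 (Suc k))" for k
  define uy where "uy k = fst (snd (d1 (Suc k)))" for k
  define uV where "uV k = snd (snd (d1 (Suc k)))" for k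
  have d1k: "d1 (Suc k) = (ux k, uy k, uV k)" for k by (simp add: ux_def uy_def uV_def)
  have cs1: "\<forall>\<^sub>F k in sequentially. corrector_sys P Bs I (?m k) (xh k, yh k, Vh k) (ux k, uy k, uV k)"
    using csol half ev1 by eventually_elim (simp add: corrector_solution_def wk d1k del: mu.simps)
  have mle': "\<forall>\<^sub>F k in sequentially. 0 < ?m k \<and> ?m k \<le> ?m k" using mp by (simp del: mu.simps)
  note corr2 = corr(2)[where \<delta> = "delta p", OF cs1 mle' rates(2) rates(7)]
  define xt where "xt k = xh k + ux k" for k
  define yt where "yt k = (\<lambda>i. yh k i + uy k i)" for k
  define Vt where "Vt k = Vh k + uV k" for k
  let ?Q = "\<lambda>k. (N k)\<^sup>2 + N k / ?m k * N k"
  have sizeO: "(\<lambda>k. dsize Bs (ux k, uy k, uV k)) \<in> O(N)"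
    and stt: "(\<lambda>k. norm (stationarity P Bs (xt k) (yt k) (Vt k))) \<in> O(\<lambda>k. (N k)\<^sup>2)"
    and ght: "\<And>i. i \<in> I \<Longrightarrow> (\<lambda>k. ghat P i (xt k)) \<in> O(\<lambda>k. (N k)\<^sup>2)"
    and Et: "(\<lambda>k. norm (jprod (Fmap P (xt k)) (Vt k) - ?m k *\<^sub>R mat 1)) \<in> O(?Q)"
    and evt: "\<forall>\<^sub>F k in sequentially. (\<forall>i\<in>Bs - I. yt k i = 0) \<and> Fmap P (xt k) \<in> Pd \<and> Vt k \<in> Pd \<and>
          step_size P (delta p) (xh k, yh k, Vh k) (ux k, uy k, uV k) = 1"
    and xtl: "xt \<longlonglongrightarrow> xs" and ytl: "\<And>i. i \<in> Bs \<Longrightarrow> (\<lambda>k. yt k i) \<longlonglongrightarrow> ys i"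
    using corr2 unfolding xt_def[abs_def] yt_def[abs_def] Vt_def[abs_def] by blast+
  have full: "\<forall>\<^sub>F k in sequentially. s_one P p w dh d1 (Suc k) = 1"
    using half evt by eventually_elim (simp add: s_one_def d1k)
  have trial: "\<forall>\<^sub>F k in sequentially. vstep (w_half P p w dh (Suc k)) 1 (d1 (Suc k)) = (xt k, yt k, Vt k)"
    using half by eventually_elim (simp add: d1k vstep_def xt_def yt_def Vt_def)

  (* a bound for the merit function at the trial point, negligible against mu p (Suc k) powr (1 + alpha p) *)
  define S where "S k = (\<Sum>i\<in>I. \<bar>ghat P i (xt k)\<bar>) + norm (stationarity P Bs (xt k) (yt k) (Vt k))
     + (\<Sum>i\<in>I. \<bar>yt k i * ghat P i (xt k)\<bar>) + norm (jprod (Fmap P (xt k)) (Vt k) - ?m k *\<^sub>R mat 1)" for k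
  have SO: "S \<in> O(?Q)"
    unfolding S_def[abs_def]
  proof (intro sum_in_bigo)
    show "(\<lambda>k. \<Sum>i\<in>I. \<bar>ghat P i (xt k)\<bar>) \<in> O(?Q)" by (rule landau_o.big_trans[OF sumO[OF ght] rates(9)])
    show "(\<lambda>k. norm (stationarity P Bs (xt k) (yt k) (Vt k))) \<in> O(?Q)" by (rule landau_o.big_trans[OF stt rates(9)])
    show "(\<lambda>k. \<Sum>i\<in>I. \<bar>yt k i * ghat P i (xt k)\<bar>) \<in> O(?Q)"
    proof (rule sumO)
      fix i assume i: "i \<in> I"
      have "(\<lambda>k. yt k i) \<in> O(\<lambda>_. 1)" by (rule bigoI_tendsto[of _ _ "ys i"]) (use ytl[of i] i IB in auto)
      from landau_o.big.mult[OF this ght[OF i]]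
      show "(\<lambda>k. yt k i * ghat P i (xt k)) \<in> O(?Q)" by (intro landau_o.big_trans[OF _ rates(9)]) simp
    qed
  qed (rule Et)
  have "\<forall>\<^sub>F k in sequentially. norm (S k) \<le> gamma1 p * norm (?m k powr (1 + alpha p))"
    by (rule landau_o.smallD[OF landau_o.big_small_trans[OF SO rates(8)] g1])
  then have Se: "\<forall>\<^sub>F k in sequentially. S k \<le> eps p (Suc k)"
    by eventually_elim (simp add: eps_def del: mu.simps)
  have ypos: "\<forall>\<^sub>F k in sequentially. \<forall>i\<in>I. 0 < yt k i"
    using fI ytl ys_pos IB by (intro eventually_ball_finite ballI order_tendstoD(1)[OF ytl]) auto
  have gneg: "\<forall>\<^sub>F k in sequentially. \<forall>i\<in>Bs - I. ghat P i (xt k) < 0"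
    using Bs gh_neg by (intro eventually_ball_finite ballI order_tendstoD(2)[OF gh_cont[OF _ xtl]]) auto
  have xtU: "\<forall>\<^sub>F k in sequentially. xt k \<in> Us" by (rule topological_tendstoD[OF xtl Us])
  have member: "\<forall>\<^sub>F k in sequentially. in_Nbhd P (U (fst (w (Suc k)))) (B (fst (w (Suc k)))) (?m k) (eps p (Suc k))
              (vstep (w_half P p w dh (Suc k)) 1 (d1 (Suc k)))"
    using trial Se ypos gneg xtU evt ev1
  proof eventually_elim
    case (elim k)
    have y0: "0 \<le> yt k i" if "i \<in> Bs" for i
      using elim(3,6) that by (cases "i \<in> I") (auto intro: less_imp_le)
    have "in_Nbhd P Us Bs (?m k) (eps p (Suc k)) (xt k, yt k, Vt k)"
    proof (rule in_Nbhd_reduced[OF P assms(3) R elim(5) gh3 y0 _ _ IB])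
      show "yt k i = 0 \<and> ghat P i (xt k) \<le> 0" if "i \<in> Bs - I" for i
        using elim(4,6) that by (auto intro: less_imp_le)
      show "(\<Sum>i\<in>I. \<bar>ghat P i (xt k)\<bar>) + norm (stationarity P Bs (xt k) (yt k) (Vt k))
         + (\<Sum>i\<in>I. \<bar>yt k i * ghat P i (xt k)\<bar>) + norm (jprod (Fmap P (xt k)) (Vt k) - ?m k *\<^sub>R mat 1) \<le> eps p (Suc k)"
        using elim(2) by (simp only: S_def)
    qed (use elim(6) in blast)+
    then show ?case using elim(1,7) by (simp add: wk del: mu.simps)
  qed

  (* F o V is close to ?m I at the half-way point and 0 at the limit, so the distance D is at least of order ?m *)
  define D where "D k = vdist Bs (xh k, yh k, Vh k) (xs, ys, Vs)" for k
  have VhS: "\<forall>\<^sub>F k in sequentially. Vh k \<in> Sym \<and> Vt k \<in> Sym"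
    using evh evt by eventually_elim (simp add: Pd_Sym)
  obtain CF where CF: "CF > 0" "\<And>h. norm (Flin P h) \<le> CF * norm h"
    using linear_bound_pos[OF linear_Flin] by blast
  have DV: "\<forall>\<^sub>F k in sequentially. norm (Vh k - Vs) \<le> D k"
    using VhS
  proof eventually_elim
    case (elim k)
    then show ?case
      using vc(3)[of "Vh k" Vs "xh k" "yh k" xs ys] norm_svec[OF subspace_diff[OF subspace_Sym _ Vs, of "Vh k"]] by (simp add: D_def)
  qed
  have mD: "?m \<in> O(D)"
  proof (rule bigo_of_le)
    have e: "\<forall>\<^sub>F k in sequentially. norm (norm (jprod (Fmap P (xh k)) (Vh k) - ?m k *\<^sub>R mat 1)) \<le> (1/2) * norm (?m k)"
      by (rule landau_o.smallD[OF landau_o.big_small_trans[OF EhN rates(2)]]) simp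
    have b: "\<forall>\<^sub>F k in sequentially. dist (Vh k) Vs < 1" by (rule tendstoD[OF Vhl]) simp
    show "\<forall>\<^sub>F k in sequentially. 0 \<le> ?m k \<and> ?m k \<le> (2 * (CF * (norm Vs + 1) + norm (Fmap P xs))) * D k"
      using e b DV
    proof eventually_elim
      case (elim k)
      have m0: "0 < ?m k" by (rule mp)
      have nV: "norm (Vh k) \<le> norm Vs + 1" using elim(2) norm_triangle_sub[of "Vh k" Vs] by (simp add: dist_norm)
      have Dx: "norm (xh k - xs) \<le> D k" unfolding D_def by (rule vc(1))
      have "jprod (Fmap P (xh k)) (Vh k) = jprod (Flin P (xh k - xs)) (Vh k) + jprod (Fmap P xs) (Vh k - Vs)"
        using FVs by (simp add: Fmap_diff[symmetric] jp.diff_left jp.diff_right)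
      then have "norm (jprod (Fmap P (xh k)) (Vh k)) \<le> norm (jprod (Flin P (xh k - xs)) (Vh k)) + norm (jprod (Fmap P xs) (Vh k - Vs))"
        by (simp only: norm_triangle_ineq)
      also have "\<dots> \<le> (CF * D k) * (norm Vs + 1) + norm (Fmap P xs) * D k"
      proof (intro add_mono order_trans[OF norm_jprod] mult_mono)
        show "norm (Flin P (xh k - xs)) \<le> CF * D k"
          using CF(2)[of "xh k - xs"] mult_left_mono[OF Dx, of CF] CF(1) by linarith
        show "0 \<le> CF * D k" using CF(1) Dx norm_ge_zero[of "xh k - xs"] by (intro mult_nonneg_nonneg) linarith+
      qed (use nV elim(3) in simp_all)
      finally have F: "norm (jprod (Fmap P (xh k)) (Vh k)) \<le> (CF * (norm Vs + 1) + norm (Fmap P xs)) * D k"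
        by (simp add: algebra_simps)
      have "?m k * 1 \<le> ?m k * norm (mat 1 :: ((real, 'm) vec, 'm) vec)" using norm_mat_1_ge m0 by (intro mult_left_mono) auto
      also have "\<dots> = norm (?m k *\<^sub>R (mat 1 :: ((real, 'm) vec, 'm) vec))" using m0 by (simp del: mu.simps)
      also have "\<dots> \<le> norm (jprod (Fmap P (xh k)) (Vh k)) + norm (jprod (Fmap P (xh k)) (Vh k) - ?m k *\<^sub>R mat 1)"
        by (metis add.commute norm_minus_commute norm_triangle_sub)
      finally have "?m k \<le> 2 * norm (jprod (Fmap P (xh k)) (Vh k))" using elim(1) m0 by (simp del: mu.simps)
      then show ?case
        using F m0 mult.assoc[of 2 "CF * (norm Vs + 1) + norm (Fmap P xs)" "D k"] by linarith
    qed
  qed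
  have dist: "(\<lambda>k. vdist Bs (xt k, yt k, Vt k) (xs, ys, Vs)) \<in> O(D)"
  proof -
    have s: "(\<lambda>k. dsize Bs (ux k, uy k, uV k)) \<in> O(D)"
      by (rule landau_o.big_trans[OF sizeO landau_o.big_trans[OF landau_o.small_imp_big[OF rates(2)] mD]])
    have "(\<lambda>k. (2 + real (card Bs)) * D k + dsize Bs (ux k, uy k, uV k)) \<in> O(D)"
      by (rule sum_in_bigo[OF _ s]) simp
    then show ?thesis
    proof (rule bigo_le)
      show "\<forall>\<^sub>F k in sequentially. 0 \<le> vdist Bs (xt k, yt k, Vt k) (xs, ys, Vs) \<and>
         vdist Bs (xt k, yt k, Vt k) (xs, ys, Vs) \<le> (2 + real (card Bs)) * D k + dsize Bs (ux k, uy k, uV k)"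
        using VhS DV
      proof eventually_elim
        case (elim k)
        have Vt: "norm (svec (Vt k - Vs)) = norm (Vt k - Vs)"
          using elim(1) by (intro norm_svec subspace_diff[OF subspace_Sym] Vs) blast
        have 1: "norm (xt k - xs) \<le> D k + norm (ux k)"
          using norm_triangle_ineq[of "xh k - xs" "ux k"] vc(1)[of "xh k" xs "yh k" "Vh k" ys Vs] by (simp add: xt_def D_def algebra_simps)
        have 2: "norm (Vt k - Vs) \<le> D k + norm (uV k)"
          using norm_triangle_ineq[of "Vh k - Vs" "uV k"] elim(2) by (simp add: Vt_def algebra_simps)
        have 3: "(\<Sum>i\<in>Bs. \<bar>yt k i - ys i\<bar>) \<le> real (card Bs) * D k + (\<Sum>i\<in>Bs. \<bar>uy k i\<bar>)"
        proof -
          have "(\<Sum>i\<in>Bs. \<bar>yt k i - ys i\<bar>) \<le> (\<Sum>i\<in>Bs. D k + \<bar>uy k i\<bar>)"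
          proof (rule sum_mono)
            fix i assume "i \<in> Bs"
            then have "\<bar>yh k i - ys i\<bar> \<le> D k" unfolding D_def by (rule vc(2))
            then show "\<bar>yt k i - ys i\<bar> \<le> D k + \<bar>uy k i\<bar>" by (simp add: yt_def)
          qed
          then show ?thesis by (simp add: sum.distrib)
        qed
        have "vdist Bs (xt k, yt k, Vt k) (xs, ys, Vs) \<le> (2 + real (card Bs)) * D k + dsize Bs (ux k, uy k, uV k)"
          using vdist_le_sum[of Bs "xt k" "yt k" "Vt k" xs ys Vs] 1 2 3 by (simp add: Vt dsize_def distrib_right)
        moreover have "0 \<le> vdist Bs (xt k, yt k, Vt k) (xs, ys, Vs)"
          by (rule order_trans[OF norm_ge_zero vc(1)])
        ultimately show ?case by blast
      qed
    qed
  qed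

  show ?thesis
  proof (intro conjI)
    have "\<forall>\<^sub>F k in sequentially. corrector_solution P p U B w dh (Suc k) (d1 (Suc k)) \<and> s_one P p w dh d1 (Suc k) = 1"
      using csol full by eventually_elim blast
    then show "\<forall>\<^sub>F k in sequentially. corrector_solution P p U B w dh k (d1 k) \<and> s_one P p w dh d1 k = 1"
      by (rule eventually_sequentially_Suc[THEN iffD1])
    show "\<forall>\<^sub>F k in sequentially. in_Nbhd P (U (fst (w k))) (B (fst (w k))) (mu p k) (eps p k)
              (vstep (w_half P p w dh k) 1 (d1 k))"
      using member by (rule eventually_sequentially_Suc[THEN iffD1])
    obtain c where c: "c > 0" "\<forall>\<^sub>F k in sequentially. norm (vdist Bs (xt k, yt k, Vt k) (xs, ys, Vs)) \<le> c * norm (D k)"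
      using landau_o.bigE[OF dist] by blast
    have "\<forall>\<^sub>F k in sequentially. norm (vdist Bs (vstep (w_half P p w dh (Suc k)) 1 (d1 (Suc k))) (masses ws))
       \<le> c * norm (vdist Bs (w_half P p w dh (Suc k)) (masses ws))"
      using c(2) trial half by eventually_elim (simp add: zs D_def)
    then have "\<forall>\<^sub>F k in sequentially. norm (vdist Bs (vstep (w_half P p w dh k) 1 (d1 k)) (masses ws))
       \<le> c * norm (vdist Bs (w_half P p w dh k) (masses ws))"
      by (rule eventually_sequentially_Suc[THEN iffD1])
    then show "(\<lambda>k. vdist (B (fst ws)) (vstep (w_half P p w dh k) 1 (d1 k)) (masses ws))
           \<in> O(\<lambda>k. vdist (B (fst ws)) (w_half P p w dh k) (masses ws))"
      unfolding Bs_def xs_def by (rule bigoI)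
  qed
qed

end
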